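(* Let $\Omega\subset\mathbb R^n$ be a Borel set with $|\Omega|<+\infty$. Suppose that for $1\le i\le N$, $f_i\in L^\infty(\Omega)$ with $f_i(x)\ge 0$ almost everywhere, and $g_i\in L^2(\Omega)$. Suppose that there is a continuous function $\widetilde F:[0,|\Omega|]^N\to\mathbb R$ such that $F(W_1,\dots,W_N)=\widetilde F(|W_1|,\dots,|W_N|)$ for all $(W_1,\dots,W_N)\in\mathcal W(\Omega)$. Then there exists $(\mathbf u_0,\mathbf W_0)\in\mathcal F(\Omega)$ such that $$J(\mathbf u_0,\mathbf W_0)\le J(\mathbf u,\mathbf W)\quad\text{for all }(\mathbf u,\mathbf W)\in\mathcal F(\Omega).$$
   Context: $n\ge1$ and $N\ge 1$ are integers; $|A|$ is the Lebesgue measure of $A$. $W^{1,2}(\mathbb R^n)$ denotes the set of functions in $L^2_{loc}(\mathbb R^n)$ whose distributional gradient lies in $L^2(\mathbb R^n)$. $\mathcal W(\Omega)$ is the set of $N$-tuples $\mathbf W=(W_1,\dots,W_N)$ of pairwise disjoint Borel subsets of $\Omega$. $\mathcal F(\Omega)$ is the set of pairs $(\mathbf u,\mathbf W)$ with $\mathbf W\in\mathcal W(\Omega)$ and $\mathbf u=(u_1,\dots,u_N)$ an $N$-tuple of real-valued functions $u_i\in W^{1,2}(\mathbb R^n)$ such that $u_i(x)=0$ for almost every $x\in\mathbb R^n\setminus W_i$. For $(\mathbf u,\mathbf W)\in\mathcal F(\Omega)$, $$J(\mathbf u,\mathbf W)=\sum_{i=1}^N\int|\nabla u_i|^2\,dx+\sum_{i=1}^N\int[u_i^2f_i-u_ig_i]\,dx+F(W_1,\dots,W_N).$$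 *)

theory Defs
  imports "HOL-Analysis.Analysis"
begin

definition partial_derivative :: "'a::euclidean_space \<Rightarrow> ('a \<Rightarrow> real) \<Rightarrow> 'a \<Rightarrow> real" where
  "partial_derivative b \<phi> x = frechet_derivative \<phi> (at x) b"

primrec continuously_differentiable :: "nat \<Rightarrow> ('a::euclidean_space \<Rightarrow> real) \<Rightarrow> bool" where
  "continuously_differentiable 0 \<phi> \<longleftrightarrow> continuous_on UNIV \<phi>"
| "continuously_differentiable (Suc k) \<phi> \<longleftrightarrow>
     \<phi> differentiable_on UNIV \<and>
     (\<forall>b\<in>Basis. continuously_differentiable k (partial_derivative b \<phi>))"

definition test_function :: "('a::euclidean_space \<Rightarrow> real) \<Rightarrow> bool" where
  "test_function \<phi> \<longleftrightarrow>
     (\<forall>k. continuously_differentiable k \<phi>) \<and> compact (closure {x. \<phi> x \<noteq> 0})"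

definition locally_L2 :: "('a::euclidean_space \<Rightarrow> real) \<Rightarrow> bool" where
  "locally_L2 u \<longleftrightarrow> u \<in> borel_measurable lebesgue \<and>
     (\<forall>K. compact K \<longrightarrow> set_integrable lebesgue K (\<lambda>x. (u x)\<^sup>2))"

definition has_weak_gradient :: "('a::euclidean_space \<Rightarrow> real) \<Rightarrow> ('a \<Rightarrow> 'a) \<Rightarrow> bool" where
  "has_weak_gradient u G \<longleftrightarrow>
     G \<in> borel_measurable lebesgue \<and>
     (\<forall>K. compact K \<longrightarrow> set_integrable lebesgue K G) \<and>
     (\<forall>\<phi>. test_function \<phi> \<longrightarrow> (\<forall>b\<in>Basis.
        (LINT x|lebesgue. u x * partial_derivative b \<phi> x) =
        - (LINT x|lebesgue. (G x \<bullet> b) * \<phi> x)))"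

text \<open>The space $W^{1,2}(\mathbb R^n)$ in which only local square integrability is required of the
  function itself; its elements are represented by Lebesgue measurable functions, not by classes
  modulo null sets.\<close>

definition W12 :: "('a::euclidean_space \<Rightarrow> real) set" where
  "W12 = {u. locally_L2 u \<and>
     (\<exists>G. has_weak_gradient u G \<and> integrable lebesgue (\<lambda>x. (norm (G x))\<^sup>2))}"

text \<open>A weak gradient is locally integrable, hence unique up to null sets, so integrals of
  expressions in \<open>weak_gradient u\<close> do not depend on the choice made here.\<close>

definition weak_gradient :: "('a::euclidean_space \<Rightarrow> real) \<Rightarrow> 'a \<Rightarrow> 'a" where
  "weak_gradient u = (SOME G. has_weak_gradient u G)"

definition Linfty_on :: "'a::euclidean_space set \<Rightarrow> ('a \<Rightarrow> real) \<Rightarrow> bool" where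
  "Linfty_on \<Omega> f \<longleftrightarrow> set_borel_measurable lebesgue \<Omega> f \<and>
     (\<exists>C. AE x\<in>\<Omega> in lebesgue. \<bar>f x\<bar> \<le> C)"

definition L2_on :: "'a::euclidean_space set \<Rightarrow> ('a \<Rightarrow> real) \<Rightarrow> bool" where
  "L2_on \<Omega> g \<longleftrightarrow> set_borel_measurable lebesgue \<Omega> g \<and>
     set_integrable lebesgue \<Omega> (\<lambda>x. (g x)\<^sup>2)"

text \<open>An \<open>N\<close>-tuple is a function on a finite index type \<open>'m\<close> with \<open>CARD('m) = N\<close>.\<close>

definition disjoint_tuples :: "'a::euclidean_space set \<Rightarrow> ('m::finite \<Rightarrow> 'a set) set" where
  "disjoint_tuples \<Omega> =
     {W. (\<forall>i. W i \<in> sets borel \<and> W i \<subseteq> \<Omega>) \<and> disjoint_family W}"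

definition admissible_pairs ::
    "'a::euclidean_space set \<Rightarrow> (('m::finite \<Rightarrow> 'a \<Rightarrow> real) \<times> ('m \<Rightarrow> 'a set)) set" where
  "admissible_pairs \<Omega> =
     {(u, W). W \<in> disjoint_tuples \<Omega> \<and>
        (\<forall>i. u i \<in> W12 \<and> (AE x in lebesgue. x \<notin> W i \<longrightarrow> u i x = 0))}"

text \<open>The lower order term is integrated over \<open>\<Omega>\<close>, where \<open>f i\<close> and \<open>g i\<close> are given; for admissible
  pairs \<open>u i\<close> vanishes almost everywhere outside \<open>\<Omega>\<close>.\<close>

definition energy ::
    "'a::euclidean_space set \<Rightarrow> ('m::finite \<Rightarrow> 'a \<Rightarrow> real) \<Rightarrow> ('m \<Rightarrow> 'a \<Rightarrow> real) \<Rightarrow>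
     (('m \<Rightarrow> 'a set) \<Rightarrow> real) \<Rightarrow> ('m \<Rightarrow> 'a \<Rightarrow> real) \<Rightarrow> ('m \<Rightarrow> 'a set) \<Rightarrow> real" where
  "energy \<Omega> f g F u W =
     (\<Sum>i\<in>UNIV. LINT x|lebesgue. (norm (weak_gradient (u i) x))\<^sup>2) +
     (\<Sum>i\<in>UNIV. LINT x:\<Omega>|lebesgue. ((u i x)\<^sup>2 * f i x - u i x * g i x)) +
     F W"

end

theory Submission
  imports Defs "HOL-Library.Diagonal_Subsequence"
begin

text \<open>The direct method: a minimizing sequence is bounded in \<open>W\<^sup>1\<^sup>,\<^sup>2\<close>, a subsequence converges
  almost everywhere, the energy is lower semicontinuous along it, and the limit can be completed to an
  admissible pair. What makes this more than routine is that \<open>\<Omega>\<close> is an arbitrary Borel set of finite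
  measure and that the sets \<open>W i\<close> vary along the sequence.

  Both the Poincare inequality and compactness rest on one inequality,
  \<open>\<integral> \<bar>u(x + h) - u(x)\<bar>\<^sup>2 dx \<le> \<bar>h\<bar>\<^sup>2 \<integral> \<bar>\<nabla>u\<bar>\<^sup>2\<close> (\<open>sobolev_translation_estimate\<close>). It is obtained by testing
  the weak derivative against test functions moved along the segment from \<open>0\<close> to \<open>h\<close>: this identifies
  \<open>u(x + h) - u(x)\<close> with the integral of \<open>\<nabla>u \<bullet> h\<close> over the segment from \<open>x\<close> to \<open>x + h\<close>.

  If \<open>u\<close> vanishes outside \<open>\<Omega>\<close>, average this inequality over \<open>h\<close> in a cube with more than twice the volume
  of \<open>\<Omega>\<close>. For at least half of the \<open>h\<close> the point \<open>x + h\<close> lies outside \<open>\<Omega>\<close>, so that the difference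
  is just \<open>u(x)\<close>; this is the Poincare inequality (\<open>poincare_finite_measure\<close>). It yields coercivity of
  the energy, and it shows that admissible functions, a priori only locally square integrable, are in
  \<open>L\<^sup>2\<close>.

  Averaging over \<open>h\<close> in a small cube instead shows that \<open>u\<close> is \<open>L\<^sup>2\<close>-close to its averages over the cells
  of a fine grid, uniformly for bounded gradients. For every grid these averages converge along
  a diagonal subsequence, and as \<open>\<Omega>\<close> has finite measure, dominated convergence makes the convergence
  strong in \<open>L\<^sup>2\<close>, also for unbounded \<open>\<Omega>\<close> (\<open>sobolev_compactness\<close>).

  Lower semicontinuity of the Dirichlet integral (\<open>sobolev_lower_semicontinuous\<close>) is proved without weak
  compactness. Among the Sobolev functions that are pointwise at least as close to the limit as the tail of
  the sequence, take almost minimizers of the Dirichlet integral; by the parallelogram law their gradients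
  form a Cauchy sequence in \<open>L\<^sup>2\<close>, and its limit is the gradient of the limit function.

  As for the sets, the limit of \<open>u i\<close> vanishes almost everywhere outside the set-theoretic lower limit of the
  sets \<open>W i\<close>. These lower limits are pairwise disjoint, but their volumes may be smaller than the limits of
  the volumes. As Lebesgue measure has no atoms, they can be enlarged inside \<open>\<Omega>\<close>
  to disjoint sets with exactly the limit volumes (\<open>liminf_sets_properties\<close>), and
  continuity of the volume functional finishes the proof.\<close>

section \<open>Smooth bump functions\<close>

text \<open>The standard smooth function that is flat at the origin, together with its quotients by powers; the
  quotients are what differentiation produces.\<close>

definition flat_exp :: "nat \<Rightarrow> real \<Rightarrow> real" where
  "flat_exp k t = (if t > 0 then exp (- (1 / t)) / t ^ k else 0)"

lemma flat_exp_0_bounds: "0 \<le> flat_exp 0 t" "flat_exp 0 t \<le> 1" and flat_exp_nonpos: "t \<le> 0 \<Longrightarrow> flat_exp k t = 0"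
  by (auto simp: flat_exp_def)

text \<open>The exponential decay in \<open>1 / t\<close> beats every power of \<open>1 / t\<close>; this gives differentiability at \<open>0\<close>.\<close>

lemma flat_exp_tendsto_0: "(flat_exp k \<longlongrightarrow> 0) (at 0)"
proof -
  have "((\<lambda>t. (1 / t) ^ k / exp (1 / t)) \<longlongrightarrow> 0) (at_right (0::real))"
    by (rule filterlim_compose[OF tendsto_power_div_exp_0])
       (simp add: filterlim_inverse_at_top_right flip: inverse_eq_divide)
  then have "(flat_exp k \<longlongrightarrow> 0) (at_right 0)"
    by (rule Lim_transform_eventually)
       (auto simp: flat_exp_def eventually_at_filter exp_minus field_simps)
  moreover have "(flat_exp k \<longlongrightarrow> 0) (at_left 0)"
    by (rule tendsto_eventually) (auto simp: flat_exp_def eventually_at_filter)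
  ultimately show ?thesis by (simp add: filterlim_split_at)
qed

lemma DERIV_flat_exp:
  "(flat_exp k has_real_derivative flat_exp (k + 2) t - real k * flat_exp (k + 1) t) (at t)"
proof -
  consider "t > 0" | "t < 0" | "t = 0" by linarith
  then show ?thesis
  proof cases
    case 1
    have pow: "real k * t ^ (k - 1) = real k * t ^ k / t"
      using 1 by (cases k) auto
    have "((\<lambda>t. exp (- (1 / t)) / t ^ k) has_real_derivative
        (exp (- (1 / t)) * (1 / t\<^sup>2) * t ^ k - exp (- (1 / t)) * (real k * t ^ (k - 1))) / (t ^ k * t ^ k)) (at t)"
      by (rule DERIV_divide DERIV_pow[simplified])+
        (use 1 in \<open>auto intro!: derivative_eq_intros simp: power2_eq_square\<close>)
    also have "(exp (- (1 / t)) * (1 / t\<^sup>2) * t ^ k - exp (- (1 / t)) * (real k * t ^ (k - 1))) / (t ^ k * t ^ k)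
        = flat_exp (k + 2) t - real k * flat_exp (k + 1) t"
      unfolding pow using 1 by (simp add: flat_exp_def field_simps power2_eq_square)
    finally have "((\<lambda>t. exp (- (1 / t)) / t ^ k) has_real_derivative
        flat_exp (k + 2) t - real k * flat_exp (k + 1) t) (at t)" .
    then show ?thesis
      by (rule has_field_derivative_transform_within_open[where S="{0<..}"])
         (use 1 in \<open>auto simp: flat_exp_def\<close>)
  next
    case 2
    have "((\<lambda>t. 0) has_real_derivative flat_exp (k + 2) t - real k * flat_exp (k + 1) t) (at t)"
      using 2 by (simp add: flat_exp_def)
    then show ?thesis
      by (rule has_field_derivative_transform_within_open[where S="{..<0}"])
         (use 2 in \<open>auto simp: flat_exp_def\<close>)
  next
    case 3
    have "((\<lambda>h. flat_exp k h / h) \<longlongrightarrow> 0) (at 0)"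
      by (rule Lim_transform_eventually[OF flat_exp_tendsto_0[of "Suc k"]])
         (auto simp: flat_exp_def eventually_at_filter)
    then show ?thesis using 3 by (simp add: DERIV_def flat_exp_nonpos)
  qed
qed

text \<open>An algebra of functions that contains the building blocks of bump functions and is closed under
  partial derivatives, so that each of its elements is infinitely differentiable.\<close>

inductive flat_algebra :: "('a::euclidean_space \<Rightarrow> real) \<Rightarrow> bool" where
  const: "flat_algebra (\<lambda>x. c)"
| flat: "flat_algebra (\<lambda>x. flat_exp k (x \<bullet> v + d))"
| add: "flat_algebra f \<Longrightarrow> flat_algebra g \<Longrightarrow> flat_algebra (\<lambda>x. f x + g x)"
| mult: "flat_algebra f \<Longrightarrow> flat_algebra g \<Longrightarrow> flat_algebra (\<lambda>x. f x * g x)"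

lemma flat_algebra_has_derivative:
  assumes "flat_algebra f"
  shows "\<exists>f'. (\<forall>x. (f has_derivative f' x) (at x)) \<and> (\<forall>h. flat_algebra (\<lambda>x. f' x h))"
  using assms
proof induction
  case (const c)
  show ?case by (rule exI[of _ "\<lambda>x h. 0"]) (auto intro: flat_algebra.const)
next
  case (flat k v d)
  let ?f = "\<lambda>x h. (flat_exp (k + 2) (x \<bullet> v + d) + - real k * flat_exp (k + 1) (x \<bullet> v + d)) * (h \<bullet> v)"
  have "((\<lambda>x. flat_exp k (x \<bullet> v + d)) has_derivative ?f x) (at x)" for x
    by (rule has_derivative_eq_rhs[OF DERIV_compose_FDERIV[OF DERIV_flat_exp]])
       (auto intro!: derivative_eq_intros simp: algebra_simps)
  moreover have "flat_algebra (\<lambda>x. ?f x h)" for h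
    by (intro flat_algebra.intros)
  ultimately show ?case by (intro exI[of _ ?f]) auto
next
  case (add f g)
  then obtain f' g' where *: "\<forall>x. (f has_derivative f' x) (at x)" "\<forall>h. flat_algebra (\<lambda>x. f' x h)"
      "\<forall>x. (g has_derivative g' x) (at x)" "\<forall>h. flat_algebra (\<lambda>x. g' x h)"
    by blast
  show ?case
    by (rule exI[of _ "\<lambda>x h. f' x h + g' x h"])
       (use * in \<open>auto intro!: flat_algebra.add has_derivative_add\<close>)
next
  case (mult f g)
  then obtain f' g' where *: "\<forall>x. (f has_derivative f' x) (at x)" "\<forall>h. flat_algebra (\<lambda>x. f' x h)"
      "\<forall>x. (g has_derivative g' x) (at x)" "\<forall>h. flat_algebra (\<lambda>x. g' x h)"
    by blast
  show ?case
    by (rule exI[of _ "\<lambda>x h. f x * g' x h + f' x h * g x"])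
       (use * mult.hyps in \<open>auto intro!: flat_algebra.add flat_algebra.mult has_derivative_mult\<close>)
qed

lemma flat_algebra_continuously_differentiable:
  "flat_algebra f \<Longrightarrow> continuously_differentiable k f"
proof (induction k arbitrary: f)
  case 0
  then show ?case
    using flat_algebra_has_derivative[OF 0] has_derivative_continuous
    by (fastforce simp: continuous_on_eq_continuous_at)
next
  case (Suc k)
  obtain f' where f': "\<And>x. (f has_derivative f' x) (at x)" "\<And>h. flat_algebra (\<lambda>x. f' x h)"
    using flat_algebra_has_derivative[OF Suc.prems] by blast
  then have "partial_derivative b f = (\<lambda>x. f' x b)" for b
    by (simp add: partial_derivative_def fun_eq_iff frechet_derivative_at[OF f'(1), symmetric])
  with f' Suc.IH show ?case
    by (auto simp: differentiable_on_def differentiable_def) 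
qed

text \<open>These bumps increase to the indicator function of an open box as \<open>m\<close> grows, because
  \<open>exp (- 1 / (m t))\<close> tends to \<open>1\<close> for every \<open>t > 0\<close>.\<close>

definition box_bump :: "'a::euclidean_space \<Rightarrow> 'a \<Rightarrow> nat \<Rightarrow> 'a \<Rightarrow> real" where
  "box_bump a b m x = (\<Prod>i\<in>Basis. flat_exp 0 (real (Suc m) * (x \<bullet> i - a \<bullet> i)) *
                                     flat_exp 0 (real (Suc m) * (b \<bullet> i - x \<bullet> i)))"

lemma flat_algebra_prod:
  "finite I \<Longrightarrow> (\<And>i. i \<in> I \<Longrightarrow> flat_algebra (f i)) \<Longrightarrow> flat_algebra (\<lambda>x. \<Prod>i\<in>I. f i x)"
  by (induction I rule: finite_induct) (auto intro: flat_algebra.intros)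

lemma box_bump_outside: 
  assumes "x \<notin> box a b" shows "box_bump a b m x = 0"
proof -
  obtain i where i: "i \<in> Basis" "x \<bullet> i \<le> a \<bullet> i \<or> b \<bullet> i \<le> x \<bullet> i"
    using assms by (auto simp: box_def not_less)
  then have "flat_exp 0 (real (Suc m) * (x \<bullet> i - a \<bullet> i)) * flat_exp 0 (real (Suc m) * (b \<bullet> i - x \<bullet> i)) = 0"
    using flat_exp_nonpos[of "real (Suc m) * (x \<bullet> i - a \<bullet> i)" 0] flat_exp_nonpos[of "real (Suc m) * (b \<bullet> i - x \<bullet> i)" 0]
    by (auto simp: mult_nonneg_nonpos)
  then show ?thesis unfolding box_bump_def using i(1) by (intro prod_zero) auto
qed

lemma box_bump_bounds: "0 \<le> box_bump a b m x" "box_bump a b m x \<le> 1"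
  unfolding box_bump_def
  by (auto intro!: prod_nonneg prod_le_1 mult_nonneg_nonneg mult_le_one flat_exp_0_bounds)

lemma test_function_box_bump: "test_function (box_bump a b m)"
proof -
  have "flat_algebra (\<lambda>x. flat_exp 0 (real (Suc m) * (x \<bullet> i - a \<bullet> i)))" for i :: 'a
    using flat_algebra.flat[of 0 "real (Suc m) *\<^sub>R i" "- real (Suc m) * (a \<bullet> i)"] by (simp add: algebra_simps)
  moreover have "flat_algebra (\<lambda>x. flat_exp 0 (real (Suc m) * (b \<bullet> i - x \<bullet> i)))" for i :: 'a
    using flat_algebra.flat[of 0 "- real (Suc m) *\<^sub>R i" "real (Suc m) * (b \<bullet> i)"] by (simp add: algebra_simps)
  ultimately have "flat_algebra (box_bump a b m)"
    unfolding box_bump_def by (intro flat_algebra_prod flat_algebra.mult) auto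
  moreover have "{x. box_bump a b m x \<noteq> 0} \<subseteq> cbox a b"
    using box_bump_outside box_subset_cbox by blast
  then have "compact (closure {x. box_bump a b m x \<noteq> 0})"
    by (meson bounded_cbox bounded_subset compact_closure)
  ultimately show ?thesis
    by (simp add: test_function_def flat_algebra_continuously_differentiable)
qed

lemma flat_exp_0_tendsto_1: "c > 0 \<Longrightarrow> (\<lambda>m. flat_exp 0 (real (Suc m) * c)) \<longlonglongrightarrow> 1"
proof -
  assume c: "c > 0"
  have "(\<lambda>m. exp (- (inverse (real (Suc m)) / c))) \<longlonglongrightarrow> exp (- (0 / c))"
    by (intro tendsto_intros LIMSEQ_inverse_real_of_nat) (use c in auto)
  then show ?thesis using c by (simp add: flat_exp_def zero_less_mult_iff inverse_eq_divide)
qed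

lemma box_bump_tendsto: "(\<lambda>m. box_bump a b m x) \<longlonglongrightarrow> indicator (box a b) x"
proof (cases "x \<in> box a b")
  case True
  then have "(\<lambda>m. box_bump a b m x) \<longlonglongrightarrow> (\<Prod>i\<in>(Basis::'a set). 1 * 1)"
    unfolding box_bump_def
    by (intro tendsto_prod tendsto_mult flat_exp_0_tendsto_1) (auto simp: box_def)
  with True show ?thesis by simp
qed (simp add: box_bump_outside)

section \<open>The fundamental lemma of the calculus of variations\<close>

text \<open>The positive and the negative part of \<open>w\<close> are densities of two measures that agree on the
  intersection-stable generator of open boxes, hence everywhere; densities are unique.\<close>

lemma AE_eq_0_if_box_integrals_0:
  fixes w :: "'a::euclidean_space \<Rightarrow> real"
  assumes [measurable]: "w \<in> borel_measurable borel"
    and int: "\<And>a b. set_integrable lborel (box a b) w"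
    and zero: "\<And>a b. (LINT x:box a b|lborel. w x) = 0"
  shows "AE x in lborel. w x = 0"
proof -
  let ?P = "density lborel (\<lambda>x. ennreal (w x))" and ?N = "density lborel (\<lambda>x. ennreal (- w x))"
  have eq: "emeasure ?P (box a b) = emeasure ?N (box a b)" 
    and fin: "emeasure ?P (box a b) \<noteq> \<infinity>" for a b
  proof -
    let ?w = "\<lambda>x. indicator (box a b) x * w x"
    have i: "integrable lborel ?w" using int[of a b] by (simp add: set_integrable_def)
    have e: "ennreal (w x) * indicator (box a b) x = ennreal (?w x)"
      "ennreal (- w x) * indicator (box a b) x = ennreal (- ?w x)" for x
      by (auto simp: indicator_def)
    have P: "emeasure ?P (box a b) = (\<integral>\<^sup>+x. ennreal (?w x) \<partial>lborel)"
      and N: "emeasure ?N (box a b) = (\<integral>\<^sup>+x. ennreal (- ?w x) \<partial>lborel)"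
      by (simp_all add: emeasure_density flip: e)
    show "emeasure ?P (box a b) \<noteq> \<infinity>"
      using i unfolding P real_integrable_def by auto
    have "enn2real (emeasure ?P (box a b)) = enn2real (emeasure ?N (box a b))"
      using zero[of a b] real_lebesgue_integral_def[OF i] unfolding P N
      by (simp add: set_lebesgue_integral_def)
    moreover have "emeasure ?P (box a b) < top" "emeasure ?N (box a b) < top"
      using i unfolding P N real_integrable_def by (auto simp: less_top)
    ultimately show "emeasure ?P (box a b) = emeasure ?N (box a b)"
      using ennreal_enn2real by metis
  qed
  let ?A = "\<lambda>n::nat. box (- (real n *\<^sub>R One)) (real n *\<^sub>R One) :: 'a set"
  have "?P = ?N"
  proof (rule measure_eqI_generator_eq)
    let ?E = "range (\<lambda>(a, b). box a b::'a set)"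
    show "Int_stable ?E"
      by (auto simp: Int_stable_def box_Int_box)
    show "?E \<subseteq> Pow UNIV" "sets ?P = sigma_sets UNIV ?E" "sets ?N = sigma_sets UNIV ?E"
      by (simp_all add: borel_eq_box)
    show "range ?A \<subseteq> ?E" "(\<Union>i. ?A i) = UNIV"
      unfolding UN_box_eq_UNIV by auto
    show "emeasure ?P (?A i) \<noteq> \<infinity>" for i by (rule fin)
    show "emeasure ?P X = emeasure ?N X" if X: "X \<in> ?E" for X
    proof -
      obtain a b where "X = box a b" using X by auto
      then show ?thesis by (simp only: eq)
    qed
  qed
  then have "AE x in lborel. ennreal (w x) = ennreal (- w x)"
    by (intro sigma_finite_measure.density_unique[OF sigma_finite_lborel]) auto
  then show ?thesis
  proof eventually_elim
    fix x assume "ennreal (w x) = ennreal (- w x)"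
    then show "w x = 0" by (cases "w x" "0::real" rule: linorder_cases) (auto simp: ennreal_neg)
  qed
qed

definition loc_integrable :: "('a::euclidean_space \<Rightarrow> real) \<Rightarrow> bool" where
  "loc_integrable w \<longleftrightarrow> w \<in> borel_measurable borel \<and> (\<forall>R. set_integrable lborel (cball 0 R) w)"

lemma loc_integrable_bounded:
  assumes "loc_integrable w" "bounded S" "S \<in> sets borel"
  shows "set_integrable lborel S w"
proof -
  obtain R where "S \<subseteq> cball 0 R" using assms(2) by (auto simp: bounded_iff subset_iff)
  then show ?thesis using assms set_integrable_subset[of lborel "cball 0 R" w S]
    by (auto simp: loc_integrable_def)
qed

text \<open>Bump functions approximate indicator functions of boxes boundedly, so that vanishing integrals
  against test functions carry over to boxes.\<close>

lemma AE_eq_0_if_test_integrals_0: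
  fixes w :: "'a::euclidean_space \<Rightarrow> real"
  assumes w: "loc_integrable w"
    and zero: "\<And>\<phi>. test_function \<phi> \<Longrightarrow> (LINT x|lborel. w x * \<phi> x) = 0"
  shows "AE x in lborel. w x = 0"
proof (rule AE_eq_0_if_box_integrals_0)
  show [measurable]: "w \<in> borel_measurable borel" using w by (simp add: loc_integrable_def)
  fix a b :: 'a
  show i: "set_integrable lborel (box a b) w" by (rule loc_integrable_bounded[OF w]) auto
  have m: "box_bump a b m \<in> borel_measurable borel" for m
    using test_function_box_bump[of a b m]
    by (metis borel_measurable_continuous_onI continuously_differentiable.simps(1) test_function_def)
  have "(\<lambda>m. LINT x|lborel. w x * box_bump a b m x) \<longlonglongrightarrow> (LINT x|lborel. indicator (box a b) x * w x)"
  proof (rule integral_dominated_convergence)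
    show "integrable lborel (\<lambda>x. norm (indicator (box a b) x * w x))"
      using i by (auto simp: set_integrable_def)
    show "AE x in lborel. (\<lambda>m. w x * box_bump a b m x) \<longlonglongrightarrow> indicator (box a b) x * w x"
      by (auto intro!: tendsto_eq_intros box_bump_tendsto)
    show "AE x in lborel. norm (w x * box_bump a b m x) \<le> norm (indicator (box a b) x * w x)" for m
      using box_bump_outside[of _ a b m] box_bump_bounds[of a b m]
      by (auto simp: abs_mult indicator_def mult_left_le)
  qed (use m in measurable)
  then have "(\<lambda>m::nat. 0::real) \<longlonglongrightarrow> (LINT x:box a b|lborel. w x)"
    using zero[OF test_function_box_bump] by (simp add: set_lebesgue_integral_def)
  then show "(LINT x:box a b|lborel. w x) = 0" by (simp add: LIMSEQ_const_iff)
qed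

section \<open>Test functions, translations and weak derivatives\<close>

lemma test_function_continuous: "test_function \<phi> \<Longrightarrow> continuous_on UNIV \<phi>"
  by (metis continuously_differentiable.simps(1) test_function_def)

lemma test_function_differentiable: "test_function \<phi> \<Longrightarrow> \<phi> differentiable (at x)"
  using continuously_differentiable.simps(2)[of 0 \<phi>] by (auto simp: test_function_def differentiable_on_def)

lemma test_function_partial_continuous:
  "test_function \<phi> \<Longrightarrow> b \<in> Basis \<Longrightarrow> continuous_on UNIV (partial_derivative b \<phi>)"
  using continuously_differentiable.simps(2)[of 0 \<phi>] by (auto simp: test_function_def)

lemma test_function_has_derivative:
  assumes "test_function \<phi>"
  shows "(\<phi> has_derivative (\<lambda>h. \<Sum>b\<in>Basis. (h \<bullet> b) * partial_derivative b \<phi> x)) (at x)"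
proof -
  have d: "(\<phi> has_derivative frechet_derivative \<phi> (at x)) (at x)"
    using test_function_differentiable[OF assms] frechet_derivative_works by blast
  then interpret l: linear "frechet_derivative \<phi> (at x)" by (rule has_derivative_linear)
  have "frechet_derivative \<phi> (at x) = (\<lambda>h. \<Sum>b\<in>Basis. (h \<bullet> b) * partial_derivative b \<phi> x)"
  proof
    fix h
    have "frechet_derivative \<phi> (at x) h = frechet_derivative \<phi> (at x) (\<Sum>b\<in>Basis. (h \<bullet> b) *\<^sub>R b)"
      by (simp add: euclidean_representation)
    also have "\<dots> = (\<Sum>b\<in>Basis. (h \<bullet> b) * partial_derivative b \<phi> x)"
      unfolding l.sum l.scale partial_derivative_def by simp
    finally show "frechet_derivative \<phi> (at x) h = (\<Sum>b\<in>Basis. (h \<bullet> b) * partial_derivative b \<phi> x)" .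
  qed
  with d show ?thesis by simp
qed

lemma test_function_support:
  assumes "test_function \<phi>"
  obtains R where "R > 0" "\<And>x. norm x > R \<Longrightarrow> \<phi> x = 0"
    "\<And>x b. norm x > R \<Longrightarrow> partial_derivative b \<phi> x = 0"
proof -
  have "bounded (closure {x. \<phi> x \<noteq> 0})"
    using assms compact_imp_bounded by (auto simp: test_function_def)
  then have "bounded {x. \<phi> x \<noteq> 0}" using bounded_subset closure_subset by blast
  then obtain R where R: "R > 0" "\<And>x. \<phi> x \<noteq> 0 \<Longrightarrow> norm x \<le> R"
    unfolding bounded_pos by blast
  then have z: "\<phi> x = 0" if "norm x > R" for x using that by force
  have "partial_derivative b \<phi> x = 0" if "norm x > R" for x b
  proof -
    have "((\<lambda>_. 0) has_derivative (\<lambda>_. 0)) (at x)" by simp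
    then have "(\<phi> has_derivative (\<lambda>_. 0)) (at x)"
      by (rule has_derivative_transform_within_open[of _ _ _ _ "- cball 0 R"])
        (use that z in \<open>auto simp: open_Compl\<close>)
    then show ?thesis
      by (simp add: partial_derivative_def frechet_derivative_at[symmetric])
  qed
  with R z that show ?thesis by blast
qed

lemma continuous_support_bounded:
  fixes \<psi> :: "'a::euclidean_space \<Rightarrow> real"
  assumes "continuous_on UNIV \<psi>" "\<And>x. norm x > R \<Longrightarrow> \<psi> x = 0"
  obtains C where "C \<ge> 0" "\<And>x. \<bar>\<psi> x\<bar> \<le> C"
proof -
  have "compact (\<psi> ` cball 0 R)"
    by (rule compact_continuous_image) (use assms(1) continuous_on_subset in auto)
  then have "bounded (\<psi> ` cball 0 R)" by (rule compact_imp_bounded)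
  then obtain C where "\<And>x. x \<in> cball 0 R \<Longrightarrow> norm (\<psi> x) \<le> C"
    unfolding bounded_iff by blast
  then have "\<bar>\<psi> x\<bar> \<le> max C 0" for x
    using assms(2)[of x] by (cases "norm x \<le> R") (force simp: not_le)+
  then show thesis by (intro that[of "max C 0"]) auto
qed

lemma has_derivative_translate:
  fixes \<phi> :: "'a::real_normed_vector \<Rightarrow> real"
  assumes "\<phi> differentiable (at (x + c))"
  shows "((\<lambda>x. \<phi> (x + c)) has_derivative frechet_derivative \<phi> (at (x + c))) (at x)"
  by (rule has_derivative_compose[of "\<lambda>x. x + c" "\<lambda>h. h", simplified])
     (use assms in \<open>auto simp: frechet_derivative_works has_derivative_add_const\<close>)

lemma partial_derivative_translate:
  assumes "\<And>x. \<phi> differentiable (at x)"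
  shows "partial_derivative b (\<lambda>x. \<phi> (x + c)) = (\<lambda>x. partial_derivative b \<phi> (x + c))"
proof
  fix x
  show "partial_derivative b (\<lambda>x. \<phi> (x + c)) x = partial_derivative b \<phi> (x + c)"
    unfolding partial_derivative_def frechet_derivative_at[OF has_derivative_translate[OF assms], symmetric] ..
qed

lemma continuously_differentiable_translate:
  "continuously_differentiable k \<phi> \<Longrightarrow> continuously_differentiable k (\<lambda>x. \<phi> (x + c))"
proof (induction k arbitrary: \<phi>)
  case 0
  then show ?case by (auto intro!: continuous_on_compose2[of UNIV \<phi>] continuous_intros)
next
  case (Suc k)
  have d: "\<phi> differentiable (at y)" for y using Suc.prems by (simp add: differentiable_on_def)
  have "(\<lambda>x. \<phi> (x + c)) differentiable (at y)" for y
    using has_derivative_translate[OF d] differentiable_def by blast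
  then show ?case using Suc.prems Suc.IH
    by (simp add: differentiable_on_def partial_derivative_translate[OF d])
qed

lemma test_function_translate:
  assumes "test_function \<phi>" shows "test_function (\<lambda>x. \<phi> (x + c))"
proof -
  obtain R where R: "\<And>x. norm x > R \<Longrightarrow> \<phi> x = 0"
    by (rule test_function_support[OF assms], rule that)
  have "norm x \<le> R + norm c" if "\<phi> (x + c) \<noteq> 0" for x
  proof -
    have "norm (x + c) \<le> R" using R[of "x + c"] that by linarith
    then show ?thesis using norm_triangle_ineq4[of "x + c" c] by simp
  qed
  then have "bounded {x. \<phi> (x + c) \<noteq> 0}"
    by (auto simp: bounded_iff)
  then show ?thesis using assms
    by (simp add: test_function_def continuously_differentiable_translate compact_closure)
qed

text \<open>The squared \<open>L\<^sup>2\<close> norm as an extended real number, so that Tonelli's theorem and Fatou's lemma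
  apply without integrability conditions.\<close>

definition L2sq :: "('a::euclidean_space \<Rightarrow> 'b::real_normed_vector) \<Rightarrow> ennreal" where
  "L2sq f = (\<integral>\<^sup>+x. ennreal ((norm (f x))\<^sup>2) \<partial>lborel)"

text \<open>Borel versions of a function in \<^term>\<open>W12\<close> and of its weak gradient. Borel measurability
  makes translations and integrals over product spaces unproblematic; the weak gradient is carried along explicitly
  instead of being chosen.\<close>

definition sobolev_pair :: "('a::euclidean_space \<Rightarrow> real) \<Rightarrow> ('a \<Rightarrow> 'a) \<Rightarrow> bool" where
  "sobolev_pair u G \<longleftrightarrow>
     u \<in> borel_measurable borel \<and> G \<in> borel_measurable borel \<and>
     (\<forall>R. set_integrable lborel (cball 0 R) (\<lambda>x. (u x)\<^sup>2)) \<and> L2sq G < \<infinity> \<and>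
     (\<forall>\<phi> b. test_function \<phi> \<longrightarrow> b \<in> Basis \<longrightarrow>
        (LINT x|lborel. u x * partial_derivative b \<phi> x) = - (LINT x|lborel. (G x \<bullet> b) * \<phi> x))"

lemma nn_integral_translate:
  fixes f :: "'a::euclidean_space \<Rightarrow> ennreal"
  assumes [measurable]: "f \<in> borel_measurable borel"
  shows "(\<integral>\<^sup>+x. f (x + c) \<partial>lborel) = (\<integral>\<^sup>+x. f x \<partial>lborel)"
proof -
  have "(\<integral>\<^sup>+x. f x \<partial>lborel) = (\<integral>\<^sup>+x. f x \<partial>distr lborel borel ((+) c))"
    by (simp add: lborel_distr_plus)
  also have "\<dots> = (\<integral>\<^sup>+x. f (c + x) \<partial>lborel)"
    by (rule nn_integral_distr) auto
  finally show ?thesis by (simp add: add.commute)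
qed

lemma integral_translate:
  fixes f :: "'a::euclidean_space \<Rightarrow> real"
  assumes [measurable]: "f \<in> borel_measurable borel"
  shows "(\<integral>x. f (x + c) \<partial>lborel) = (\<integral>x. f x \<partial>lborel)"
proof -
  have "(\<integral>x. f x \<partial>lborel) = (\<integral>x. f x \<partial>distr lborel borel ((+) c))"
    by (simp add: lborel_distr_plus)
  also have "\<dots> = (\<integral>x. f (c + x) \<partial>lborel)"
    by (rule integral_distr) auto
  finally show ?thesis by (simp add: add.commute)
qed

lemma integrable_translate:
  fixes f :: "'a::euclidean_space \<Rightarrow> real"
  assumes "integrable lborel f"
  shows "integrable lborel (\<lambda>x. f (x + c))"
proof -
  have [measurable]: "f \<in> borel_measurable borel" using assms by auto
  have "(\<integral>\<^sup>+x. norm (f (x + c)) \<partial>lborel) = (\<integral>\<^sup>+x. norm (f x) \<partial>lborel)"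
    by (rule nn_integral_translate) auto
  then show ?thesis using assms by (simp add: integrable_iff_bounded)
qed

lemma loc_integrable_L2:
  assumes "w \<in> borel_measurable borel" "\<And>R. set_integrable lborel (cball 0 R) (\<lambda>x. (w x)\<^sup>2)"
  shows "loc_integrable w"
proof -
  have "set_integrable lborel (cball 0 R) w" for R
  proof -
    have "set_integrable lborel (cball 0 R) (\<lambda>x. 1 + (w x)\<^sup>2)"
      by (intro set_integral_add assms(2)) 
         (simp add: set_integrable_def emeasure_lborel_cball_finite[unfolded infinity_ennreal_def])
    then show ?thesis unfolding set_integrable_def
    proof (rule Bochner_Integration.integrable_bound)
      have "\<bar>w x\<bar> \<le> 1 + (w x)\<^sup>2" for x
        using sum_squares_bound[of "\<bar>w x\<bar>" 1] abs_ge_zero[of "w x"] unfolding power2_abs power_one by linarith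
      then show "AE x in lborel. norm (indicat_real (cball 0 R) x *\<^sub>R w x) \<le> norm (indicat_real (cball 0 R) x *\<^sub>R (1 + (w x)\<^sup>2))"
        by (intro AE_I2) (auto simp: indicator_def)
    qed (use assms(1) in \<open>auto intro!: borel_measurable_times borel_measurable_indicator\<close>)
  qed
  with assms(1) show ?thesis by (simp add: loc_integrable_def)
qed

lemma loc_integrable_mult:
  assumes w: "loc_integrable w" and \<psi>: "continuous_on UNIV \<psi>" "\<And>x. norm x > R \<Longrightarrow> \<psi> x = 0"
  shows "integrable lborel (\<lambda>x. w x * \<psi> x)"
proof -
  obtain C where C: "\<And>x. \<bar>\<psi> x\<bar> \<le> C" "C \<ge> 0" using continuous_support_bounded[OF \<psi>] by blast
  have [measurable]: "\<psi> \<in> borel_measurable borel" "w \<in> borel_measurable borel"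
    using \<psi>(1) w by (auto intro: borel_measurable_continuous_onI simp: loc_integrable_def)
  have "integrable lborel (\<lambda>x. C * (indicator (cball 0 R) x * w x))"
    using w by (intro integrable_mult_right) (auto simp: loc_integrable_def set_integrable_def)
  then show ?thesis
  proof (rule Bochner_Integration.integrable_bound)
    show "AE x in lborel. norm (w x * \<psi> x) \<le> norm (C * (indicat_real (cball 0 R) x * w x))"
      using C \<psi>(2) by (auto simp: indicator_def abs_mult mult.commute intro!: mult_right_mono)
  qed auto
qed

definition dir_deriv :: "('a::euclidean_space \<Rightarrow> real) \<Rightarrow> 'a \<Rightarrow> 'a \<Rightarrow> real" where
  "dir_deriv \<phi> h x = (\<Sum>b\<in>Basis. (h \<bullet> b) * partial_derivative b \<phi> x)"

context
  fixes u :: "'a::euclidean_space \<Rightarrow> real" and G assumes uG: "sobolev_pair u G"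
begin

lemma sobolev_measurable: "u \<in> borel_measurable borel" "G \<in> borel_measurable borel"
  using uG by (auto simp: sobolev_pair_def)

lemma sobolev_loc_integrable: "loc_integrable u"
  using uG by (intro loc_integrable_L2) (auto simp: sobolev_pair_def)

lemma sobolev_gradient_finite: "L2sq G < \<infinity>"
  using uG unfolding sobolev_pair_def by blast

lemma sobolev_gradient_square_integrable: "integrable lborel (\<lambda>x. (norm (G x))\<^sup>2)"
  using uG by (auto simp: sobolev_pair_def L2sq_def integrable_iff_bounded)

lemma sobolev_gradient_loc_integrable: "loc_integrable (\<lambda>x. G x \<bullet> h)"
proof (rule loc_integrable_L2)
  note [measurable] = sobolev_measurable
  fix R
  have [measurable]: "cball (0::'a) R \<in> sets borel" by simp
  have "integrable lborel (\<lambda>x. (norm h)\<^sup>2 * (norm (G x))\<^sup>2)"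
    by (intro integrable_mult_right sobolev_gradient_square_integrable)
  then show "set_integrable lborel (cball 0 R) (\<lambda>x. (G x \<bullet> h)\<^sup>2)" unfolding set_integrable_def
  proof (rule Bochner_Integration.integrable_bound)
    have "(G x \<bullet> h)\<^sup>2 \<le> (norm h)\<^sup>2 * (norm (G x))\<^sup>2" for x
      using Cauchy_Schwarz_ineq[of "G x" h] by (simp add: power2_norm_eq_inner mult.commute)
    then show "AE x in lborel. norm (indicat_real (cball 0 R) x *\<^sub>R (G x \<bullet> h)\<^sup>2) \<le> norm ((norm h)\<^sup>2 * (norm (G x))\<^sup>2)"
      by (auto simp: indicator_def)
  qed auto
qed (use sobolev_measurable(2) in \<open>auto intro!: borel_measurable_inner\<close>)

lemma sobolev_weak_directional:
  assumes \<phi>: "test_function \<phi>"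
  shows "(LINT x|lborel. u x * dir_deriv \<phi> h x) = - (LINT x|lborel. (G x \<bullet> h) * \<phi> x)"
proof -
  obtain R where "R > 0" and R: "\<And>x. norm x > R \<Longrightarrow> \<phi> x = 0"
      "\<And>x b. norm x > R \<Longrightarrow> partial_derivative b \<phi> x = 0"
    by (rule test_function_support[OF \<phi>], rule that)
  have "(LINT x|lborel. u x * dir_deriv \<phi> h x)
      = (LINT x|lborel. (\<Sum>b\<in>Basis. (h \<bullet> b) * (u x * partial_derivative b \<phi> x)))"
    by (simp add: dir_deriv_def sum_distrib_left mult.left_commute)
  also have "\<dots> = (\<Sum>b\<in>Basis. (h \<bullet> b) * (LINT x|lborel. u x * partial_derivative b \<phi> x))"
    by (subst Bochner_Integration.integral_sum)
       (auto intro!: integrable_mult_right loc_integrable_mult[OF sobolev_loc_integrable] R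
                     test_function_partial_continuous \<phi>)
  also have "\<dots> = (\<Sum>b\<in>Basis. (h \<bullet> b) * - (LINT x|lborel. (G x \<bullet> b) * \<phi> x))"
    using uG \<phi> by (intro sum.cong refl) (auto simp: sobolev_pair_def)
  also have "\<dots> = - (LINT x|lborel. (\<Sum>b\<in>Basis. (h \<bullet> b) * ((G x \<bullet> b) * \<phi> x)))"
    by (subst Bochner_Integration.integral_sum)
       (auto intro!: integrable_mult_right loc_integrable_mult[OF sobolev_gradient_loc_integrable] R
                     test_function_continuous \<phi> simp: sum_negf)
  also have "(\<lambda>x. \<Sum>b\<in>Basis. (h \<bullet> b) * ((G x \<bullet> b) * \<phi> x)) = (\<lambda>x. (G x \<bullet> h) * \<phi> x)"
    by (rule ext) (subst (2) euclidean_inner, simp add: sum_distrib_left mult_ac)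
  finally show ?thesis .
qed
end

text \<open>For a gradient field \<open>G\<close> this is the increment of its potential from \<open>x\<close> to \<open>x + h\<close>.\<close>

abbreviation segment_integral :: "('a::euclidean_space \<Rightarrow> 'a) \<Rightarrow> 'a \<Rightarrow> 'a \<Rightarrow> real" where
  "segment_integral G h x \<equiv> LINT t|lborel. indicator {0..1} t * (G (x + t *\<^sub>R h) \<bullet> h)"

section \<open>The translation estimate\<close>

lemma dir_deriv_continuous: "test_function \<phi> \<Longrightarrow> continuous_on UNIV (dir_deriv \<phi> h)"
  unfolding dir_deriv_def by (intro continuous_intros test_function_partial_continuous) auto

lemma dir_deriv_translate:
  "test_function \<phi> \<Longrightarrow> dir_deriv (\<lambda>x. \<phi> (x + c)) h x = dir_deriv \<phi> h (x + c)"
  unfolding dir_deriv_def by (simp add: partial_derivative_translate test_function_differentiable)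

lemma test_function_increment:
  assumes \<phi>: "test_function \<phi>"
  shows "\<phi> (x - h) - \<phi> x = - (LINT t|lborel. dir_deriv \<phi> h (x - t *\<^sub>R h) * indicator {0..1} t)"
proof -
  have "(LINT t|lborel. - dir_deriv \<phi> h (x - t *\<^sub>R h) * indicator {0..1} t)
      = \<phi> (x - 1 *\<^sub>R h) - \<phi> (x - 0 *\<^sub>R h)"
  proof (rule integral_FTC_Icc_real)
    fix t :: real
    have "((\<lambda>t. \<phi> (x - t *\<^sub>R h)) has_derivative (\<lambda>s. dir_deriv \<phi> (- (s *\<^sub>R h)) (x - t *\<^sub>R h))) (at t)"
      unfolding dir_deriv_def
      by (rule has_derivative_compose[OF _ test_function_has_derivative[OF \<phi>]])
         (auto intro!: derivative_eq_intros)
    moreover have "dir_deriv \<phi> (- (s *\<^sub>R h)) (x - t *\<^sub>R h) = s * - dir_deriv \<phi> h (x - t *\<^sub>R h)" for s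
      by (simp add: dir_deriv_def sum_distrib_left sum_negf mult.assoc)
    ultimately show "((\<lambda>t. \<phi> (x - t *\<^sub>R h)) has_real_derivative - dir_deriv \<phi> h (x - t *\<^sub>R h)) (at t)"
      unfolding has_field_derivative_def by (auto elim!: has_derivative_eq_rhs)
    have "continuous_on UNIV (\<lambda>t. - dir_deriv \<phi> h (x - t *\<^sub>R h))"
      by (intro continuous_intros continuous_on_compose2[OF dir_deriv_continuous[OF \<phi>]]) auto
    then show "isCont (\<lambda>t. - dir_deriv \<phi> h (x - t *\<^sub>R h)) t"
      by (simp add: continuous_on_eq_continuous_at)
  qed simp
  then show ?thesis by simp
qed

lemma loc_integrable_translate:
  assumes "loc_integrable w" shows "loc_integrable (\<lambda>x. w (x + c))"
proof -
  have [measurable]: "w \<in> borel_measurable borel" using assms by (simp add: loc_integrable_def)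
  have "set_integrable lborel (cball 0 R) (\<lambda>x. w (x + c))" for R
  proof -
    have "integrable lborel (\<lambda>x. indicator (cball c R) x *\<^sub>R w x)"
      using loc_integrable_bounded[OF assms, of "cball c R"] by (simp add: set_integrable_def)
    from integrable_translate[OF this, of c] show ?thesis
      by (simp add: set_integrable_def indicator_def dist_norm)
  qed
  then show ?thesis by (simp add: loc_integrable_def)
qed

text \<open>The square of a mean is at most the mean of the squares. If \<open>f\<close> is not integrable over \<open>Q\<close>, the
  integral is \<open>0\<close> by convention and the inequality is trivial.\<close>

lemma Jensen_L2:
  fixes f :: "'a::euclidean_space \<Rightarrow> real"
  assumes [measurable]: "f \<in> borel_measurable borel" "Q \<in> sets borel" and c: "emeasure lborel Q = ennreal c" "c > 0"
  shows "ennreal ((1 / c * (LINT y|lborel. indicator Q y * f y))\<^sup>2)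
     \<le> ennreal (1 / c) * (\<integral>\<^sup>+y. indicator Q y * ennreal ((f y)\<^sup>2) \<partial>lborel)"
proof (cases "integrable lborel (\<lambda>y. indicator Q y * f y)")
  case True
  let ?I = "LINT y|lborel. indicator Q y * f y"
  have "ennreal (?I\<^sup>2) = (ennreal (norm ?I))\<^sup>2" by (simp add: ennreal_power)
  also have "\<dots> \<le> (\<integral>\<^sup>+y. ennreal (norm (indicator Q y * f y)) \<partial>lborel)\<^sup>2"
    by (intro power_mono integral_norm_bound_ennreal True) simp
  also have "\<dots> = (\<integral>\<^sup>+y. ennreal (norm (indicator Q y * f y)) * indicator Q y \<partial>lborel)\<^sup>2"
    by (rule arg_cong[of _ _ "\<lambda>z. z\<^sup>2"], rule nn_integral_cong) (auto simp: indicator_def)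
  also have "\<dots> \<le> (\<integral>\<^sup>+y. (ennreal (norm (indicator Q y * f y)))\<^sup>2 \<partial>lborel) * (\<integral>\<^sup>+y. (indicator Q y)\<^sup>2 \<partial>lborel)"
    by (rule Cauchy_Schwarz_nn_integral) auto
  also have "(\<integral>\<^sup>+y. (indicator Q y)\<^sup>2 \<partial>lborel) = (\<integral>\<^sup>+y. indicator Q y \<partial>lborel)"
    by (rule nn_integral_cong) (auto simp: indicator_def)
  also have "\<dots> = ennreal c" using c by simp
  also have "(\<integral>\<^sup>+y. (ennreal (norm (indicator Q y * f y)))\<^sup>2 \<partial>lborel) = (\<integral>\<^sup>+y. indicator Q y * ennreal ((f y)\<^sup>2) \<partial>lborel)"
    by (rule nn_integral_cong) (auto simp: indicator_def ennreal_power)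
  finally have *: "ennreal (?I\<^sup>2) \<le> (\<integral>\<^sup>+y. indicator Q y * ennreal ((f y)\<^sup>2) \<partial>lborel) * ennreal c" .
  have "ennreal ((1 / c * ?I)\<^sup>2) = ennreal ((1 / c)\<^sup>2) * ennreal (?I\<^sup>2)"
    by (simp add: power_mult_distrib ennreal_mult[symmetric] del: times_divide_eq_left)
  also have "\<dots> \<le> ennreal ((1 / c)\<^sup>2) * ((\<integral>\<^sup>+y. indicator Q y * ennreal ((f y)\<^sup>2) \<partial>lborel) * ennreal c)"
    by (intro mult_left_mono *) simp
  also have "\<dots> = (ennreal ((1 / c)\<^sup>2) * ennreal c) * (\<integral>\<^sup>+y. indicator Q y * ennreal ((f y)\<^sup>2) \<partial>lborel)"
    by (simp only: mult_ac)
  also have "ennreal ((1 / c)\<^sup>2) * ennreal c = ennreal (1 / c)"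
    using c by (simp add: ennreal_mult[symmetric] power2_eq_square)
  finally show ?thesis .
next
  case False
  then show ?thesis by (simp add: not_integrable_integral_eq)
qed

lemma integrable_pair_lborelI:
  fixes F :: "'a::euclidean_space \<Rightarrow> 'b::euclidean_space \<Rightarrow> real"
  assumes m: "case_prod F \<in> borel_measurable (lborel \<Otimes>\<^sub>M lborel)"
    and fin: "(\<integral>\<^sup>+y. \<integral>\<^sup>+x. ennreal \<bar>F x y\<bar> \<partial>lborel \<partial>lborel) < \<infinity>"
  shows "integrable (lborel \<Otimes>\<^sub>M lborel) (case_prod F)"
  unfolding integrable_iff_bounded
proof (intro conjI m)
  have "(\<integral>\<^sup>+p. ennreal (norm (case_prod F p)) \<partial>(lborel \<Otimes>\<^sub>M lborel))
      = (\<integral>\<^sup>+y. \<integral>\<^sup>+x. ennreal \<bar>F x y\<bar> \<partial>lborel \<partial>lborel)"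
    using m by (subst lborel_pair.nn_integral_snd[symmetric]) auto
  with fin show "(\<integral>\<^sup>+p. ennreal (norm (case_prod F p)) \<partial>(lborel \<Otimes>\<^sub>M lborel)) < \<infinity>" by simp
qed

context
  fixes u :: "'a::euclidean_space \<Rightarrow> real" and G assumes uG: "sobolev_pair u G"
begin

text \<open>The integrability that justifies both the integration of \<open>G\<close> along segments and the exchange of the
  order of integration. Integrate over \<open>x\<close> first and use that \<open>\<bar>G\<bar> \<le> \<bar>G\<bar>\<^sup>2 + 1\<close>.\<close>

lemma sobolev_gradient_pair_integrable:
  "integrable (lborel \<Otimes>\<^sub>M lborel) (\<lambda>(x, t). indicator (cball 0 R) x * indicator {0..1::real} t * (G (x + t *\<^sub>R h) \<bullet> h))"
proof (rule integrable_pair_lborelI)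
  note [measurable] = sobolev_measurable[OF uG]
  let ?F = "\<lambda>x t. indicator (cball 0 R) x * indicator {0..1::real} t * (G (x + t *\<^sub>R h) \<bullet> h)"
  have [measurable]: "cball (0::'a) R \<in> sets borel" by simp
  show "(\<lambda>(x, t). ?F x t)
    \<in> borel_measurable (lborel \<Otimes>\<^sub>M lborel)" by measurable
  let ?B = "ennreal (norm h) * (L2sq G + emeasure lborel (cball (0::'a) R))"
  have le: "\<bar>G y \<bullet> h\<bar> \<le> norm h * ((norm (G y))\<^sup>2 + 1)" for y
  proof -
    have "norm (G y) \<le> (norm (G y))\<^sup>2 + 1"
      using sum_squares_bound[of "norm (G y)" 1] norm_ge_zero[of "G y"] unfolding power_one by linarith
    then show ?thesis
      using Cauchy_Schwarz_ineq2[of "G y" h] mult_left_mono[of "norm (G y)" "(norm (G y))\<^sup>2 + 1" "norm h"]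
      by (simp add: mult.commute)
  qed
  have "(\<integral>\<^sup>+x. ennreal \<bar>?F x t\<bar> \<partial>lborel)
     \<le> indicator {0..1} t * ?B" for t
  proof -
    have "(\<integral>\<^sup>+x. ennreal \<bar>?F x t\<bar> \<partial>lborel)
      \<le> (\<integral>\<^sup>+x. indicator {0..1} t * (ennreal (norm h) * (ennreal ((norm (G (x + t *\<^sub>R h)))\<^sup>2) + indicator (cball 0 R) x)) \<partial>lborel)"
    proof (rule nn_integral_mono)
      fix x
      show "ennreal \<bar>?F x t\<bar>
        \<le> indicator {0..1} t * (ennreal (norm h) * (ennreal ((norm (G (x + t *\<^sub>R h)))\<^sup>2) + indicator (cball 0 R) x))"
        using ennreal_leI[OF le[of "x + t *\<^sub>R h"]]
        by (auto simp: indicator_def ennreal_mult ennreal_plus simp del: ennreal_leI)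
    qed
    also have "\<dots> = indicator {0..1} t * (ennreal (norm h) * (L2sq G + emeasure lborel (cball (0::'a) R)))"
      using nn_integral_translate[of "\<lambda>x. ennreal ((norm (G x))\<^sup>2)" "t *\<^sub>R h"]
      by (simp add: nn_integral_cmult nn_integral_add L2sq_def)
    finally show ?thesis .
  qed
  then have "(\<integral>\<^sup>+t. \<integral>\<^sup>+x. ennreal \<bar>?F x t\<bar> \<partial>lborel \<partial>lborel)
    \<le> (\<integral>\<^sup>+t. indicator {0..1::real} t * ?B \<partial>lborel)" by (intro nn_integral_mono)
  also have "\<dots> = ?B" by (simp add: nn_integral_multc)
  also have "\<dots> < \<infinity>" using sobolev_gradient_finite[OF uG] emeasure_lborel_cball_finite[of "0::'a" R]
    by (simp add: ennreal_mult_less_top)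
  finally show "(\<integral>\<^sup>+t. \<integral>\<^sup>+x. ennreal \<bar>?F x t\<bar> \<partial>lborel \<partial>lborel) < \<infinity>" .
qed

lemma sobolev_line_integral_loc_integrable:
  "loc_integrable (\<lambda>x. segment_integral G h x)"
  unfolding loc_integrable_def
proof (intro conjI allI)
  note [measurable] = sobolev_measurable[OF uG]
  show "(\<lambda>x. segment_integral G h x) \<in> borel_measurable borel"
    by measurable
  fix R
  have "integrable lborel (\<lambda>x. LINT t|lborel. indicator (cball 0 R) x * indicator {0..1::real} t * (G (x + t *\<^sub>R h) \<bullet> h))"
    using lborel_pair.integrable_fst[OF sobolev_gradient_pair_integrable] by simp
  then show "set_integrable lborel (cball 0 R) (\<lambda>x. segment_integral G h x)"
    by (simp add: set_integrable_def mult.assoc)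
qed

text \<open>Move the translation of \<open>u\<close> to the test function, write the increment of the test function as an integral
  of its derivative along the segment, exchange the integrals, and apply the definition of the weak
  gradient to the translated test functions \<open>\<phi>(x - t h)\<close>.\<close>

lemma sobolev_increment_weak:
  assumes \<phi>: "test_function \<phi>"
  shows "(LINT x|lborel. (u (x + h) - u x) * \<phi> x)
       = (LINT x|lborel. segment_integral G h x * \<phi> x)"
proof -
  note [measurable] = sobolev_measurable[OF uG]
  obtain R where "R > 0" and R: "\<And>x. norm x > R \<Longrightarrow> \<phi> x = 0"
      "\<And>x b. norm x > R \<Longrightarrow> partial_derivative b \<phi> x = 0"
    by (rule test_function_support[OF \<phi>], rule that)
  let ?F = "\<lambda>x t. indicator (cball 0 R) x * indicator {0..1::real} t * (G (x + t *\<^sub>R h) \<bullet> h)"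
  let ?D = "dir_deriv \<phi> h"
  have D0: "?D x = 0" if "norm x > R" for x using R(2)[OF that] by (simp add: dir_deriv_def)
  obtain C where C: "C \<ge> 0" "\<And>x. \<bar>\<phi> x\<bar> \<le> C"
    by (rule continuous_support_bounded[OF test_function_continuous[OF \<phi>] R(1)], assumption, rule that)
  obtain C' where C': "C' \<ge> 0" "\<And>x. \<bar>?D x\<bar> \<le> C'"
    by (rule continuous_support_bounded[OF dir_deriv_continuous[OF \<phi>] D0], assumption, rule that)
  have [measurable]: "\<phi> \<in> borel_measurable borel" "?D \<in> borel_measurable borel"
    using test_function_continuous[OF \<phi>] dir_deriv_continuous[OF \<phi>] by (auto intro: borel_measurable_continuous_onI)
  note li = sobolev_loc_integrable[OF uG]
  have int: "integrable lborel (\<lambda>x. u (x + c) * \<phi> x)" for c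
    by (rule loc_integrable_mult[OF loc_integrable_translate[OF li] test_function_continuous[OF \<phi>] R(1)])
  have int': "integrable lborel (\<lambda>x. u x * \<phi> (x + c))" for c
    using integrable_translate[OF int[of "- c"], of c] by simp
  have "(LINT x|lborel. (u (x + h) - u x) * \<phi> x)
      = (LINT x|lborel. u (x + h) * \<phi> x) - (LINT x|lborel. u x * \<phi> x)"
    using int[of h] int[of 0] by (simp add: left_diff_distrib)
  also have "(LINT x|lborel. u (x + h) * \<phi> x) = (LINT x|lborel. u x * \<phi> (x - h))"
    using integral_translate[of "\<lambda>x. u (x + h) * \<phi> x" "- h"] by simp
  also have "\<dots> - (LINT x|lborel. u x * \<phi> x) = (LINT x|lborel. u x * (\<phi> (x - h) - \<phi> x))"
    using int'[of "- h"] int'[of 0] by (simp add: right_diff_distrib)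
  also have "\<dots> = - (LINT x|lborel. (LINT t|lborel. u x * (?D (x - t *\<^sub>R h) * indicator {0..1} t)))"
    by (simp add: test_function_increment[OF \<phi>])
  also have "(LINT x|lborel. (LINT t|lborel. u x * (?D (x - t *\<^sub>R h) * indicator {0..1} t)))
     = (LINT t|lborel. (LINT x|lborel. u x * (?D (x - t *\<^sub>R h) * indicator {0..1} t)))"
  proof (rule lborel_pair.Fubini_integral[symmetric], rule integrable_pair_lborelI)
    let ?K = "cball (0::'a) (R + norm h)"
    let ?B = "ennreal C' * (\<integral>\<^sup>+x. ennreal \<bar>indicator ?K x * u x\<bar> \<partial>lborel)"
    show "(\<lambda>(x, t). u x * (?D (x - t *\<^sub>R h) * indicator {0..1} t)) \<in> borel_measurable (lborel \<Otimes>\<^sub>M lborel)"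
      by measurable
    have le: "ennreal \<bar>u x * (?D (x - t *\<^sub>R h) * indicator {0..1} t)\<bar>
       \<le> indicator {0..1} t * (ennreal C' * ennreal \<bar>indicator ?K x * u x\<bar>)" for x t
    proof (cases "t \<in> {0..1} \<and> norm (x - t *\<^sub>R h) \<le> R")
      case True
      have "norm x \<le> norm (x - t *\<^sub>R h) + norm (t *\<^sub>R h)" using norm_triangle_ineq[of "x - t *\<^sub>R h" "t *\<^sub>R h"] by simp
      also have "\<dots> \<le> R + norm h" using True by (intro add_mono) (auto simp: mult_left_le_one_le)
      finally have "x \<in> ?K" by simp
      with True C' show ?thesis
        by (auto simp: abs_mult mult.commute[of C'] ennreal_mult[symmetric] intro!: ennreal_leI mult_left_mono)
    next
      case False
      then show ?thesis using D0[of "x - t *\<^sub>R h"] by (auto simp: indicator_def not_le)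
    qed
    have "(\<integral>\<^sup>+t. \<integral>\<^sup>+x. ennreal \<bar>u x * (?D (x - t *\<^sub>R h) * indicator {0..1} t)\<bar> \<partial>lborel \<partial>lborel)
      \<le> (\<integral>\<^sup>+t. \<integral>\<^sup>+x. indicator {0..1::real} t * (ennreal C' * ennreal \<bar>indicator ?K x * u x\<bar>) \<partial>lborel \<partial>lborel)"
      by (intro nn_integral_mono le)
    also have "\<dots> = ?B"
    proof -
      have [measurable]: "?K \<in> sets borel" by simp
      have "(\<lambda>x. ennreal \<bar>indicator ?K x * u x\<bar>) \<in> borel_measurable lborel" by measurable
      then show ?thesis by (simp add: nn_integral_cmult nn_integral_multc)
    qed
    also have "\<dots> < \<infinity>"
      using li by (auto simp: loc_integrable_def set_integrable_def integrable_iff_bounded ennreal_mult_less_top)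
    finally show "(\<integral>\<^sup>+t. \<integral>\<^sup>+x. ennreal \<bar>u x * (?D (x - t *\<^sub>R h) * indicator {0..1} t)\<bar> \<partial>lborel \<partial>lborel) < \<infinity>" .
  qed
  also have "- \<dots> = (LINT t|lborel. (LINT x|lborel. indicator {0..1} t * (G (x + t *\<^sub>R h) \<bullet> h) * \<phi> x))"
  proof -
    have "(LINT x|lborel. u x * (?D (x - t *\<^sub>R h) * indicator {0..1} t))
      = - (LINT x|lborel. indicator {0..1} t * (G (x + t *\<^sub>R h) \<bullet> h) * \<phi> x)" for t
    proof -
      have "(LINT x|lborel. u x * (?D (x - t *\<^sub>R h) * indicator {0..1} t))
        = (LINT x|lborel. indicator {0..1} t * (u x * ?D (x - t *\<^sub>R h)))"
        by (simp only: mult_ac)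
      also have "\<dots> = indicator {0..1} t * (LINT x|lborel. u x * dir_deriv (\<lambda>x. \<phi> (x + - (t *\<^sub>R h))) h x)"
        unfolding dir_deriv_translate[OF \<phi>] by simp
      also have "(LINT x|lborel. u x * dir_deriv (\<lambda>x. \<phi> (x + - (t *\<^sub>R h))) h x)
        = - (LINT x|lborel. (G x \<bullet> h) * \<phi> (x + - (t *\<^sub>R h)))"
        by (rule sobolev_weak_directional[OF uG test_function_translate[OF \<phi>]])
      also have "(LINT x|lborel. (G x \<bullet> h) * \<phi> (x + - (t *\<^sub>R h))) = (LINT x|lborel. (G (x + t *\<^sub>R h) \<bullet> h) * \<phi> x)"
        using integral_translate[of "\<lambda>x. (G x \<bullet> h) * \<phi> (x + - (t *\<^sub>R h))" "t *\<^sub>R h"] by simp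
      finally show ?thesis by (simp add: mult.assoc)
    qed
    then show ?thesis by simp
  qed
  also have "\<dots> = (LINT x|lborel. (LINT t|lborel. indicator {0..1} t * (G (x + t *\<^sub>R h) \<bullet> h) * \<phi> x))"
  proof (rule lborel_pair.Fubini_integral)
    have "integrable (lborel \<Otimes>\<^sub>M lborel) (\<lambda>p. C * (case p of (x, t) \<Rightarrow> ?F x t))"
      by (intro integrable_mult_right sobolev_gradient_pair_integrable)
    then show "integrable (lborel \<Otimes>\<^sub>M lborel) (\<lambda>(x, t). indicator {0..1::real} t * (G (x + t *\<^sub>R h) \<bullet> h) * \<phi> x)"
    proof (rule Bochner_Integration.integrable_bound)
      show "AE p in lborel \<Otimes>\<^sub>M lborel. norm (case p of (x, t) \<Rightarrow> indicator {0..1::real} t * (G (x + t *\<^sub>R h) \<bullet> h) * \<phi> x)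
        \<le> norm (C * (case p of (x, t) \<Rightarrow> ?F x t))"
        using C R(1) by (intro AE_I2) (auto simp: indicator_def abs_mult mult.commute intro!: mult_right_mono)
    qed measurable
  qed
  also have "\<dots> = (LINT x|lborel. segment_integral G h x * \<phi> x)"
    by simp
  finally show ?thesis .
qed

lemma sobolev_increment_AE:
  "AE x in lborel. u (x + h) - u x = segment_integral G h x"
proof -
  let ?v = "\<lambda>x. segment_integral G h x"
  note li = loc_integrable_translate[OF sobolev_loc_integrable[OF uG], of h] sobolev_loc_integrable[OF uG]
    sobolev_line_integral_loc_integrable[of h]
  have "AE x in lborel. u (x + h) - u x - ?v x = 0"
  proof (rule AE_eq_0_if_test_integrals_0)
    show "loc_integrable (\<lambda>x. u (x + h) - u x - ?v x)"
      using li unfolding loc_integrable_def by (auto intro!: borel_measurable_diff set_integral_diff(1))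
    fix \<phi> :: "'a \<Rightarrow> real" assume \<phi>: "test_function \<phi>"
    obtain R where "R > 0" and R: "\<And>x. norm x > R \<Longrightarrow> \<phi> x = 0"
        "\<And>x b. norm x > R \<Longrightarrow> partial_derivative b \<phi> x = 0"
      by (rule test_function_support[OF \<phi>], rule that)
    note i = li[THEN loc_integrable_mult, OF test_function_continuous[OF \<phi>] R(1)]
    have "(LINT x|lborel. (u (x + h) - u x - ?v x) * \<phi> x)
      = (LINT x|lborel. (u (x + h) - u x) * \<phi> x) - (LINT x|lborel. ?v x * \<phi> x)"
      using i by (simp add: left_diff_distrib)
    then show "(LINT x|lborel. (u (x + h) - u x - ?v x) * \<phi> x) = 0"
      by (simp add: sobolev_increment_weak[OF \<phi>])
  qed
  then show ?thesis by eventually_elim simp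
qed

text \<open>Jensen's inequality on the segment bounds the squared increment by the mean of
  \<open>\<bar>h\<bar>\<^sup>2 \<bar>G\<bar>\<^sup>2\<close> along the segment; each translate of \<open>G\<close> has the same \<open>L\<^sup>2\<close> norm as \<open>G\<close>.\<close>

lemma sobolev_translation_estimate:
  "L2sq (\<lambda>x. u (x + h) - u x) \<le> ennreal ((norm h)\<^sup>2) * L2sq G"
proof -
  note [measurable] = sobolev_measurable[OF uG]
  have pt: "ennreal ((norm (segment_integral G h x))\<^sup>2)
      \<le> (\<integral>\<^sup>+t. indicator {0..1} t * (ennreal ((norm h)\<^sup>2) * ennreal ((norm (G (x + t *\<^sub>R h)))\<^sup>2)) \<partial>lborel)" for x
  proof -
    have "ennreal ((norm (segment_integral G h x))\<^sup>2)
        \<le> (\<integral>\<^sup>+t. indicator {0..1} t * ennreal ((G (x + t *\<^sub>R h) \<bullet> h)\<^sup>2) \<partial>lborel)"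
      using Jensen_L2[of "\<lambda>t. G (x + t *\<^sub>R h) \<bullet> h" "{0..1::real}" 1] by simp
    also have "\<dots> \<le> (\<integral>\<^sup>+t. indicator {0..1} t * (ennreal ((norm h)\<^sup>2) * ennreal ((norm (G (x + t *\<^sub>R h)))\<^sup>2)) \<partial>lborel)"
    proof (intro nn_integral_mono mult_left_mono)
      fix t :: real
      have "(G (x + t *\<^sub>R h) \<bullet> h)\<^sup>2 \<le> (norm h)\<^sup>2 * (norm (G (x + t *\<^sub>R h)))\<^sup>2"
        using Cauchy_Schwarz_ineq[of "G (x + t *\<^sub>R h)" h] by (simp add: power2_norm_eq_inner mult.commute)
      then show "ennreal ((G (x + t *\<^sub>R h) \<bullet> h)\<^sup>2) \<le> ennreal ((norm h)\<^sup>2) * ennreal ((norm (G (x + t *\<^sub>R h)))\<^sup>2)"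
        by (simp add: ennreal_mult[symmetric] ennreal_leI)
    qed simp
    finally show ?thesis .
  qed
  have "L2sq (\<lambda>x. u (x + h) - u x) = (\<integral>\<^sup>+x. ennreal ((norm (segment_integral G h x))\<^sup>2) \<partial>lborel)"
    unfolding L2sq_def by (rule nn_integral_cong_AE) (use sobolev_increment_AE[of h] in eventually_elim, simp)
  also have "\<dots> \<le> (\<integral>\<^sup>+x. \<integral>\<^sup>+t. indicator {0..1} t * (ennreal ((norm h)\<^sup>2) * ennreal ((norm (G (x + t *\<^sub>R h)))\<^sup>2)) \<partial>lborel \<partial>lborel)"
    by (intro nn_integral_mono pt)
  also have "\<dots> = (\<integral>\<^sup>+t. \<integral>\<^sup>+x. indicator {0..1} t * (ennreal ((norm h)\<^sup>2) * ennreal ((norm (G (x + t *\<^sub>R h)))\<^sup>2)) \<partial>lborel \<partial>lborel)"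
    by (rule lborel_pair.Fubini') measurable
  also have "\<dots> = (\<integral>\<^sup>+t. indicator {0..1::real} t * (ennreal ((norm h)\<^sup>2) * L2sq G) \<partial>lborel)"
    using nn_integral_translate[of "\<lambda>x. ennreal ((norm (G x))\<^sup>2)"]
    by (simp add: nn_integral_cmult L2sq_def)
  also have "\<dots> = ennreal ((norm h)\<^sup>2) * L2sq G" by (simp add: nn_integral_multc)
  finally show ?thesis .
qed
end

section \<open>The Poincare inequality on sets of finite measure\<close>

lemma AE_translate:
  fixes c :: "'a::euclidean_space"
  assumes "AE x in lborel. P x"
  shows "AE x in lborel. P (x + c)"
proof -
  obtain N where N: "N \<in> null_sets lborel" "{x. \<not> P x} \<subseteq> N"
    by (rule AE_E3[OF assms], rule that) auto
  have [measurable]: "N \<in> sets borel" using N by (auto simp: null_sets_def)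
  have [measurable]: "(\<lambda>x. x + c) -` N \<in> sets borel"
    using measurable_sets[of "\<lambda>x. x + c" borel borel N] by simp
  have "emeasure lborel ((\<lambda>x. x + c) -` N) = (\<integral>\<^sup>+x. indicator N (x + c) \<partial>lborel)"
  proof -
    have "(\<integral>\<^sup>+x. indicator N (x + c) \<partial>lborel) = (\<integral>\<^sup>+x. indicator ((\<lambda>x. x + c) -` N) x \<partial>lborel)"
      by (intro nn_integral_cong) (simp add: indicator_def)
    then show ?thesis by simp
  qed
  also have "\<dots> = 0"
    using N by (subst nn_integral_translate) (auto simp: null_sets_def)
  finally have "(\<lambda>x. x + c) -` N \<in> null_sets lborel"
    by (auto simp: null_sets_def)
  then show ?thesis
    by (rule AE_I') (use N in auto)
qed

text \<open>Average the translation estimate over the shifts \<open>h\<close> in a cube \<open>B\<close> of volume at least \<open>2 |\<Omega>|\<close>: for each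
  \<open>x\<close>, at least half of these shifts move \<open>x\<close> out of \<open>\<Omega>\<close>, where \<open>u\<close> vanishes. The argument starts from
  a function that is only locally square integrable and proves that it is square integrable.\<close>

lemma poincare_finite_measure:
  fixes \<Omega> :: "'a::euclidean_space set"
  assumes [measurable]: "\<Omega> \<in> sets borel" and fin: "emeasure lborel \<Omega> < \<infinity>"
  shows "\<exists>C\<ge>0. \<forall>u G. sobolev_pair u G \<longrightarrow> (AE x in lborel. x \<notin> \<Omega> \<longrightarrow> u x = 0) \<longrightarrow>
           L2sq u \<le> ennreal C * L2sq G"
proof -
  define m where "m = measure lborel \<Omega>"
  have m: "emeasure lborel \<Omega> = ennreal m" "m \<ge> 0"
    using fin by (auto simp: m_def emeasure_eq_ennreal_measure)
  define B where "B = cbox (- ((m + 1) *\<^sub>R One)) ((m + 1) *\<^sub>R One :: 'a)"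
  define V where "V = (2 * (m + 1)) ^ DIM('a)"
  define K where "K = DIM('a) * (m + 1)"
  have [measurable]: "B \<in> sets borel" by (simp add: B_def)
  have V: "V \<ge> 2 * m + 2"
    using m power_increasing[of 1 "DIM('a)" "2 * (m + 1)"] by (simp add: V_def Suc_le_eq)
  have VB: "emeasure lborel B = ennreal V"
    using m by (simp add: B_def V_def emeasure_lborel_cbox_eq inner_simps prod_constant)
  have KB: "norm h \<le> K" if "h \<in> B" for h
  proof -
    have "norm h \<le> (\<Sum>b\<in>Basis. \<bar>h \<bullet> b\<bar>)" by (rule norm_le_l1)
    also have "\<dots> \<le> (\<Sum>b\<in>(Basis::'a set). m + 1)"
      using that by (intro sum_mono) (auto simp: B_def mem_box abs_le_iff minus_le_iff)
    finally show ?thesis by (simp add: K_def)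
  qed
  have "L2sq u \<le> ennreal (2 * K\<^sup>2) * L2sq G"
    if uG: "sobolev_pair u G" and zero: "AE x in lborel. x \<notin> \<Omega> \<longrightarrow> u x = 0" for u :: "'a \<Rightarrow> real" and G
  proof -
    note [measurable] = sobolev_measurable[OF uG]
    have low: "ennreal (V / 2) \<le> (\<integral>\<^sup>+h. indicator B h * indicator (- \<Omega>) (x + h) \<partial>lborel)" (is "_ \<le> ?I") for x
    proof -
      have "ennreal V = (\<integral>\<^sup>+h. indicator B h \<partial>lborel)" by (simp add: VB)
      also have "\<dots> \<le> (\<integral>\<^sup>+h. indicator B h * indicator (- \<Omega>) (x + h) + indicator \<Omega> (h + x) \<partial>lborel)"
        by (intro nn_integral_mono) (auto simp: indicator_def add.commute)
      also have "\<dots> = ?I + (\<integral>\<^sup>+h. indicator \<Omega> (h + x) \<partial>lborel)"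
        by (rule nn_integral_add) measurable
      also have "(\<integral>\<^sup>+h. indicator \<Omega> (h + x) \<partial>lborel) = ennreal m"
        by (subst nn_integral_translate) (auto simp: m)
      finally have *: "ennreal V \<le> ?I + ennreal m" .
      show ?thesis
      proof (cases ?I)
        case (real r)
        with * m have "V \<le> r + m" by (simp add: ennreal_plus[symmetric] del: ennreal_plus)
        with V real show ?thesis by (simp add: ennreal_leI)
      qed simp
    qed
    have "ennreal (V / 2) * L2sq u = (\<integral>\<^sup>+x. ennreal ((u x)\<^sup>2) * ennreal (V / 2) \<partial>lborel)"
      by (subst nn_integral_multc) (auto simp: L2sq_def mult.commute)
    also have "\<dots> \<le> (\<integral>\<^sup>+x. ennreal ((u x)\<^sup>2) * (\<integral>\<^sup>+h. indicator B h * indicator (- \<Omega>) (x + h) \<partial>lborel) \<partial>lborel)"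
      by (intro nn_integral_mono mult_left_mono low) simp
    also have "\<dots> = (\<integral>\<^sup>+x. \<integral>\<^sup>+h. ennreal ((u x)\<^sup>2) * (indicator B h * indicator (- \<Omega>) (x + h)) \<partial>lborel \<partial>lborel)"
      by (subst nn_integral_cmult) auto
    also have "\<dots> = (\<integral>\<^sup>+h. \<integral>\<^sup>+x. ennreal ((u x)\<^sup>2) * (indicator B h * indicator (- \<Omega>) (x + h)) \<partial>lborel \<partial>lborel)"
      by (rule lborel_pair.Fubini') measurable
    also have "\<dots> \<le> (\<integral>\<^sup>+h. indicator B h * (ennreal (K\<^sup>2) * L2sq G) \<partial>lborel)"
    proof (rule nn_integral_mono)
      fix h :: 'a
      have "(\<integral>\<^sup>+x. ennreal ((u x)\<^sup>2) * (indicator B h * indicator (- \<Omega>) (x + h)) \<partial>lborel)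
        \<le> (\<integral>\<^sup>+x. indicator B h * ennreal ((norm (u (x + h) - u x))\<^sup>2) \<partial>lborel)"
        by (rule nn_integral_mono_AE)
           (use AE_translate[OF zero, of h] in \<open>eventually_elim, auto simp: indicator_def\<close>)
      also have "\<dots> = indicator B h * L2sq (\<lambda>x. u (x + h) - u x)"
        unfolding L2sq_def by (rule nn_integral_cmult) measurable
      also have "\<dots> \<le> indicator B h * (ennreal (K\<^sup>2) * L2sq G)"
      proof (cases "h \<in> B")
        case True
        have "L2sq (\<lambda>x. u (x + h) - u x) \<le> ennreal ((norm h)\<^sup>2) * L2sq G"
          by (rule sobolev_translation_estimate[OF uG])
        also have "\<dots> \<le> ennreal (K\<^sup>2) * L2sq G"
          using KB[OF True] by (intro mult_right_mono ennreal_leI power_mono) auto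
        finally show ?thesis using True by simp
      qed simp
      finally show "(\<integral>\<^sup>+x. ennreal ((u x)\<^sup>2) * (indicator B h * indicator (- \<Omega>) (x + h)) \<partial>lborel)
        \<le> indicator B h * (ennreal (K\<^sup>2) * L2sq G)" .
    qed
    also have "\<dots> = ennreal V * (ennreal (K\<^sup>2) * L2sq G)"
      by (simp add: nn_integral_multc VB)
    finally have *: "ennreal (V / 2) * L2sq u \<le> ennreal V * (ennreal (K\<^sup>2) * L2sq G)" .
    have "ennreal (2 / V) * (ennreal (V / 2) * L2sq u) = L2sq u"
      using V m by (simp add: mult.assoc[symmetric] ennreal_mult[symmetric])
    moreover have "ennreal (2 / V) * (ennreal V * (ennreal (K\<^sup>2) * L2sq G)) = ennreal (2 * K\<^sup>2) * L2sq G"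
      using V m by (simp add: mult.assoc[symmetric] ennreal_mult[symmetric])
    ultimately show ?thesis using mult_left_mono[OF *, of "ennreal (2 / V)"] by simp
  qed
  then show ?thesis by (intro exI[of _ "2 * K\<^sup>2"]) auto
qed

section \<open>Borel representatives and uniqueness of the weak gradient\<close>

lemma borel_representative:
  fixes f :: "'a::euclidean_space \<Rightarrow> 'b::euclidean_space"
  assumes "f \<in> borel_measurable lebesgue"
  obtains f' where "f' \<in> borel_measurable borel" "AE x in lborel. f x = f' x"
proof -
  have "\<exists>g. g \<in> borel_measurable lborel \<and> (AE x in lborel. f x \<bullet> b = g x)" for b
    using completion_ex_borel_measurable_real[of "\<lambda>x. f x \<bullet> b" lborel] assms by auto
  then obtain g where g: "\<And>b. g b \<in> borel_measurable lborel" "\<And>b. AE x in lborel. f x \<bullet> b = g b x"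
    by metis
  show ?thesis
  proof
    show "(\<lambda>x. \<Sum>b\<in>Basis. g b x *\<^sub>R b) \<in> borel_measurable borel" using g(1) by simp
    have "AE x in lborel. \<forall>b\<in>Basis. f x \<bullet> b = g b x" using g(2) by (intro AE_finite_allI) auto
    then show "AE x in lborel. f x = (\<Sum>b\<in>Basis. g b x *\<^sub>R b)"
    proof eventually_elim
      case (elim x)
      then have "(\<Sum>b\<in>Basis. g b x *\<^sub>R b) = (\<Sum>b\<in>Basis. (f x \<bullet> b) *\<^sub>R b)" by simp
      then show ?case by (simp add: euclidean_representation)
    qed
  qed
qed

lemma integral_lebesgue_representative:
  fixes f :: "'a::euclidean_space \<Rightarrow> real"
  assumes "f \<in> borel_measurable lebesgue" "f' \<in> borel_measurable borel" "AE x in lborel. f x = f' x"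
  shows "(LINT x|lebesgue. f x) = (LINT x|lborel. f' x)"
proof -
  have "(LINT x|lebesgue. f x) = (LINT x|lebesgue. f' x)"
    using assms by (intro integral_cong_AE) (auto simp: AE_completion_iff intro: measurable_completion)
  also have "\<dots> = (LINT x|lborel. f' x)"
    using assms by (intro integral_completion) auto
  finally show ?thesis .
qed

lemma integrable_lebesgue_representative:
  fixes f :: "'a::euclidean_space \<Rightarrow> real"
  assumes "f \<in> borel_measurable lebesgue" "f' \<in> borel_measurable borel" "AE x in lborel. f x = f' x"
  shows "integrable lebesgue f \<longleftrightarrow> integrable lborel f'"
proof -
  have "integrable lebesgue f \<longleftrightarrow> integrable lebesgue f'"
    using assms by (intro integrable_cong_AE) (auto simp: AE_completion_iff intro: measurable_completion)
  also have "\<dots> \<longleftrightarrow> integrable lborel f'"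
    using assms by (intro integrable_completion) auto
  finally show ?thesis .
qed

lemma test_function_measurable:
  assumes "test_function \<phi>"
  shows "\<phi> \<in> borel_measurable borel" "b \<in> Basis \<Longrightarrow> partial_derivative b \<phi> \<in> borel_measurable borel"
  using test_function_continuous[OF assms] test_function_partial_continuous[OF assms]
  by (auto intro: borel_measurable_continuous_onI)

lemma weak_gradient_component_borel:
  assumes G: "has_weak_gradient u G" "G' \<in> borel_measurable borel" "AE x in lborel. G x = G' x"
  shows "loc_integrable (\<lambda>x. G' x \<bullet> b)"
    and "test_function \<phi> \<Longrightarrow> (LINT x|lebesgue. (G x \<bullet> b) * \<phi> x) = (LINT x|lborel. (G' x \<bullet> b) * \<phi> x)"
proof -
  have m: "G \<in> borel_measurable lebesgue" using G(1) by (simp add: has_weak_gradient_def)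
  show "loc_integrable (\<lambda>x. G' x \<bullet> b)" unfolding loc_integrable_def
  proof (intro conjI allI)
    fix R
    have "set_integrable lebesgue (cball 0 R) G"
      using G(1) by (simp add: has_weak_gradient_def)
    then have "integrable lebesgue (\<lambda>x. (indicator (cball 0 R) x *\<^sub>R G x) \<bullet> b)"
      unfolding set_integrable_def by (rule integrable_inner_left) 
    then have "integrable lborel (\<lambda>x. (indicator (cball 0 R) x *\<^sub>R G' x) \<bullet> b)"
      by (subst (asm) integrable_lebesgue_representative)
         (use G m in \<open>auto intro!: borel_measurable_inner borel_measurable_times borel_measurable_indicator\<close>)
    then show "set_integrable lborel (cball 0 R) (\<lambda>x. G' x \<bullet> b)"
      by (simp add: set_integrable_def)
  qed (use G(2) in simp)
  assume \<phi>: "test_function \<phi>"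
  show "(LINT x|lebesgue. (G x \<bullet> b) * \<phi> x) = (LINT x|lborel. (G' x \<bullet> b) * \<phi> x)"
    by (rule integral_lebesgue_representative)
       (use G m test_function_measurable[OF \<phi>] in \<open>auto intro!: borel_measurable_times borel_measurable_inner intro: measurable_completion\<close>)
qed

text \<open>The difference of two weak gradients is annihilated by all test functions.\<close>

lemma weak_gradient_unique:
  assumes "has_weak_gradient u G" "has_weak_gradient u H"
  shows "AE x in lborel. G x = H x"
proof -
  have Gm: "G \<in> borel_measurable lebesgue" and Hm: "H \<in> borel_measurable lebesgue"
    using assms by (auto simp: has_weak_gradient_def)
  obtain G' where G': "G' \<in> borel_measurable borel" "AE x in lborel. G x = G' x"
    by (rule borel_representative[OF Gm], rule that)
  obtain H' where H': "H' \<in> borel_measurable borel" "AE x in lborel. H x = H' x"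
    by (rule borel_representative[OF Hm], rule that)
  note g = weak_gradient_component_borel[OF assms(1) G'] and h = weak_gradient_component_borel[OF assms(2) H']
  have "AE x in lborel. G' x \<bullet> b - H' x \<bullet> b = 0" if b: "b \<in> Basis" for b
  proof (rule AE_eq_0_if_test_integrals_0)
    show "loc_integrable (\<lambda>x. G' x \<bullet> b - H' x \<bullet> b)"
      using g(1)[of b] h(1)[of b] unfolding loc_integrable_def by (auto intro!: borel_measurable_diff set_integral_diff(1))
    fix \<phi> :: "'a \<Rightarrow> real" assume \<phi>: "test_function \<phi>"
    obtain R where "R > 0" and R: "\<And>x. norm x > R \<Longrightarrow> \<phi> x = 0"
        "\<And>x b. norm x > R \<Longrightarrow> partial_derivative b \<phi> x = 0"
      by (rule test_function_support[OF \<phi>], rule that)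
    have "(LINT x|lebesgue. u x * partial_derivative b \<phi> x) = - (LINT x|lebesgue. (G x \<bullet> b) * \<phi> x)"
      using assms(1) \<phi> b unfolding has_weak_gradient_def by blast
    moreover have "(LINT x|lebesgue. u x * partial_derivative b \<phi> x) = - (LINT x|lebesgue. (H x \<bullet> b) * \<phi> x)"
      using assms(2) \<phi> b unfolding has_weak_gradient_def by blast
    ultimately have "(LINT x|lborel. (G' x \<bullet> b) * \<phi> x) = (LINT x|lborel. (H' x \<bullet> b) * \<phi> x)"
      by (simp add: g(2)[OF \<phi>] h(2)[OF \<phi>])
    then show "(LINT x|lborel. (G' x \<bullet> b - H' x \<bullet> b) * \<phi> x) = 0"
      using loc_integrable_mult[OF g(1)[of b] test_function_continuous[OF \<phi>] R(1)]
        loc_integrable_mult[OF h(1)[of b] test_function_continuous[OF \<phi>] R(1)]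
      by (simp add: left_diff_distrib)
  qed
  then have "AE x in lborel. \<forall>b\<in>Basis. G' x \<bullet> b - H' x \<bullet> b = 0" by (intro AE_finite_allI) auto
  with G'(2) H'(2) show ?thesis
    by eventually_elim (auto intro: euclidean_eqI)
qed

text \<open>The chosen \<^term>\<open>weak_gradient\<close> is only known to be locally integrable. By uniqueness it agrees almost
  everywhere with a square integrable weak gradient.\<close>

lemma W12_representative:
  assumes u: "u \<in> W12"
  obtains u' G where "sobolev_pair u' G" "AE x in lborel. u x = u' x" "AE x in lborel. weak_gradient u x = G x"
proof -
  obtain H where H: "has_weak_gradient u H" "integrable lebesgue (\<lambda>x. (norm (H x))\<^sup>2)"
    using u by (auto simp: W12_def)
  have wg: "has_weak_gradient u (weak_gradient u)"
    unfolding weak_gradient_def by (rule someI[where P="has_weak_gradient u", OF H(1)])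
  have um: "u \<in> borel_measurable lebesgue" and Hm: "H \<in> borel_measurable lebesgue"
    using u H by (auto simp: W12_def locally_L2_def has_weak_gradient_def)
  obtain u' where u': "u' \<in> borel_measurable borel" "AE x in lborel. u x = u' x"
    by (rule borel_representative[OF um], rule that)
  obtain G where G: "G \<in> borel_measurable borel" "AE x in lborel. H x = G x"
    by (rule borel_representative[OF Hm], rule that)
  have "sobolev_pair u' G" unfolding sobolev_pair_def
  proof (intro conjI allI impI)
    fix R
    have "integrable lebesgue (\<lambda>x. indicator (cball 0 R) x * (u x)\<^sup>2)"
      using u by (auto simp: W12_def locally_L2_def set_integrable_def)
    then have "integrable lborel (\<lambda>x. indicator (cball 0 R) x * (u' x)\<^sup>2)"
      by (subst (asm) integrable_lebesgue_representative)
         (use u' um in \<open>auto intro!: borel_measurable_times borel_measurable_power borel_measurable_indicator\<close>)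
    then show "set_integrable lborel (cball 0 R) (\<lambda>x. (u' x)\<^sup>2)" by (simp add: set_integrable_def)
  next
    have "integrable lborel (\<lambda>x. (norm (G x))\<^sup>2)"
      using H(2) by (subst (asm) integrable_lebesgue_representative)
         (use G Hm in \<open>auto intro!: borel_measurable_power borel_measurable_norm\<close>)
    then show "L2sq G < \<infinity>" by (auto simp: L2sq_def integrable_iff_bounded)
  next
    fix \<phi> :: "'a \<Rightarrow> real" and b :: 'a assume \<phi>: "test_function \<phi>" and b: "b \<in> Basis"
    have "(LINT x|lborel. u' x * partial_derivative b \<phi> x) = (LINT x|lebesgue. u x * partial_derivative b \<phi> x)"
      by (rule integral_lebesgue_representative[symmetric])
         (use u' um test_function_measurable[OF \<phi>] b in \<open>auto intro!: borel_measurable_times intro: measurable_completion\<close>)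
    also have "\<dots> = - (LINT x|lebesgue. (H x \<bullet> b) * \<phi> x)"
      using H(1) \<phi> b unfolding has_weak_gradient_def by blast
    also have "\<dots> = - (LINT x|lborel. (G x \<bullet> b) * \<phi> x)"
      by (simp add: weak_gradient_component_borel(2)[OF H(1) G \<phi>])
    finally show "(LINT x|lborel. u' x * partial_derivative b \<phi> x) = - (LINT x|lborel. (G x \<bullet> b) * \<phi> x)" .
  qed (use u' G in auto)
  moreover have "AE x in lborel. weak_gradient u x = G x"
    using weak_gradient_unique[OF wg H(1)] G(2) by eventually_elim simp
  ultimately show thesis using that u'(2) by blast
qed

lemma sobolev_pair_W12:
  assumes uG: "sobolev_pair u G"
  shows "u \<in> W12" "AE x in lborel. weak_gradient u x = G x"
proof -
  note m = sobolev_measurable[OF uG]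
  have K: "\<exists>R. K \<subseteq> cball 0 R \<and> K \<in> sets borel" if cK: "compact K" for K :: "'a set"
  proof -
    obtain R where "\<forall>x\<in>K. norm x \<le> R"
      using compact_imp_bounded[OF cK] unfolding bounded_iff by blast
    then have "K \<subseteq> cball 0 R" by auto
    then show ?thesis using borel_compact[OF cK] by blast
  qed
  have lm: "f \<in> borel_measurable borel \<Longrightarrow> f \<in> borel_measurable lebesgue" for f :: "'a \<Rightarrow> 'b::topological_space"
    by (auto intro: measurable_completion)
  have leb: "set_integrable lebesgue K f"
    if "compact K" "\<And>R. set_integrable lborel (cball 0 R) f" for K and f :: "'a \<Rightarrow> 'b::{banach, second_countable_topology}"
  proof -
    obtain R where R: "K \<subseteq> cball 0 R" "K \<in> sets borel" using K[OF \<open>compact K\<close>] by blast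
    then have "set_integrable lborel K f" using set_integrable_subset[OF that(2)[of R], of K] by simp
    then show ?thesis unfolding set_integrable_def
      by (subst integrable_completion) (auto simp: integrable_iff_bounded)
  qed
  have G: "set_integrable lborel (cball 0 R) G" for R
  proof -
    have "integrable lborel (\<lambda>x. indicator (cball 0 R) x * (1 + (norm (G x))\<^sup>2))"
      using integrable_real_mult_indicator[OF _ sobolev_gradient_square_integrable[OF uG], of "cball 0 R"]
        emeasure_lborel_cball_finite[of "0::'a" R]
      unfolding distrib_left by (intro Bochner_Integration.integrable_add) (simp_all add: mult.commute)
    then show ?thesis unfolding set_integrable_def
    proof (rule Bochner_Integration.integrable_bound)
      have "norm y \<le> 1 + (norm y)\<^sup>2" for y :: 'a
        using sum_squares_bound[of "norm y" 1] norm_ge_zero[of y] unfolding power_one by linarith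
      then show "AE x in lborel. norm (indicat_real (cball 0 R) x *\<^sub>R G x) \<le> norm (indicat_real (cball 0 R) x * (1 + (norm (G x))\<^sup>2))"
        by (auto simp: indicator_def)
    qed (use m in \<open>auto intro!: borel_measurable_scaleR borel_measurable_indicator\<close>)
  qed
  have weak: "has_weak_gradient u G" unfolding has_weak_gradient_def
  proof (intro conjI allI impI ballI)
    fix \<phi> :: "'a \<Rightarrow> real" and b :: 'a assume \<phi>: "test_function \<phi>" and b: "b \<in> Basis"
    have "(LINT x|lebesgue. u x * partial_derivative b \<phi> x) = (LINT x|lborel. u x * partial_derivative b \<phi> x)"
      by (rule integral_completion) (use m test_function_measurable[OF \<phi>] b in auto)
    also have "\<dots> = - (LINT x|lborel. (G x \<bullet> b) * \<phi> x)"
      using uG \<phi> b unfolding sobolev_pair_def by blast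
    also have "(LINT x|lborel. (G x \<bullet> b) * \<phi> x) = (LINT x|lebesgue. (G x \<bullet> b) * \<phi> x)"
      by (rule integral_completion[symmetric]) (use m test_function_measurable[OF \<phi>] b in auto)
    finally show "(LINT x|lebesgue. u x * partial_derivative b \<phi> x) = - (LINT x|lebesgue. (G x \<bullet> b) * \<phi> x)" .
  qed (use m G leb lm in auto)
  have "locally_L2 u" unfolding locally_L2_def
    using uG m(1) leb lm unfolding sobolev_pair_def by blast
  moreover have "integrable lebesgue (\<lambda>x. (norm (G x))\<^sup>2)"
    by (subst integrable_completion) (use sobolev_gradient_square_integrable[OF uG] m in auto)
  ultimately show "u \<in> W12" using weak unfolding W12_def by blast
  have "has_weak_gradient u (weak_gradient u)"
    unfolding weak_gradient_def by (rule someI[where P="has_weak_gradient u", OF weak])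
  then show "AE x in lborel. weak_gradient u x = G x"
    by (rule weak_gradient_unique[OF _ weak])
qed

section \<open>Square integrable functions\<close>

lemma L2sq_integrable:
  assumes [measurable]: "f \<in> borel_measurable borel" and "L2sq f < \<infinity>"
  shows "integrable lborel (\<lambda>x. (norm (f x))\<^sup>2)" "L2sq f = ennreal (LINT x|lborel. (norm (f x))\<^sup>2)"
proof -
  show *: "integrable lborel (\<lambda>x. (norm (f x))\<^sup>2)"
    using assms(2) by (simp add: L2sq_def integrable_iff_bounded)
  show "L2sq f = ennreal (LINT x|lborel. (norm (f x))\<^sup>2)"
    unfolding L2sq_def by (rule nn_integral_eq_integral[OF *]) simp
qed

lemma L2sq_mono: "(\<And>x. norm (f x) \<le> norm (g x)) \<Longrightarrow> L2sq f \<le> L2sq g"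
  unfolding L2sq_def by (intro nn_integral_mono ennreal_leI power_mono) auto

lemma L2sq_diff_le:
  assumes [measurable]: "f \<in> borel_measurable borel" "g \<in> borel_measurable borel"
  shows "L2sq (\<lambda>x. f x - g x) \<le> 2 * L2sq f + 2 * L2sq g"
proof -
  have "(norm (a - b))\<^sup>2 \<le> 2 * (norm a)\<^sup>2 + 2 * (norm b)\<^sup>2" for a b :: 'b
  proof -
    have "(norm (a - b))\<^sup>2 \<le> (norm a + norm b)\<^sup>2" by (intro power_mono norm_triangle_ineq4) simp
    also have "\<dots> \<le> 2 * (norm a)\<^sup>2 + 2 * (norm b)\<^sup>2"
      using sum_squares_bound[of "norm a" "norm b"] by (simp add: power2_sum)
    finally show ?thesis .
  qed
  from ennreal_leI[OF this]
  have "ennreal ((norm (f x - g x))\<^sup>2) \<le> 2 * ennreal ((norm (f x))\<^sup>2) + 2 * ennreal ((norm (g x))\<^sup>2)" for x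
    by (simp add: ennreal_plus ennreal_mult)
  then have "L2sq (\<lambda>x. f x - g x) \<le> (\<integral>\<^sup>+x. 2 * ennreal ((norm (f x))\<^sup>2) + 2 * ennreal ((norm (g x))\<^sup>2) \<partial>lborel)"
    unfolding L2sq_def by (intro nn_integral_mono)
  also have "\<dots> = 2 * L2sq f + 2 * L2sq g"
    unfolding L2sq_def by (subst nn_integral_add) (auto simp: nn_integral_cmult)
  finally show ?thesis .
qed

lemma L2sq_parallelogram:
  fixes f g :: "'a::euclidean_space \<Rightarrow> 'b::euclidean_space"
  assumes [measurable]: "f \<in> borel_measurable borel" "g \<in> borel_measurable borel"
  shows "L2sq (\<lambda>x. f x - g x) + 4 * L2sq (\<lambda>x. (1/2) *\<^sub>R f x + (1/2) *\<^sub>R g x) = 2 * L2sq f + 2 * L2sq g"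
proof -
  have p: "(norm (a - b))\<^sup>2 + 4 * (norm ((1/2) *\<^sub>R a + (1/2) *\<^sub>R b))\<^sup>2 = 2 * (norm a)\<^sup>2 + 2 * (norm b)\<^sup>2" for a b :: 'b
    unfolding power2_norm_eq_inner by (simp add: inner_simps inner_commute algebra_simps)
  have "ennreal ((norm (f x - g x))\<^sup>2) + 4 * ennreal ((norm ((1/2) *\<^sub>R f x + (1/2) *\<^sub>R g x))\<^sup>2)
    = 2 * ennreal ((norm (f x))\<^sup>2) + 2 * ennreal ((norm (g x))\<^sup>2)" for x
    using arg_cong[OF p[of "f x" "g x"], of ennreal] by (simp add: ennreal_plus ennreal_mult del: scaleR_half_double)
  then have "(\<integral>\<^sup>+x. ennreal ((norm (f x - g x))\<^sup>2) + 4 * ennreal ((norm ((1/2) *\<^sub>R f x + (1/2) *\<^sub>R g x))\<^sup>2) \<partial>lborel)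
    = (\<integral>\<^sup>+x. 2 * ennreal ((norm (f x))\<^sup>2) + 2 * ennreal ((norm (g x))\<^sup>2) \<partial>lborel)"
    by (intro nn_integral_cong)
  moreover have "(\<integral>\<^sup>+x. ennreal ((norm (f x - g x))\<^sup>2) + 4 * ennreal ((norm ((1/2) *\<^sub>R f x + (1/2) *\<^sub>R g x))\<^sup>2) \<partial>lborel)
     = L2sq (\<lambda>x. f x - g x) + 4 * L2sq (\<lambda>x. (1/2) *\<^sub>R f x + (1/2) *\<^sub>R g x)"
    unfolding L2sq_def by (subst nn_integral_add) (auto simp: nn_integral_cmult)
  moreover have "(\<integral>\<^sup>+x. 2 * ennreal ((norm (f x))\<^sup>2) + 2 * ennreal ((norm (g x))\<^sup>2) \<partial>lborel) = 2 * L2sq f + 2 * L2sq g"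
    unfolding L2sq_def by (subst nn_integral_add) (auto simp: nn_integral_cmult)
  ultimately show ?thesis by simp
qed

text \<open>The argument behind the completeness of \<open>L\<^sup>2\<close>. Along a subsequence the squared distances of
  successive terms are at most \<open>8\<^sup>-\<^sup>k\<close>, so that the sum of \<open>2\<^sup>k\<close> times the squared increments is finite almost
  everywhere; this sum controls the sum of the increments.\<close>

lemma L2_Cauchy_AE_convergent_subseq:
  fixes f :: "nat \<Rightarrow> 'a::euclidean_space \<Rightarrow> 'b::euclidean_space"
  assumes m [measurable]: "\<And>k. f k \<in> borel_measurable borel"
    and Cauchy: "\<And>e. e > 0 \<Longrightarrow> \<exists>N. \<forall>m\<ge>N. \<forall>n\<ge>N. L2sq (\<lambda>x. f m x - f n x) \<le> ennreal e"
  shows "\<exists>r. strict_mono r \<and> (AE x in lborel. convergent (\<lambda>k. f (r k) x))"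
proof -
  have "\<forall>k. \<exists>N. \<forall>m\<ge>N. \<forall>n\<ge>N. L2sq (\<lambda>x. f m x - f n x) \<le> ennreal ((1/8) ^ k)"
    by (intro allI Cauchy) simp
  then obtain N where N: "\<And>k m n. m \<ge> N k \<Longrightarrow> n \<ge> N k \<Longrightarrow> L2sq (\<lambda>x. f m x - f n x) \<le> ennreal ((1/8) ^ k)"
    by metis
  define r where "r k = (\<Sum>j\<le>k. N j) + k" for k
  have r: "strict_mono r" by (rule strict_monoI_Suc) (simp add: r_def)
  have rN: "N k \<le> r k" "N k \<le> r (Suc k)" for k
    using member_le_sum[of k "{..k}" N] by (auto simp: r_def)
  let ?d = "\<lambda>k x. f (r (Suc k)) x - f (r k) x"
  have "(\<integral>\<^sup>+x. (\<Sum>k. ennreal (2 ^ k * (norm (?d k x))\<^sup>2)) \<partial>lborel) = (\<Sum>k. ennreal (2 ^ k) * L2sq (?d k))"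
    unfolding L2sq_def by (subst nn_integral_suminf) (auto simp: ennreal_mult nn_integral_cmult)
  also have "\<dots> \<le> (\<Sum>k. ennreal ((1/4) ^ k))"
  proof (rule suminf_le)
    fix k
    have "ennreal (2 ^ k) * L2sq (?d k) \<le> ennreal (2 ^ k) * ennreal ((1/8) ^ k)"
      by (intro mult_left_mono N rN) simp
    also have "\<dots> = ennreal ((1/4) ^ k)"
      by (simp add: ennreal_mult[symmetric] power_mult_distrib[symmetric])
    finally show "ennreal (2 ^ k) * L2sq (?d k) \<le> ennreal ((1/4) ^ k)" .
  qed auto
  also have "\<dots> = ennreal (\<Sum>k. (1/4) ^ k)"
    by (rule suminf_ennreal2) (auto intro: summable_geometric)
  finally have "(\<integral>\<^sup>+x. (\<Sum>k. ennreal (2 ^ k * (norm (?d k x))\<^sup>2)) \<partial>lborel) < \<infinity>"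
    by (rule le_less_trans) simp
  then have "AE x in lborel. (\<Sum>k. ennreal (2 ^ k * (norm (?d k x))\<^sup>2)) \<noteq> \<infinity>"
    by (intro nn_integral_PInf_AE) auto
  then have "AE x in lborel. convergent (\<lambda>k. f (r k) x)"
  proof eventually_elim
    case (elim x)
    have s: "summable (\<lambda>k. 2 ^ k * (norm (?d k x))\<^sup>2)"
      by (rule summable_suminf_not_top) (use elim in auto)
    have "summable (\<lambda>k. (1/2) ^ k + 2 ^ k * (norm (?d k x))\<^sup>2)"
      by (intro summable_add s summable_geometric) simp
    then have "summable (\<lambda>k. ?d k x)"
    proof (rule summable_comparison_test[rotated], intro exI allI impI)
      fix k
      have "norm (?d k x) \<le> (1/2) ^ k + 2 ^ k * (norm (?d k x))\<^sup>2"
      proof -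
        \<comment> \<open>Splitting \<open>1 = (1 / c) c\<close> with \<open>c\<^sup>2 = 2\<^sup>k\<close> distributes the weights in the inequality between the arithmetic and the geometric mean.\<close>
        define c where "c = sqrt (2 ^ k)"
        have c: "c > 0" "c\<^sup>2 = 2 ^ k" by (auto simp: c_def)
        have "2 * (1 / c) * (c * norm (?d k x)) \<le> (1 / c)\<^sup>2 + (c * norm (?d k x))\<^sup>2"
          by (rule sum_squares_bound)
        then have "2 * norm (?d k x) \<le> (1/2) ^ k + 2 ^ k * (norm (?d k x))\<^sup>2"
          using c by (simp add: power_mult_distrib power_divide)
        then show ?thesis using norm_ge_zero[of "?d k x"] by linarith
      qed
      then show "norm (?d k x) \<le> (1/2) ^ k + 2 ^ k * (norm (?d k x))\<^sup>2" .
    qed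
    then have "(\<lambda>n. f (r 0) x + (\<Sum>k<n. ?d k x)) \<longlonglongrightarrow> f (r 0) x + (\<Sum>k. ?d k x)"
      by (intro tendsto_intros summable_LIMSEQ)
    moreover have "f (r 0) x + (\<Sum>k<n. ?d k x) = f (r n) x" for n
      by (simp add: sum_lessThan_telescope[of "\<lambda>k. f (r k) x"])
    ultimately show ?case by (auto simp: convergent_def)
  qed
  with r show ?thesis by blast
qed

lemma L2_Fatou:
  assumes m [measurable]: "\<And>k. f k \<in> borel_measurable borel" 
    and lim: "AE x in lborel. (\<lambda>k. f k x) \<longlonglongrightarrow> g x"
    and bd: "\<And>k. L2sq (f k) \<le> ennreal (a k)" and a: "a \<longlonglongrightarrow> A"
  shows "L2sq g \<le> ennreal A"
proof -
  have "L2sq g = (\<integral>\<^sup>+x. liminf (\<lambda>k. ennreal ((norm (f k x))\<^sup>2)) \<partial>lborel)"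
    unfolding L2sq_def
  proof (rule nn_integral_cong_AE, use lim in eventually_elim)
    case (elim x)
    then have "(\<lambda>k. ennreal ((norm (f k x))\<^sup>2)) \<longlonglongrightarrow> ennreal ((norm (g x))\<^sup>2)"
      by (intro tendsto_ennrealI tendsto_intros)
    then show ?case by (rule lim_imp_Liminf[symmetric, rotated]) simp
  qed
  also have "\<dots> \<le> liminf (\<lambda>k. L2sq (f k))"
    unfolding L2sq_def by (rule nn_integral_liminf) measurable
  also have "\<dots> \<le> liminf (\<lambda>k. ennreal (a k))"
    by (intro Liminf_mono always_eventually allI bd)
  also have "\<dots> = ennreal A"
    by (intro lim_imp_Liminf tendsto_ennrealI a) simp
  finally show ?thesis .
qed

lemma integrable_L2_mult:
  fixes f g :: "'a::euclidean_space \<Rightarrow> real"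
  assumes [measurable]: "f \<in> borel_measurable borel" "g \<in> borel_measurable borel"
    and "L2sq f < \<infinity>" "L2sq g < \<infinity>"
  shows "integrable lborel (\<lambda>x. f x * g x)"
proof -
  have "integrable lborel (\<lambda>x. (f x)\<^sup>2 + (g x)\<^sup>2)"
    using L2sq_integrable(1)[of f] L2sq_integrable(1)[of g] assms by simp
  then show ?thesis
  proof (rule Bochner_Integration.integrable_bound)
    have "\<bar>a * b\<bar> \<le> a\<^sup>2 + b\<^sup>2" for a b :: real
      using sum_squares_bound[of "\<bar>a\<bar>" "\<bar>b\<bar>"] abs_ge_zero[of "a * b"] unfolding abs_mult power2_abs by linarith
    then show "AE x in lborel. norm (f x * g x) \<le> norm ((f x)\<^sup>2 + (g x)\<^sup>2)" by simp
  qed auto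
qed

text \<open>For the differences \<open>h k\<close> to the limit and any \<open>d > 0\<close>, the part of \<open>\<bar>h k g\<bar>\<close> that exceeds
  \<open>d (h k)\<^sup>2\<close> is at most \<open>g\<^sup>2 / d\<close> and tends to \<open>0\<close> almost everywhere. Dominated convergence disposes of this
  part, and the rest is at most \<open>d\<close> times the bound on the norms.\<close>

lemma L2_bounded_AE_weak_convergence:
  fixes f :: "nat \<Rightarrow> 'a::euclidean_space \<Rightarrow> real"
  assumes m [measurable]: "\<And>k. f k \<in> borel_measurable borel" "f0 \<in> borel_measurable borel" "g \<in> borel_measurable borel"
    and lim: "AE x in lborel. (\<lambda>k. f k x) \<longlonglongrightarrow> f0 x"
    and bd: "\<And>k. L2sq (f k) \<le> ennreal A" and g: "L2sq g < \<infinity>"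
  shows "(\<lambda>k. LINT x|lborel. f k x * g x) \<longlonglongrightarrow> (LINT x|lborel. f0 x * g x)"
proof -
  have f0: "L2sq f0 \<le> ennreal A" by (rule L2_Fatou[OF m(1) lim bd tendsto_const])
  define h where "h k x = f k x - f0 x" for k x
  define B where "B = 4 * max A 0"
  have B: "B \<ge> 0" by (simp add: B_def)
  have [measurable]: "h k \<in> borel_measurable borel" for k by (simp add: h_def[abs_def])
  have hB: "L2sq (h k) \<le> ennreal B" for k
  proof -
    have "L2sq (h k) \<le> 2 * L2sq (f k) + 2 * L2sq f0" unfolding h_def by (rule L2sq_diff_le) auto
    also have "\<dots> \<le> 2 * ennreal A + 2 * ennreal A" by (intro add_mono mult_left_mono bd f0) auto
    also have "\<dots> = ennreal B" by (cases "A \<ge> 0") (auto simp: B_def ennreal_mult ennreal_neg max_def simp flip: distrib_right)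
    finally show ?thesis .
  qed
  have fin: "L2sq (h k) < \<infinity>" "L2sq (f k) < \<infinity>" "L2sq f0 < \<infinity>" for k
    using le_less_trans[OF hB[of k] ennreal_less_top] le_less_trans[OF bd[of k] ennreal_less_top]
      le_less_trans[OF f0 ennreal_less_top] by simp_all
  have ih: "integrable lborel (\<lambda>x. (h k x)\<^sup>2)" "(LINT x|lborel. (h k x)\<^sup>2) \<le> B" for k
    using L2sq_integrable[of "h k"] fin hB[of k] B by (auto simp: ennreal_le_iff)
  have ig: "integrable lborel (\<lambda>x. (g x)\<^sup>2)" using L2sq_integrable(1)[of g] g by simp
  have ihg: "integrable lborel (\<lambda>x. h k x * g x)" for k
    by (rule integrable_L2_mult) (use fin g in auto)
  have "(\<lambda>k. LINT x|lborel. h k x * g x) \<longlonglongrightarrow> 0"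
  proof (rule LIMSEQ_I)
    fix e :: real assume e: "e > 0"
    \<comment> \<open>The part below \<open>d (h k)\<^sup>2\<close> then contributes at most \<open>e / 2\<close>.\<close>
    define d where "d = e / (2 * (B + 1))"
    have d: "d > 0" using e B by (simp add: d_def)
    define p where "p k x = max 0 (\<bar>h k x * g x\<bar> - d * (h k x)\<^sup>2)" for k x
    have [measurable]: "p k \<in> borel_measurable borel" for k unfolding p_def[abs_def] by measurable
    have pg: "p k x \<le> (g x)\<^sup>2 / d" for k x
    proof -
      have "2 * (d * \<bar>h k x\<bar>) * \<bar>g x\<bar> \<le> (d * \<bar>h k x\<bar>)\<^sup>2 + \<bar>g x\<bar>\<^sup>2" by (rule sum_squares_bound)
      then have "d * (2 * \<bar>h k x * g x\<bar>) \<le> d * (d * (h k x)\<^sup>2 + (g x)\<^sup>2 / d)"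
        using d by (simp add: abs_mult distrib_left power2_eq_square mult_ac)
      then have "2 * \<bar>h k x * g x\<bar> \<le> d * (h k x)\<^sup>2 + (g x)\<^sup>2 / d" using d by simp
      then show ?thesis using d abs_ge_zero[of "h k x * g x"] by (auto simp: p_def)
    qed
    have "(\<lambda>k. LINT x|lborel. p k x) \<longlonglongrightarrow> (LINT x|(lborel :: 'a measure). (0::real))"
    proof (rule integral_dominated_convergence)
      show "integrable lborel (\<lambda>x. (g x)\<^sup>2 / d)" using ig by simp
      show "AE x in lborel. (\<lambda>k. p k x) \<longlonglongrightarrow> 0" using lim
      proof eventually_elim
        case (elim x)
        then have "(\<lambda>k. h k x) \<longlonglongrightarrow> 0" unfolding h_def by (rule LIM_zero)
        then have "(\<lambda>k. p k x) \<longlonglongrightarrow> max 0 (\<bar>0 * g x\<bar> - d * 0\<^sup>2)"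
          unfolding p_def by (intro tendsto_intros)
        then show ?case by simp
      qed
      show "AE x in lborel. norm (p k x) \<le> (g x)\<^sup>2 / d" for k
        using pg by (intro AE_I2) (auto simp: p_def)
    qed auto
    then obtain K where K: "\<And>k. k \<ge> K \<Longrightarrow> norm (LINT x|lborel. p k x) < e / 2"
      using e LIMSEQ_D[of "\<lambda>k. LINT x|lborel. p k x" 0 "e/2"] by auto
    have "norm ((LINT x|lborel. h k x * g x) - 0) < e" if "k \<ge> K" for k
    proof -
      have ip: "integrable lborel (p k)"
        by (rule Bochner_Integration.integrable_bound[of _ "\<lambda>x. (g x)\<^sup>2 / d"])
           (use ig pg d in \<open>auto simp: p_def intro!: AE_I2\<close>)
      have "norm (LINT x|lborel. h k x * g x) \<le> (LINT x|lborel. \<bar>h k x * g x\<bar>)"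
        using integral_norm_bound[of lborel "\<lambda>x. h k x * g x"] by simp
      also have "\<dots> \<le> (LINT x|lborel. d * (h k x)\<^sup>2 + p k x)"
        by (rule integral_mono) (use ihg ih ip in \<open>auto simp: p_def\<close>)
      also have "\<dots> = d * (LINT x|lborel. (h k x)\<^sup>2) + (LINT x|lborel. p k x)"
        using ih ip by simp
      also have "\<dots> < d * B + e / 2"
        using K[OF that] ih(2)[of k] d by (intro add_le_less_mono mult_left_mono) auto
      also have "d * B \<le> e / 2" using e B by (simp add: d_def field_simps)
      finally show ?thesis by simp
    qed
    then show "\<exists>K. \<forall>k\<ge>K. norm ((LINT x|lborel. h k x * g x) - 0) < e" by blast
  qed
  then have "(\<lambda>k. (LINT x|lborel. h k x * g x) + (LINT x|lborel. f0 x * g x)) \<longlonglongrightarrow> 0 + (LINT x|lborel. f0 x * g x)"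
    by (intro tendsto_intros)
  moreover have "(LINT x|lborel. h k x * g x) + (LINT x|lborel. f0 x * g x) = (LINT x|lborel. f k x * g x)" for k
  proof -
    have "integrable lborel (\<lambda>x. f k x * g x)" "integrable lborel (\<lambda>x. f0 x * g x)"
      using fin g by (auto intro!: integrable_L2_mult)
    then show ?thesis by (simp add: h_def left_diff_distrib)
  qed
  ultimately show ?thesis by simp
qed

section \<open>Lower semicontinuity of the Dirichlet integral\<close>

lemma L2sq_continuous_support:
  fixes \<psi> :: "'a::euclidean_space \<Rightarrow> real"
  assumes "continuous_on UNIV \<psi>" "\<And>x. norm x > R \<Longrightarrow> \<psi> x = 0"
  shows "L2sq \<psi> < \<infinity>"
proof -
  obtain C where C: "C \<ge> 0" "\<And>x. \<bar>\<psi> x\<bar> \<le> C"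
    by (rule continuous_support_bounded[OF assms], assumption, rule that)
  have "L2sq \<psi> \<le> (\<integral>\<^sup>+x. ennreal (C\<^sup>2) * indicator (cball (0::'a) R) x \<partial>lborel)"
    unfolding L2sq_def
  proof (rule nn_integral_mono)
    fix x :: 'a
    have "(\<psi> x)\<^sup>2 \<le> C\<^sup>2" using C(2)[of x] C(1) by (simp add: abs_le_square_iff[symmetric])
    then show "ennreal ((norm (\<psi> x))\<^sup>2) \<le> ennreal (C\<^sup>2) * indicator (cball 0 R) x"
      using assms(2)[of x] by (auto simp: indicator_def ennreal_leI)
  qed
  also have "\<dots> = ennreal (C\<^sup>2) * emeasure lborel (cball (0::'a) R)"
    by (rule nn_integral_cmult_indicator) simp
  also have "\<dots> < \<infinity>"
    using emeasure_lborel_cball_finite[of "0::'a" R] by (simp add: ennreal_mult_less_top)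
  finally show ?thesis .
qed

lemma sobolev_pair_scaleR_add:
  assumes uG: "sobolev_pair u G" and wH: "sobolev_pair w H"
  shows "sobolev_pair (\<lambda>x. a * u x + b * w x) (\<lambda>x. a *\<^sub>R G x + b *\<^sub>R H x)"
  unfolding sobolev_pair_def
proof (intro conjI allI impI)
  note [measurable] = sobolev_measurable[OF uG] sobolev_measurable[OF wH]
  show "(\<lambda>x. a * u x + b * w x) \<in> borel_measurable borel" "(\<lambda>x. a *\<^sub>R G x + b *\<^sub>R H x) \<in> borel_measurable borel"
    by measurable
  fix R
  have [measurable]: "cball (0::'a) R \<in> sets borel" by simp
  have "integrable lborel (\<lambda>x. indicator (cball 0 R) x * (2 * a\<^sup>2 * (u x)\<^sup>2 + 2 * b\<^sup>2 * (w x)\<^sup>2))"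
  proof -
    have "integrable lborel (\<lambda>x. 2 * a\<^sup>2 * (indicator (cball 0 R) x * (u x)\<^sup>2) + 2 * b\<^sup>2 * (indicator (cball 0 R) x * (w x)\<^sup>2))"
      using uG wH by (intro Bochner_Integration.integrable_add integrable_mult_right)
        (auto simp: sobolev_pair_def set_integrable_def)
    then show ?thesis by (simp add: algebra_simps)
  qed
  then show "set_integrable lborel (cball 0 R) (\<lambda>x. (a * u x + b * w x)\<^sup>2)"
    unfolding set_integrable_def
  proof (rule Bochner_Integration.integrable_bound)
    have "(a * p + b * q)\<^sup>2 \<le> 2 * a\<^sup>2 * p\<^sup>2 + 2 * b\<^sup>2 * q\<^sup>2" for p q
      using sum_squares_bound[of "a * p" "b * q"] by (simp add: power2_sum power_mult_distrib)
    then show "AE x in lborel. norm (indicat_real (cball 0 R) x *\<^sub>R (a * u x + b * w x)\<^sup>2)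
        \<le> norm (indicat_real (cball 0 R) x * (2 * a\<^sup>2 * (u x)\<^sup>2 + 2 * b\<^sup>2 * (w x)\<^sup>2))"
      by (auto simp: indicator_def)
  qed measurable
next
  note [measurable] = sobolev_measurable[OF uG] sobolev_measurable[OF wH]
  have s: "L2sq (\<lambda>x. c *\<^sub>R K x) = ennreal (c\<^sup>2) * L2sq K"
    if [measurable]: "K \<in> borel_measurable borel" for c and K :: "'a \<Rightarrow> 'a"
    unfolding L2sq_def by (subst nn_integral_cmult[symmetric]) (auto simp: power_mult_distrib ennreal_mult)
  have "L2sq (\<lambda>x. a *\<^sub>R G x - (- b) *\<^sub>R H x) \<le> 2 * L2sq (\<lambda>x. a *\<^sub>R G x) + 2 * L2sq (\<lambda>x. (- b) *\<^sub>R H x)"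
    by (rule L2sq_diff_le) measurable
  also have "\<dots> = 2 * (ennreal (a\<^sup>2) * L2sq G) + 2 * (ennreal ((- b)\<^sup>2) * L2sq H)"
    by (subst (1 2) s) auto
  also have "\<dots> < \<infinity>"
    using sobolev_gradient_finite[OF uG] sobolev_gradient_finite[OF wH]
    by (simp add: ennreal_mult_less_top)
  finally show "L2sq (\<lambda>x. a *\<^sub>R G x + b *\<^sub>R H x) < \<infinity>" by simp
next
  fix \<phi> :: "'a \<Rightarrow> real" and e :: 'a assume \<phi>: "test_function \<phi>" and e: "e \<in> Basis"
  obtain R where "R > 0" and R: "\<And>x. norm x > R \<Longrightarrow> \<phi> x = 0"
      "\<And>x b. norm x > R \<Longrightarrow> partial_derivative b \<phi> x = 0"
    by (rule test_function_support[OF \<phi>], rule that)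
  have i: "integrable lborel (\<lambda>x. v x * partial_derivative e \<phi> x)" "integrable lborel (\<lambda>x. (K x \<bullet> e) * \<phi> x)"
    "(LINT x|lborel. v x * partial_derivative e \<phi> x) = - (LINT x|lborel. (K x \<bullet> e) * \<phi> x)"
    if vK: "sobolev_pair v K" for v K
  proof -
    show "integrable lborel (\<lambda>x. v x * partial_derivative e \<phi> x)"
      by (rule loc_integrable_mult[OF sobolev_loc_integrable[OF vK] test_function_partial_continuous[OF \<phi> e] R(2)])
    show "integrable lborel (\<lambda>x. (K x \<bullet> e) * \<phi> x)"
      by (rule loc_integrable_mult[OF sobolev_gradient_loc_integrable[OF vK] test_function_continuous[OF \<phi>] R(1)])
    show "(LINT x|lborel. v x * partial_derivative e \<phi> x) = - (LINT x|lborel. (K x \<bullet> e) * \<phi> x)"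
      using vK \<phi> e unfolding sobolev_pair_def by blast
  qed
  have "(LINT x|lborel. (a * u x + b * w x) * partial_derivative e \<phi> x)
    = a * (LINT x|lborel. u x * partial_derivative e \<phi> x) + b * (LINT x|lborel. w x * partial_derivative e \<phi> x)"
    using i(1)[OF uG] i(1)[OF wH] by (simp add: distrib_right mult.assoc)
  also have "\<dots> = - (a * (LINT x|lborel. (G x \<bullet> e) * \<phi> x) + b * (LINT x|lborel. (H x \<bullet> e) * \<phi> x))"
    by (simp add: i(3)[OF uG] i(3)[OF wH])
  also have "a * (LINT x|lborel. (G x \<bullet> e) * \<phi> x) + b * (LINT x|lborel. (H x \<bullet> e) * \<phi> x)
    = (LINT x|lborel. ((a *\<^sub>R G x + b *\<^sub>R H x) \<bullet> e) * \<phi> x)"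
    using i(2)[OF uG] i(2)[OF wH] by (simp add: inner_add_left distrib_right mult.assoc)
  finally show "(LINT x|lborel. (a * u x + b * w x) * partial_derivative e \<phi> x)
    = - (LINT x|lborel. ((a *\<^sub>R G x + b *\<^sub>R H x) \<bullet> e) * \<phi> x)" .
qed

text \<open>Both sides of the defining identity of the weak gradient pass to the limit, by weak convergence of
  the functions and of the gradients.\<close>

lemma sobolev_pair_limit:
  fixes w :: "nat \<Rightarrow> 'a::euclidean_space \<Rightarrow> real"
  assumes wH: "\<And>k. sobolev_pair (w k) (H k)"
    and v: "v \<in> borel_measurable borel" "AE x in lborel. (\<lambda>k. w k x) \<longlonglongrightarrow> v x" "\<And>k. L2sq (w k) \<le> ennreal A"
    and K: "K \<in> borel_measurable borel" "AE x in lborel. (\<lambda>k. H k x) \<longlonglongrightarrow> K x"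
    and d: "\<And>k. L2sq (H k) \<le> ennreal (d k)" "d \<longlonglongrightarrow> D"
  shows "sobolev_pair v K" "L2sq K \<le> ennreal D"
proof -
  note [measurable] = sobolev_measurable[OF wH] v(1) K(1)
  show KD: "L2sq K \<le> ennreal D"
    by (rule L2_Fatou[OF _ K(2) d]) measurable
  have "Bseq d" using d(2) by (rule convergentI[THEN convergent_imp_Bseq])
  then obtain D' where "\<And>k. d k \<le> D'" unfolding Bseq_def by (metis abs_le_iff real_norm_def)
  then have HD: "L2sq (H k) \<le> ennreal D'" for k using d(1) ennreal_leI order_trans by blast
  have vA: "L2sq v \<le> ennreal A"
    by (rule L2_Fatou[OF _ v(2) v(3) tendsto_const]) measurable
  show "sobolev_pair v K" unfolding sobolev_pair_def
  proof (intro conjI allI impI)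
    fix R
    have "integrable lborel (\<lambda>x. (v x)\<^sup>2)"
      using L2sq_integrable(1)[OF v(1)] le_less_trans[OF vA ennreal_less_top] by simp
    then show "set_integrable lborel (cball 0 R) (\<lambda>x. (v x)\<^sup>2)"
      unfolding set_integrable_def by (intro integrable_mult_indicator) auto
    show "L2sq K < \<infinity>" using le_less_trans[OF KD ennreal_less_top] by simp
    fix \<phi> :: "'a \<Rightarrow> real" and b :: 'a assume \<phi>: "test_function \<phi>" and b: "b \<in> Basis"
    obtain R where "R > 0" and R: "\<And>x. norm x > R \<Longrightarrow> \<phi> x = 0"
        "\<And>x b. norm x > R \<Longrightarrow> partial_derivative b \<phi> x = 0"
      by (rule test_function_support[OF \<phi>], rule that)
    note [measurable] = test_function_measurable(1)[OF \<phi>] test_function_measurable(2)[OF \<phi> b]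
    have 1: "(\<lambda>k. LINT x|lborel. w k x * partial_derivative b \<phi> x) \<longlonglongrightarrow> (LINT x|lborel. v x * partial_derivative b \<phi> x)"
      by (rule L2_bounded_AE_weak_convergence[OF _ _ _ v(2) v(3)
            L2sq_continuous_support[OF test_function_partial_continuous[OF \<phi> b] R(2)]]) measurable
    have 2: "(\<lambda>k. LINT x|lborel. (H k x \<bullet> b) * \<phi> x) \<longlonglongrightarrow> (LINT x|lborel. (K x \<bullet> b) * \<phi> x)"
    proof (rule L2_bounded_AE_weak_convergence[OF _ _ _ _ _ L2sq_continuous_support[OF test_function_continuous[OF \<phi>] R(1)]])
      show "AE x in lborel. (\<lambda>k. H k x \<bullet> b) \<longlonglongrightarrow> K x \<bullet> b"
        using K(2) by eventually_elim (intro tendsto_intros)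
      show "L2sq (\<lambda>x. H k x \<bullet> b) \<le> ennreal D'" for k
        by (rule order_trans[OF L2sq_mono HD]) (use Basis_le_norm[OF b] in auto)
    qed measurable
    have "(LINT x|lborel. w k x * partial_derivative b \<phi> x) = - (LINT x|lborel. (H k x \<bullet> b) * \<phi> x)" for k
      using wH[of k] \<phi> b unfolding sobolev_pair_def by blast
    with 1 have "(\<lambda>k. - (LINT x|lborel. (H k x \<bullet> b) * \<phi> x)) \<longlonglongrightarrow> (LINT x|lborel. v x * partial_derivative b \<phi> x)"
      by simp
    moreover have "(\<lambda>k. - (LINT x|lborel. (H k x \<bullet> b) * \<phi> x)) \<longlonglongrightarrow> - (LINT x|lborel. (K x \<bullet> b) * \<phi> x)"
      by (intro tendsto_intros 2)
    ultimately show "(LINT x|lborel. v x * partial_derivative b \<phi> x) = - (LINT x|lborel. (K x \<bullet> b) * \<phi> x)"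
      by (rule LIMSEQ_unique)
  qed (use v(1) K(1) in auto)
qed

text \<open>Mazur's idea in elementary form. Instead of convex combinations of the tail of the sequence,
  consider the set \<open>S m\<close> of all Sobolev functions that are almost everywhere at most as far from \<open>v\<close> as the
  worst \<open>u k\<close> with \<open>k \<ge> m\<close>. It contains midpoints, so that by the parallelogram law
  almost minimizers of the Dirichlet integral on \<open>S m\<close> have gradients that form a Cauchy sequence; the
  infimum over \<open>S m\<close> is at most \<open>D\<close>.\<close>

lemma sobolev_lower_semicontinuous:
  fixes u :: "nat \<Rightarrow> 'a::euclidean_space \<Rightarrow> real"
  assumes uG: "\<And>k. sobolev_pair (u k) (G k)"
    and v: "v \<in> borel_measurable borel" "AE x in lborel. (\<lambda>k. u k x) \<longlonglongrightarrow> v x"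
    and A: "\<And>k. L2sq (u k) \<le> ennreal A"
    and d: "\<And>k. L2sq (G k) \<le> ennreal (d k)" "d \<longlonglongrightarrow> D"
  shows "\<exists>H. sobolev_pair v H \<and> L2sq H \<le> ennreal D"
proof -
  define S where "S m = {(w, H). sobolev_pair w H \<and> L2sq w \<le> ennreal A \<and>
      (AE x in lborel. \<forall>c. (\<forall>k\<ge>m. \<bar>u k x - v x\<bar> \<le> c) \<longrightarrow> \<bar>w x - v x\<bar> \<le> c)}" for m
  define e where "e m = (INF p\<in>S m. L2sq (snd p))" for m
  have uS: "(u k, G k) \<in> S m" if "k \<ge> m" for k m
    using uG A that by (auto simp: S_def)
  have e_le: "e m \<le> L2sq H" if "(w, H) \<in> S m" for w H m
    unfolding e_def using that by (intro INF_lower2[of "(w, H)"]) auto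
  have S_anti: "S l \<subseteq> S m" if "m \<le> l" for m l
  proof -
    have "(\<forall>k\<ge>l. \<bar>u k x - v x\<bar> \<le> c)" if "\<forall>k\<ge>m. \<bar>u k x - v x\<bar> \<le> c" for x c
      using that \<open>m \<le> l\<close> by auto
    then show ?thesis unfolding S_def by (auto elim!: eventually_mono)
  qed
  have e_mono: "e m \<le> e l" if "m \<le> l" for m l
    unfolding e_def by (rule INF_superset_mono[OF S_anti[OF that]]) simp
  have eD: "e m \<le> ennreal D" for m
  proof (rule LIMSEQ_le_const[OF tendsto_ennrealI[OF d(2)]])
    show "\<exists>N. \<forall>n\<ge>N. e m \<le> ennreal (d n)"
      using e_le[OF uS] d(1) order_trans by blast
  qed
  define E where "E m = enn2real (e m)" for m
  have eE: "e m = ennreal (E m)" for m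
    using le_less_trans[OF eD ennreal_less_top, of m] by (simp add: E_def)
  have E0: "E m \<ge> 0" for m by (simp add: E_def)
  have ED: "E m \<le> max D 0" for m
    using eD[of m] E0[of m] unfolding eE by (cases "D \<ge> 0") (auto simp: ennreal_neg)
  have two: "2 * ennreal a + 2 * ennreal b = ennreal (2 * a + 2 * b)" if "a \<ge> 0" "b \<ge> 0" for a b
    using that by (simp add: ennreal_plus ennreal_mult)
  have E_mono: "E m \<le> E l" if "m \<le> l" for m l
    using e_mono[OF that] E0[of l] by (simp add: eE ennreal_le_iff)
  have "\<exists>p\<in>S m. L2sq (snd p) < e m + ennreal (1 / real (Suc m))" for m
  proof -
    have "e m < e m + ennreal (1 / real (Suc m))"
      using E0[of m] by (simp add: eE ennreal_plus[symmetric] ennreal_less_iff del: ennreal_plus)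
    then show ?thesis unfolding e_def INF_less_iff .
  qed
  then obtain p where p: "\<And>m. p m \<in> S m" "\<And>m. L2sq (snd (p m)) < e m + ennreal (1 / real (Suc m))"
    by metis
  define w where "w m = fst (p m)" for m
  define H where "H m = snd (p m)" for m
  have wS: "(w m, H m) \<in> S m" for m using p(1)[of m] by (simp add: w_def H_def)
  have wH: "sobolev_pair (w m) (H m)" and wA: "L2sq (w m) \<le> ennreal A"
    and wc: "AE x in lborel. \<forall>c. (\<forall>k\<ge>m. \<bar>u k x - v x\<bar> \<le> c) \<longrightarrow> \<bar>w m x - v x\<bar> \<le> c" for m
    using wS[of m] by (auto simp: S_def)
  note [measurable] = sobolev_measurable[OF wH]
  have HE: "L2sq (H m) \<le> ennreal (E m + 1 / real (Suc m))" for m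
    using p(2)[of m] E0[of m] by (simp add: H_def eE ennreal_plus)
  have wlim: "AE x in lborel. (\<lambda>m. w m x) \<longlonglongrightarrow> v x"
  proof -
    have "AE x in lborel. \<forall>m. \<forall>c. (\<forall>k\<ge>m. \<bar>u k x - v x\<bar> \<le> c) \<longrightarrow> \<bar>w m x - v x\<bar> \<le> c"
      using wc by (simp add: AE_all_countable)
    with v(2) show ?thesis
    proof eventually_elim
      case (elim x)
      show ?case
      proof (rule LIMSEQ_I)
        fix r :: real assume "r > 0"
        then obtain N where N: "\<And>k. k \<ge> N \<Longrightarrow> \<bar>u k x - v x\<bar> < r / 2"
          using LIMSEQ_D[OF elim(1), of "r/2"] by auto
        have "\<bar>w m x - v x\<bar> \<le> r / 2" if "m \<ge> N" for m
          using elim(2) N that by (meson less_imp_le order_trans)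
        then show "\<exists>N. \<forall>m\<ge>N. norm (w m x - v x) < r"
          using \<open>r > 0\<close> by (intro exI[of _ N]) force
      qed
    qed
  qed
  \<comment> \<open>The midpoint of two almost minimizers is a competitor on \<open>S m\<close>.\<close>
  have mid: "L2sq (\<lambda>x. H m x - H l x) \<le> ennreal (2 * (E l - E m) + 4 / real (Suc m))" if ml: "m \<le> l" for m l
  proof -
    have l: "(w l, H l) \<in> S m" using wS S_anti[OF ml] by blast
    have "((\<lambda>x. (1/2) * w m x + (1/2) * w l x), (\<lambda>x. (1/2) *\<^sub>R H m x + (1/2) *\<^sub>R H l x)) \<in> S m"
    proof -
      have "L2sq (\<lambda>x. (1/2) *\<^sub>R w m x + (1/2) *\<^sub>R w l x) \<le> ennreal A"
      proof -
        have "4 * L2sq (\<lambda>x. (1/2) *\<^sub>R w m x + (1/2) *\<^sub>R w l x)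
          \<le> L2sq (\<lambda>x. w m x - w l x) + 4 * L2sq (\<lambda>x. (1/2) *\<^sub>R w m x + (1/2) *\<^sub>R w l x)" by simp
        also have "\<dots> = 2 * L2sq (w m) + 2 * L2sq (w l)" by (rule L2sq_parallelogram) measurable
        also have "\<dots> \<le> 2 * ennreal A + 2 * ennreal A" by (intro add_mono mult_left_mono wA) auto
        also have "\<dots> = 4 * ennreal A" by (simp flip: distrib_right)
        finally show ?thesis by (subst (asm) ennreal_mult_le_mult_iff) auto
      qed
      moreover have "AE x in lborel. \<forall>c. (\<forall>k\<ge>m. \<bar>u k x - v x\<bar> \<le> c) \<longrightarrow> \<bar>(1/2) * w m x + (1/2) * w l x - v x\<bar> \<le> c"
      proof -
        have "AE x in lborel. \<forall>c. (\<forall>k\<ge>m. \<bar>u k x - v x\<bar> \<le> c) \<longrightarrow> \<bar>w l x - v x\<bar> \<le> c"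
          using l by (auto simp: S_def)
        with wc[of m] show ?thesis
        proof eventually_elim
          case (elim x)
          show ?case
          proof (intro allI impI)
            fix c assume "\<forall>k\<ge>m. \<bar>u k x - v x\<bar> \<le> c"
            with elim have "\<bar>w m x - v x\<bar> \<le> c" "\<bar>w l x - v x\<bar> \<le> c" by blast+
            then show "\<bar>(1/2) * w m x + (1/2) * w l x - v x\<bar> \<le> c" by linarith
          qed
        qed
      qed
      ultimately show ?thesis
        using sobolev_pair_scaleR_add[OF wH[of m] wH[of l], of "1/2" "1/2"] by (simp add: S_def)
    qed
    then have "e m \<le> L2sq (\<lambda>x. (1/2) *\<^sub>R H m x + (1/2) *\<^sub>R H l x)" by (rule e_le)
    then have "L2sq (\<lambda>x. H m x - H l x) + 4 * e m
      \<le> L2sq (\<lambda>x. H m x - H l x) + 4 * L2sq (\<lambda>x. (1/2) *\<^sub>R H m x + (1/2) *\<^sub>R H l x)"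
      by (intro add_left_mono mult_left_mono) auto
    also have "\<dots> = 2 * L2sq (H m) + 2 * L2sq (H l)" by (rule L2sq_parallelogram) measurable
    also have "\<dots> \<le> 2 * ennreal (E m + 1 / real (Suc m)) + 2 * ennreal (E l + 1 / real (Suc l))"
      by (intro add_mono mult_left_mono HE) auto
    also have "\<dots> \<le> 2 * ennreal (E m + 1 / real (Suc m)) + 2 * ennreal (E l + 1 / real (Suc m))"
      using ml by (intro add_left_mono mult_left_mono ennreal_leI) (auto simp: field_simps)
    also have "\<dots> = ennreal (2 * (E m + 1 / real (Suc m)) + 2 * (E l + 1 / real (Suc m)))"
      using E0 by (intro two) (auto intro!: add_nonneg_nonneg)
    finally have *: "L2sq (\<lambda>x. H m x - H l x) + ennreal (4 * E m)
       \<le> ennreal (2 * (E m + 1 / real (Suc m)) + 2 * (E l + 1 / real (Suc m)))"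
      using E0[of m] by (simp add: eE ennreal_mult)
    show ?thesis
    proof (cases "L2sq (\<lambda>x. H m x - H l x)")
      case (real q)
      with * E0 have "q + 4 * E m \<le> 2 * (E m + 1 / real (Suc m)) + 2 * (E l + 1 / real (Suc m))"
        by (simp add: ennreal_plus[symmetric] ennreal_le_iff add_nonneg_nonneg del: ennreal_plus)
      then have "q \<le> 2 * (E l - E m) + 4 / real (Suc m)" by (simp add: algebra_simps)
      then show ?thesis using real by (simp add: ennreal_leI)
    next
      case top
      with * show ?thesis by (simp add: top_unique)
    qed
  qed
  have "\<exists>r. strict_mono r \<and> (AE x in lborel. convergent (\<lambda>k. H (r k) x))"
  proof (rule L2_Cauchy_AE_convergent_subseq)
    fix \<epsilon> :: real assume \<epsilon>: "\<epsilon> > 0"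
    have "incseq E" by (simp add: incseq_def E_mono)
    then have "convergent E"
      by (rule incseq_convergent[of E "max D 0"]) (use ED in \<open>auto intro: convergentI\<close>)
    then have "Cauchy E" by (rule convergent_Cauchy)
    then obtain N1 where N1: "\<And>m l. m \<ge> N1 \<Longrightarrow> l \<ge> N1 \<Longrightarrow> \<bar>E m - E l\<bar> < \<epsilon> / 4"
      using CauchyD[of E "\<epsilon>/4"] \<epsilon> unfolding real_norm_def by (meson divide_pos_pos zero_less_numeral)
    obtain N2 where N2: "8 / \<epsilon> < real N2" using reals_Archimedean2 by blast
    have *: "L2sq (\<lambda>x. H m x - H l x) \<le> ennreal \<epsilon>" if "m \<ge> max N1 N2" "m \<le> l" for m l
    proof -
      have "8 / \<epsilon> < real (Suc m)" using N2 that(1) by simp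
      then have "4 / real (Suc m) < \<epsilon> / 2" using \<epsilon> by (simp add: field_simps)
      moreover define q where "q = E l - E m"
      moreover have "q < \<epsilon> / 4"
      proof -
        have "l \<ge> N1" "m \<ge> N1" using that by auto
        then show ?thesis unfolding q_def using N1[of l m] abs_ge_self[of "E l - E m"] by (meson le_less_trans)
      qed
      ultimately have "2 * q + 4 / real (Suc m) \<le> \<epsilon>" by linarith
      then have "2 * (E l - E m) + 4 / real (Suc m) \<le> \<epsilon>" by (simp only: q_def)
      then show ?thesis using mid[OF that(2)] ennreal_leI order_trans by blast
    qed
    have sym: "L2sq (\<lambda>x. H m x - H l x) = L2sq (\<lambda>x. H l x - H m x)" for m l
      by (simp add: L2sq_def norm_minus_commute)
    show "\<exists>N. \<forall>m\<ge>N. \<forall>n\<ge>N. L2sq (\<lambda>x. H m x - H n x) \<le> ennreal \<epsilon>"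
    proof (intro exI allI impI)
      fix m n assume "max N1 N2 \<le> m" "max N1 N2 \<le> n"
      then show "L2sq (\<lambda>x. H m x - H n x) \<le> ennreal \<epsilon>"
        using *[of m n] *[of n m] sym[of m n] by (cases "m \<le> n") auto
    qed
  qed measurable
  then obtain r where r: "strict_mono r" "AE x in lborel. convergent (\<lambda>k. H (r k) x)" by blast
  define K where "K x = lim (\<lambda>k. H (r k) x)" for x
  have Km: "K \<in> borel_measurable borel"
    unfolding K_def[abs_def] by (rule borel_measurable_lim_metric) measurable
  have bound: "L2sq (H (r k)) \<le> ennreal (max D 0 + 1 / real (Suc (r k)))" for k
    using HE[of "r k"] ED[of "r k"] by (meson add_right_mono ennreal_leI order_trans)
  have wr: "AE x in lborel. (\<lambda>k. w (r k) x) \<longlonglongrightarrow> v x"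
    using wlim by eventually_elim (rule LIMSEQ_subseq_LIMSEQ[OF _ r(1), unfolded o_def])
  have Hr: "AE x in lborel. (\<lambda>k. H (r k) x) \<longlonglongrightarrow> K x"
    using r(2) by eventually_elim (simp add: K_def convergent_LIMSEQ_iff)
  have "(\<lambda>k. max D 0 + 1 / real (Suc k)) \<longlonglongrightarrow> max D 0 + 0"
    by (rule tendsto_add[OF tendsto_const LIMSEQ_inverse_real_of_nat[unfolded inverse_eq_divide]])
  from LIMSEQ_subseq_LIMSEQ[OF this r(1)]
  have dr: "(\<lambda>k. max D 0 + 1 / real (Suc (r k))) \<longlonglongrightarrow> max D 0" by (simp add: o_def)
  have "sobolev_pair v K" "L2sq K \<le> ennreal (max D 0)"
    by (rule sobolev_pair_limit[OF wH v(1) wr wA Km Hr bound dr])+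
  then show ?thesis by (auto simp: max_def ennreal_neg split: if_splits)
qed

section \<open>Averages over grid cells\<close>

lemma diagonal_convergent_subseq:
  fixes a :: "nat \<Rightarrow> nat \<Rightarrow> real"
  assumes "\<And>n. bounded (range (\<lambda>k. a k n))"
  shows "\<exists>r. strict_mono r \<and> (\<forall>n. convergent (\<lambda>k. a (r k) n))"
proof -
  interpret subseqs "\<lambda>n s. convergent (\<lambda>k. a (s k) n)"
  proof
    fix n and s :: "nat \<Rightarrow> nat"
    have "bounded (range (\<lambda>k. a (s k) n))"
      by (rule bounded_subset[OF assms[of n]]) auto
    from bounded_imp_convergent_subsequence[OF this]
    show "\<exists>r'. strict_mono r' \<and> convergent (\<lambda>k. a ((s \<circ> r') k) n)"
      by (auto simp: convergent_def o_def)
  qed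
  have "convergent (\<lambda>k. a (diagseq k) n)" for n
  proof -
    have "convergent (\<lambda>k. a ((diagseq \<circ> (+) (Suc n)) k) n)"
    proof (rule diagseq_holds)
      show "convergent (\<lambda>k. a ((s \<circ> r) k) m)" if "strict_mono r" "convergent (\<lambda>k. a (s k) m)" for r s m
        using convergent_subseq_convergent[OF that(2,1)] by (simp add: o_def)
    qed
    then show ?thesis
      using convergent_ignore_initial_segment[of "\<lambda>k. a (diagseq k) n" "Suc n"] by (simp add: add.commute)
  qed
  with subseq_diagseq show ?thesis by blast
qed

text \<open>The lower left corner of the cell of side length \<open>1 / N\<close> of the grid \<open>N\<^sup>-\<^sup>1 \<int>\<^sup>n\<close> that contains \<open>x\<close>.\<close>

definition grid_corner :: "real \<Rightarrow> 'a::euclidean_space \<Rightarrow> 'a" where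
  "grid_corner N x = (\<Sum>i\<in>Basis. (real_of_int \<lfloor>N * (x \<bullet> i)\<rfloor> / N) *\<^sub>R i)"

definition grid_cell :: "real \<Rightarrow> 'a::euclidean_space \<Rightarrow> 'a set" where
  "grid_cell N x = cbox (grid_corner N x) (grid_corner N x + (1 / N) *\<^sub>R One)"

definition cell_average :: "real \<Rightarrow> ('a::euclidean_space \<Rightarrow> real) \<Rightarrow> 'a \<Rightarrow> real" where
  "cell_average N u x = N ^ DIM('a) * (LINT y|lborel. indicator (grid_cell N x) y * u y)"

lemma grid_corner_inner: "i \<in> Basis \<Longrightarrow> grid_corner N x \<bullet> i = real_of_int \<lfloor>N * (x \<bullet> i)\<rfloor> / N"
  by (simp add: grid_corner_def inner_sum_left_Basis)

text \<open>Countability is what allows a diagonal sequence to handle all cells at once.\<close>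

lemma countable_grid_cells: "countable (range (grid_cell N :: 'a::euclidean_space \<Rightarrow> 'a set))"
proof -
  define C where "C g = cbox (\<Sum>i\<in>Basis. (real_of_int (g i) / N) *\<^sub>R i)
      ((\<Sum>i\<in>Basis. (real_of_int (g i) / N) *\<^sub>R i) + (1 / N) *\<^sub>R One :: 'a)" for g
  have "countable (C ` PiE Basis (\<lambda>_. UNIV))"
    by (intro countable_image countable_PiE) auto
  moreover have "grid_cell N x \<in> C ` PiE Basis (\<lambda>_. UNIV)" for x
  proof -
    have "grid_cell N x = C (restrict (\<lambda>i. \<lfloor>N * (x \<bullet> i)\<rfloor>) Basis)"
      by (simp add: grid_cell_def grid_corner_def C_def)
    moreover have "restrict (\<lambda>i. \<lfloor>N * (x \<bullet> i)\<rfloor>) Basis \<in> PiE Basis (\<lambda>_. UNIV)" by auto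
    ultimately show ?thesis by blast
  qed
  ultimately show ?thesis by (blast intro: countable_subset)
qed

lemma mem_grid_cell: 
  "y \<in> grid_cell N x \<longleftrightarrow> (\<forall>i\<in>Basis. grid_corner N x \<bullet> i \<le> y \<bullet> i \<and> y \<bullet> i \<le> grid_corner N x \<bullet> i + 1 / N)"
  by (simp add: grid_cell_def mem_box inner_add_left)

lemma grid_cell_self: "N > 0 \<Longrightarrow> x \<in> grid_cell N x"
  unfolding mem_grid_cell by (auto simp: grid_corner_inner field_simps) linarith

lemma grid_cell_borel [measurable]: "grid_cell N x \<in> sets borel"
  by (simp add: grid_cell_def)

lemma emeasure_grid_cell:
  assumes "N > 0"
  shows "emeasure lborel (grid_cell N (x::'a::euclidean_space)) = ennreal ((1 / N) ^ DIM('a))"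
  using assms by (simp add: grid_cell_def emeasure_lborel_cbox_eq inner_simps prod_constant)

lemma grid_cell_diff:
  assumes N: "N > 0" and y: "y \<in> grid_cell N x"
  shows "y - x \<in> cbox (- ((1 / N) *\<^sub>R One)) ((1 / N) *\<^sub>R One)"
  using y grid_cell_self[OF N, of x] unfolding mem_grid_cell
  by (force simp: mem_box inner_simps)

lemma grid_cell_measurable_pair [measurable]:
  "Measurable.pred (borel \<Otimes>\<^sub>M borel) (\<lambda>p. snd p \<in> grid_cell N (fst p :: 'a::euclidean_space))"
proof -
  have [measurable]: "grid_corner N \<in> borel_measurable (borel :: 'a measure)"
    unfolding grid_corner_def by measurable
  show ?thesis unfolding mem_grid_cell by measurable
qed

text \<open>The average is a parametric integral of a jointly measurable function.\<close>

lemma cell_average_measurable: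
  assumes [measurable]: "u \<in> borel_measurable borel"
  shows "cell_average N (u :: 'a::euclidean_space \<Rightarrow> real) \<in> borel_measurable borel"
proof -
  have "(\<lambda>p. (if snd p \<in> grid_cell N (fst p) then 1 else 0) * u (snd p)) \<in> borel_measurable (borel \<Otimes>\<^sub>M lborel)"
    by measurable
  then have "(\<lambda>x. LINT y|lborel. (if y \<in> grid_cell N x then 1 else 0) * u y) \<in> borel_measurable borel"
    by (intro lborel.borel_measurable_lebesgue_integral) (simp add: case_prod_beta')
  then show ?thesis
    unfolding cell_average_def by (simp add: indicator_def of_bool_def)
qed

lemma L2_indicator_integrable:
  fixes u :: "'a::euclidean_space \<Rightarrow> real"
  assumes [measurable]: "u \<in> borel_measurable borel" "Q \<in> sets borel"
    and "L2sq u < \<infinity>" "emeasure lborel Q < \<infinity>"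
  shows "integrable lborel (\<lambda>y. indicator Q y * u y)"
proof (rule integrable_L2_mult)
  have "L2sq (indicator Q :: 'a \<Rightarrow> real) = (\<integral>\<^sup>+x. indicator Q x \<partial>lborel)"
    unfolding L2sq_def by (rule nn_integral_cong) (auto simp: indicator_def)
  then show "L2sq (indicator Q :: 'a \<Rightarrow> real) < \<infinity>" using assms by simp
qed (use assms in auto)

text \<open>Within a cell, \<open>u(x)\<close> is compared with \<open>u(x + h)\<close> for shifts \<open>h\<close> in a cube \<open>B\<close> of side length \<open>2 / N\<close>, whose
  volume is \<open>2\<^sup>n\<close> times the volume of the cell. Each shift costs at most \<open>\<bar>h\<bar>\<^sup>2 \<le> (n / N)\<^sup>2\<close> times the Dirichlet
  integral.\<close>

lemma cell_average_approximation:
  fixes u :: "'a::euclidean_space \<Rightarrow> real"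
  assumes uG: "sobolev_pair u G" and fin: "L2sq u < \<infinity>" and N: "N > 0"
  shows "L2sq (\<lambda>x. u x - cell_average N u x) \<le> ennreal (2 ^ DIM('a) * (real DIM('a))\<^sup>2 / N\<^sup>2) * L2sq G"
proof -
  note [measurable] = sobolev_measurable[OF uG]
  define B where "B = cbox (- ((1 / N) *\<^sub>R One)) ((1 / N) *\<^sub>R One :: 'a)"
  define c where "c = (1 / N) ^ DIM('a)"
  have c: "c > 0" "1 / c = N ^ DIM('a)" using N by (auto simp: c_def power_divide)
  have [measurable]: "B \<in> sets borel" by (simp add: B_def)
  have pt: "ennreal ((norm (u x - cell_average N u x))\<^sup>2)
    \<le> ennreal (1 / c) * (\<integral>\<^sup>+h. indicator B h * ennreal ((norm (u (x + h) - u x))\<^sup>2) \<partial>lborel)" for x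
  proof -
    let ?Q = "grid_cell N x"
    have Qc: "emeasure lborel ?Q = ennreal c" unfolding c_def by (rule emeasure_grid_cell[OF N])
    have "integrable lborel (\<lambda>y. indicator ?Q y * u y)"
      by (rule L2_indicator_integrable) (use fin Qc in auto)
    moreover have "integrable lborel (\<lambda>y. indicator ?Q y * u x)"
      using Qc by (intro integrable_mult_left) simp
    moreover have "(LINT y|lborel. indicator ?Q y * u x) = c * u x"
      using Qc c by (simp add: measure_def)
    ultimately have "(LINT y|lborel. indicator ?Q y * (u y - u x)) = (LINT y|lborel. indicator ?Q y * u y) - c * u x"
      by (simp add: right_diff_distrib)
    then have "1 / c * (LINT y|lborel. indicator ?Q y * (u y - u x)) = - (u x - cell_average N u x)"
      using c(1) unfolding cell_average_def c(2)[symmetric] by (simp add: right_diff_distrib)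
    then have "(u x - cell_average N u x)\<^sup>2 = (1 / c * (LINT y|lborel. indicator ?Q y * (u y - u x)))\<^sup>2"
      by (simp only: power2_minus)
    then have "ennreal ((norm (u x - cell_average N u x))\<^sup>2)
      \<le> ennreal (1 / c) * (\<integral>\<^sup>+y. indicator ?Q y * ennreal ((u y - u x)\<^sup>2) \<partial>lborel)"
      using Jensen_L2[OF _ _ Qc c(1), of "\<lambda>y. u y - u x"] by simp
    also have "\<dots> \<le> ennreal (1 / c) * (\<integral>\<^sup>+y. indicator B (y + - x) * ennreal ((norm (u (x + (y + - x)) - u x))\<^sup>2) \<partial>lborel)"
      using grid_cell_diff[OF N, of _ x]
      by (intro mult_left_mono nn_integral_mono) (auto simp: indicator_def B_def)
    also have "(\<integral>\<^sup>+y. indicator B (y + - x) * ennreal ((norm (u (x + (y + - x)) - u x))\<^sup>2) \<partial>lborel)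
      = (\<integral>\<^sup>+h. indicator B h * ennreal ((norm (u (x + h) - u x))\<^sup>2) \<partial>lborel)"
      by (rule nn_integral_translate[of "\<lambda>h. indicator B h * ennreal ((norm (u (x + h) - u x))\<^sup>2)" "- x"]) measurable
    finally show ?thesis .
  qed
  have KB: "(norm h)\<^sup>2 \<le> (DIM('a) / N)\<^sup>2" if "h \<in> B" for h
  proof -
    have "norm h \<le> (\<Sum>b\<in>Basis. \<bar>h \<bullet> b\<bar>)" by (rule norm_le_l1)
    also have "\<dots> \<le> (\<Sum>b\<in>(Basis::'a set). 1 / N)"
      using that by (intro sum_mono) (auto simp: B_def mem_box abs_le_iff minus_le_iff)
    finally show ?thesis by (intro power_mono) auto
  qed
  have VB: "emeasure lborel B = ennreal ((2 / N) ^ DIM('a))"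
    using N by (simp add: B_def emeasure_lborel_cbox_eq inner_simps prod_constant)
  have "L2sq (\<lambda>x. u x - cell_average N u x)
    \<le> (\<integral>\<^sup>+x. ennreal (1 / c) * (\<integral>\<^sup>+h. indicator B h * ennreal ((norm (u (x + h) - u x))\<^sup>2) \<partial>lborel) \<partial>lborel)"
    unfolding L2sq_def by (intro nn_integral_mono pt)
  also have "\<dots> = ennreal (1 / c) * (\<integral>\<^sup>+x. \<integral>\<^sup>+h. indicator B h * ennreal ((norm (u (x + h) - u x))\<^sup>2) \<partial>lborel \<partial>lborel)"
    by (rule nn_integral_cmult) measurable
  also have "(\<integral>\<^sup>+x. \<integral>\<^sup>+h. indicator B h * ennreal ((norm (u (x + h) - u x))\<^sup>2) \<partial>lborel \<partial>lborel)
    = (\<integral>\<^sup>+h. \<integral>\<^sup>+x. indicator B h * ennreal ((norm (u (x + h) - u x))\<^sup>2) \<partial>lborel \<partial>lborel)"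
    by (rule lborel_pair.Fubini') measurable
  also have "\<dots> = (\<integral>\<^sup>+h. indicator B h * L2sq (\<lambda>x. u (x + h) - u x) \<partial>lborel)"
    unfolding L2sq_def by (intro nn_integral_cong nn_integral_cmult) measurable
  also have "\<dots> \<le> (\<integral>\<^sup>+h. indicator B h * (ennreal ((DIM('a) / N)\<^sup>2) * L2sq G) \<partial>lborel)"
  proof (rule nn_integral_mono)
    fix h :: 'a
    show "indicator B h * L2sq (\<lambda>x. u (x + h) - u x) \<le> indicator B h * (ennreal ((DIM('a) / N)\<^sup>2) * L2sq G)"
    proof (cases "h \<in> B")
      case True
      have "L2sq (\<lambda>x. u (x + h) - u x) \<le> ennreal ((norm h)\<^sup>2) * L2sq G"
        by (rule sobolev_translation_estimate[OF uG])
      also have "\<dots> \<le> ennreal ((DIM('a) / N)\<^sup>2) * L2sq G"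
        using KB[OF True] by (intro mult_right_mono ennreal_leI) auto
      finally show ?thesis using True by simp
    qed simp
  qed
  also have "\<dots> = ennreal ((2 / N) ^ DIM('a)) * (ennreal ((DIM('a) / N)\<^sup>2) * L2sq G)"
    by (simp add: nn_integral_multc VB)
  also have "ennreal (1 / c) * (ennreal ((2 / N) ^ DIM('a)) * (ennreal ((DIM('a) / N)\<^sup>2) * L2sq G))
    = (ennreal (1 / c) * ennreal ((2 / N) ^ DIM('a)) * ennreal ((DIM('a) / N)\<^sup>2)) * L2sq G"
    by (simp only: mult_ac)
  also have "ennreal (1 / c) * ennreal ((2 / N) ^ DIM('a)) * ennreal ((DIM('a) / N)\<^sup>2)
     = ennreal (2 ^ DIM('a) * (real DIM('a))\<^sup>2 / N\<^sup>2)"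
    using N c by (simp add: ennreal_mult[symmetric] power_divide)
  finally show ?thesis by (simp add: mult_left_mono)
qed

lemma cell_average_bound:
  fixes u :: "'a::euclidean_space \<Rightarrow> real"
  assumes [measurable]: "u \<in> borel_measurable borel" and A: "L2sq u \<le> ennreal A" "A \<ge> 0" and N: "N > 0"
  shows "(cell_average N u x)\<^sup>2 \<le> N ^ DIM('a) * A"
proof -
  define c where "c = (1 / N) ^ DIM('a)"
  have c: "c > 0" "1 / c = N ^ DIM('a)" using N by (auto simp: c_def power_divide)
  have "ennreal ((cell_average N u x)\<^sup>2) \<le> ennreal (1 / c) * (\<integral>\<^sup>+y. indicator (grid_cell N x) y * ennreal ((u y)\<^sup>2) \<partial>lborel)"
    unfolding cell_average_def c(2)[symmetric]
    by (rule Jensen_L2) (use emeasure_grid_cell[OF N, of x] c in \<open>auto simp: c_def\<close>)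
  also have "\<dots> \<le> ennreal (1 / c) * L2sq u"
    unfolding L2sq_def by (intro mult_left_mono nn_integral_mono) (auto simp: indicator_def)
  also have "\<dots> \<le> ennreal (1 / c) * ennreal A" by (intro mult_left_mono A) simp
  also have "\<dots> = ennreal (N ^ DIM('a) * A)" using A(2) N unfolding c(2) by (simp add: ennreal_mult)
  finally show ?thesis using A(2) N by (simp add: ennreal_le_iff)
qed

section \<open>Compactness\<close>

lemma cell_average_diff:
  assumes [measurable]: "u \<in> borel_measurable borel" "w \<in> borel_measurable borel"
    and "L2sq u < \<infinity>" "L2sq w < \<infinity>" "N > 0"
  shows "cell_average N (\<lambda>x. u x - w x) x = cell_average N u x - cell_average N w (x::'a::euclidean_space)"
proof -
  have "emeasure lborel (grid_cell N x) < \<infinity>" using emeasure_grid_cell[OF \<open>N > 0\<close>, of x] by simp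
  then have "integrable lborel (\<lambda>y. indicator (grid_cell N x) y * u y)"
      "integrable lborel (\<lambda>y. indicator (grid_cell N x) y * w y)"
    using assms by (auto intro!: L2_indicator_integrable)
  then show ?thesis by (simp add: cell_average_def right_diff_distrib)
qed

lemma cell_averages_convergent_subseq:
  fixes u :: "nat \<Rightarrow> 'a::euclidean_space \<Rightarrow> real"
  assumes m: "\<And>k. u k \<in> borel_measurable borel" and A: "\<And>k. L2sq (u k) \<le> ennreal A" "A \<ge> 0"
  shows "\<exists>r. strict_mono r \<and> (\<forall>j x. convergent (\<lambda>k. cell_average (real (Suc j)) (u (r k)) x))"
proof -
  define Q where "Q = (\<Union>j. range (grid_cell (real (Suc j)) :: 'a \<Rightarrow> 'a set))"
  have Q: "countable Q" "Q \<noteq> {}" unfolding Q_def using countable_grid_cells by auto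
  define a where "a k n = (LINT y|lborel. indicator (from_nat_into Q n) y * u k y)" for k n
  have "\<exists>r. strict_mono r \<and> (\<forall>n. convergent (\<lambda>k. a (r k) n))"
  proof (rule diagonal_convergent_subseq)
    fix n
    have "from_nat_into Q n \<in> Q" using Q(2) by (rule from_nat_into)
    then obtain j x where e: "from_nat_into Q n = grid_cell (real (Suc j)) x" unfolding Q_def by blast
    define N where "N = real (Suc j)"
    have N: "N > 0" by (simp add: N_def)
    define M where "M = N ^ DIM('a) * A"
    have "norm (a k n) \<le> (1 + M) / N ^ DIM('a)" for k
    proof -
      have "(cell_average N (u k) x)\<^sup>2 \<le> M" unfolding M_def by (rule cell_average_bound[OF m A N])
      moreover have "\<bar>t\<bar> \<le> 1 + t\<^sup>2" for t :: real
        using sum_squares_bound[of "\<bar>t\<bar>" 1] abs_ge_zero[of t] unfolding power2_abs power_one by linarith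
      ultimately have "\<bar>cell_average N (u k) x\<bar> \<le> 1 + M" by (meson add_left_mono order_trans)
      moreover have "cell_average N (u k) x = N ^ DIM('a) * a k n"
        by (simp add: cell_average_def a_def e N_def)
      ultimately show ?thesis using N by (simp add: abs_mult field_simps)
    qed
    then show "bounded (range (\<lambda>k. a k n))" unfolding bounded_iff by blast
  qed
  then obtain r where r: "strict_mono r" "\<And>n. convergent (\<lambda>k. a (r k) n)" by blast
  have "convergent (\<lambda>k. cell_average (real (Suc j)) (u (r k)) x)" for j x
  proof -
    have "grid_cell (real (Suc j)) x \<in> Q" unfolding Q_def by blast
    then obtain n where n: "from_nat_into Q n = grid_cell (real (Suc j)) x"
      using range_from_nat_into[OF Q(2,1)] by (metis imageE)
    have "convergent (\<lambda>k. real (Suc j) ^ DIM('a) * a (r k) n)"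
      using r(2)[of n] by (intro convergent_mult convergent_const)
    then show ?thesis by (simp add: cell_average_def a_def n)
  qed
  with r(1) show ?thesis by blast
qed

text \<open>Uniformly bounded pointwise convergence on a set of finite measure is convergence in \<open>L\<^sup>2\<close>.\<close>

lemma cell_averages_L2_Cauchy:
  fixes a :: "nat \<Rightarrow> 'a::euclidean_space \<Rightarrow> real"
  assumes [measurable]: "\<And>k. a k \<in> borel_measurable borel" "\<Omega> \<in> sets borel" and fin: "emeasure lborel \<Omega> < \<infinity>"
    and bd: "\<And>k x. (a k x)\<^sup>2 \<le> M" and conv: "\<And>x. convergent (\<lambda>k. a k x)" and e: "e > 0"
  shows "\<exists>K. \<forall>m\<ge>K. \<forall>l\<ge>K. (\<integral>\<^sup>+x. indicator \<Omega> x * ennreal ((a m x - a l x)\<^sup>2) \<partial>lborel) \<le> ennreal e"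
proof -
  define b where "b x = lim (\<lambda>k. a k x)" for x
  have b: "(\<lambda>k. a k x) \<longlonglongrightarrow> b x" for x
    using conv[of x] by (simp add: b_def convergent_LIMSEQ_iff)
  have [measurable]: "b \<in> borel_measurable borel"
    unfolding b_def[abs_def] by (rule borel_measurable_lim_metric) measurable
  have bM: "(b x)\<^sup>2 \<le> M" for x
    by (rule LIMSEQ_le_const2[OF tendsto_power[OF b]]) (use bd in auto)
  have sq: "(s - t)\<^sup>2 \<le> 2 * s\<^sup>2 + 2 * t\<^sup>2" for s t :: real
    using sum_squares_bound[of s "- t"] by (simp add: power2_diff)
  let ?f = "\<lambda>k x. indicator \<Omega> x * (a k x - b x)\<^sup>2"
  have i4: "integrable lborel (\<lambda>x. indicator \<Omega> x * (4 * M))"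
    using fin by (intro integrable_mult_left) simp
  have f4: "norm (?f k x) \<le> indicator \<Omega> x * (4 * M)" for k x
    using sq[of "a k x" "b x"] bd[of k x] bM[of x] by (auto simp: indicator_def)
  have fi: "integrable lborel (?f k)" for k
    by (rule Bochner_Integration.integrable_bound[OF i4]) (use f4 in \<open>auto intro: order_trans[OF _ abs_ge_self]\<close>)
  have "(\<lambda>k. LINT x|lborel. ?f k x) \<longlonglongrightarrow> (LINT x|(lborel :: 'a measure). (0::real))"
  proof (rule integral_dominated_convergence[OF _ _ i4])
    show "AE x in lborel. (\<lambda>k. ?f k x) \<longlonglongrightarrow> 0"
    proof (rule AE_I2)
      fix x
      have "(\<lambda>k. ?f k x) \<longlonglongrightarrow> indicator \<Omega> x * (b x - b x)\<^sup>2" by (intro tendsto_intros b)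
      then show "(\<lambda>k. ?f k x) \<longlonglongrightarrow> 0" by simp
    qed
  qed (use f4 in auto)
  then obtain K where K: "\<And>k. k \<ge> K \<Longrightarrow> norm (LINT x|lborel. ?f k x) < e / 4"
    using e LIMSEQ_D[of "\<lambda>k. LINT x|lborel. ?f k x" 0 "e/4"] by auto
  have "(\<integral>\<^sup>+x. indicator \<Omega> x * ennreal ((a m x - a l x)\<^sup>2) \<partial>lborel) \<le> ennreal e" if "m \<ge> K" "l \<ge> K" for m l
  proof -
    have "(\<integral>\<^sup>+x. indicator \<Omega> x * ennreal ((a m x - a l x)\<^sup>2) \<partial>lborel) \<le> (\<integral>\<^sup>+x. ennreal (2 * ?f m x + 2 * ?f l x) \<partial>lborel)"
    proof (rule nn_integral_mono)
      fix x
      have "(a m x - a l x)\<^sup>2 \<le> 2 * (a m x - b x)\<^sup>2 + 2 * (a l x - b x)\<^sup>2"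
        using sq[of "a m x - b x" "a l x - b x"] by simp
      from ennreal_leI[OF this]
      show "indicator \<Omega> x * ennreal ((a m x - a l x)\<^sup>2) \<le> ennreal (2 * ?f m x + 2 * ?f l x)"
        by (auto simp: indicator_def)
    qed
    also have "\<dots> = ennreal (LINT x|lborel. 2 * ?f m x + 2 * ?f l x)"
      by (rule nn_integral_eq_integral) (use fi in \<open>auto intro!: Bochner_Integration.integrable_add integrable_mult_right\<close>)
    also have "(LINT x|lborel. 2 * ?f m x + 2 * ?f l x) = 2 * (LINT x|lborel. ?f m x) + 2 * (LINT x|lborel. ?f l x)"
      using fi by simp
    also have "\<dots> \<le> e"
      using K[OF that(1)] K[OF that(2)] by (simp add: abs_less_iff)
    finally show ?thesis by (simp add: ennreal_leI)
  qed
  then show ?thesis by blast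
qed

text \<open>A Rellich theorem on sets of finite measure. The difference of two terms of the sequence is close
  to its cell averages on a fine grid, and these form a Cauchy sequence in \<open>L\<^sup>2(\<Omega>)\<close>.\<close>

lemma sobolev_compactness:
  fixes u :: "nat \<Rightarrow> 'a::euclidean_space \<Rightarrow> real"
  assumes uG: "\<And>k. sobolev_pair (u k) (G k)"
    and \<Omega> [measurable]: "\<Omega> \<in> sets borel" and fin: "emeasure lborel \<Omega> < \<infinity>"
    and zero: "\<And>k. AE x in lborel. x \<notin> \<Omega> \<longrightarrow> u k x = 0"
    and A: "\<And>k. L2sq (u k) \<le> ennreal A" "A \<ge> 0" and B: "\<And>k. L2sq (G k) \<le> ennreal B" "B \<ge> 0"
  shows "\<exists>r v. strict_mono r \<and> v \<in> borel_measurable borel \<and> (AE x in lborel. (\<lambda>k. u (r k) x) \<longlonglongrightarrow> v x)"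
proof -
  note [measurable] = sobolev_measurable[OF uG] cell_average_measurable
  have ufin: "L2sq (u k) < \<infinity>" for k using le_less_trans[OF A(1)[of k] ennreal_less_top] by simp
  obtain r where r: "strict_mono r"
    "\<And>j x. convergent (\<lambda>k. cell_average (real (Suc j)) (u (r k)) x)"
    using cell_averages_convergent_subseq[of u A] sobolev_measurable(1)[OF uG] A by blast
  have "\<exists>r'. strict_mono r' \<and> (AE x in lborel. convergent (\<lambda>k. u (r (r' k)) x))"
  proof (rule L2_Cauchy_AE_convergent_subseq)
    fix e :: real assume e: "e > 0"
    define D where "D = 2 ^ DIM('a) * (real DIM('a))\<^sup>2"
    have D: "D \<ge> 0" by (simp add: D_def)
    \<comment> \<open>The grid is so fine that replacing a difference \<open>w\<close> of two terms by its cell averages costs at most \<open>e / 4\<close>.\<close>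
    obtain j where j: "16 * D * B / e < real j" using reals_Archimedean2 by blast
    define N where "N = real (Suc j)"
    have N: "N > 0" "N \<ge> 1" by (auto simp: N_def)
    have small: "D / N\<^sup>2 * (4 * B) \<le> e / 4"
    proof -
      have "16 * D * B / e \<le> N" using j by (simp add: N_def)
      also have "\<dots> \<le> N\<^sup>2" using N by (simp add: power2_eq_square)
      finally show ?thesis using e N by (simp add: field_simps)
    qed
    define a where "a k = cell_average N (u (r k))" for k
    have [measurable]: "a k \<in> borel_measurable borel" for k unfolding a_def by measurable
    have "\<exists>K. \<forall>m\<ge>K. \<forall>l\<ge>K. (\<integral>\<^sup>+x. indicator \<Omega> x * ennreal ((a m x - a l x)\<^sup>2) \<partial>lborel) \<le> ennreal (e / 4)"
    proof (rule cell_averages_L2_Cauchy[OF _ \<Omega> fin])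
      show "(a k x)\<^sup>2 \<le> N ^ DIM('a) * A" for k x
        unfolding a_def by (rule cell_average_bound[OF _ A N(1)]) measurable
      show "convergent (\<lambda>k. a k x)" for x using r(2) by (simp add: a_def N_def)
    qed (use e in auto)
    then obtain K where K: "\<And>m l. m \<ge> K \<Longrightarrow> l \<ge> K \<Longrightarrow>
        (\<integral>\<^sup>+x. indicator \<Omega> x * ennreal ((a m x - a l x)\<^sup>2) \<partial>lborel) \<le> ennreal (e / 4)" by blast
    have "L2sq (\<lambda>x. u (r m) x - u (r l) x) \<le> ennreal e" if "m \<ge> K" "l \<ge> K" for m l
    proof -
      define w where "w x = u (r m) x - u (r l) x" for x
      define H where "H x = G (r m) x - G (r l) x" for x
      have [measurable]: "w \<in> borel_measurable borel" unfolding w_def[abs_def] by measurable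
      have wH: "sobolev_pair w H"
        using sobolev_pair_scaleR_add[OF uG[of "r m"] uG[of "r l"], of 1 "-1"] by (simp add: w_def[abs_def] H_def[abs_def])
      have "L2sq w \<le> 2 * L2sq (u (r m)) + 2 * L2sq (u (r l))"
        unfolding w_def[abs_def] by (rule L2sq_diff_le) measurable
      also have "\<dots> < \<infinity>" using ufin by (simp add: ennreal_mult_less_top)
      finally have wfin: "L2sq w < \<infinity>" .
      have "L2sq H \<le> 2 * L2sq (G (r m)) + 2 * L2sq (G (r l))"
        unfolding H_def[abs_def] by (rule L2sq_diff_le) measurable
      also have "\<dots> \<le> 2 * ennreal B + 2 * ennreal B" by (intro add_mono mult_left_mono B) auto
      also have "\<dots> = ennreal (4 * B)" using B(2) by (simp add: ennreal_mult flip: distrib_right)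
      finally have HB: "L2sq H \<le> ennreal (4 * B)" .
      have avg: "cell_average N w x = a m x - a l x" for x
        unfolding w_def[abs_def] a_def by (rule cell_average_diff) (use ufin N in auto)
      have "L2sq (\<lambda>x. w x - cell_average N w x) \<le> ennreal (D / N\<^sup>2) * L2sq H"
        unfolding D_def by (rule cell_average_approximation[OF wH wfin N(1)])
      also have "\<dots> \<le> ennreal (D / N\<^sup>2) * ennreal (4 * B)" by (intro mult_left_mono HB) simp
      also have "\<dots> \<le> ennreal (e / 4)"
        using small D B(2) by (simp add: ennreal_mult[symmetric] ennreal_leI)
      finally have 1: "L2sq (\<lambda>x. w x - cell_average N w x) \<le> ennreal (e / 4)" .
      have "AE x in lborel. x \<notin> \<Omega> \<longrightarrow> w x = 0"
        using zero[of "r m"] zero[of "r l"] by eventually_elim (auto simp: w_def)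
      then have "L2sq w \<le> (\<integral>\<^sup>+x. 2 * ennreal ((norm (w x - cell_average N w x))\<^sup>2)
          + 2 * (indicator \<Omega> x * ennreal ((a m x - a l x)\<^sup>2)) \<partial>lborel)"
        unfolding L2sq_def
      proof (intro nn_integral_mono_AE, eventually_elim)
        case (elim x)
        show ?case
        proof (cases "x \<in> \<Omega>")
          case True
          have "(w x)\<^sup>2 \<le> 2 * (w x - cell_average N w x)\<^sup>2 + 2 * (cell_average N w x)\<^sup>2"
            using sum_squares_bound[of "w x - cell_average N w x" "cell_average N w x"]
              power2_sum[of "w x - cell_average N w x" "cell_average N w x"] by simp
          from ennreal_leI[OF this] True show ?thesis
            by (simp add: avg ennreal_plus ennreal_mult)
        qed (use elim in simp)
      qed
      also have "\<dots> = 2 * L2sq (\<lambda>x. w x - cell_average N w x)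
          + 2 * (\<integral>\<^sup>+x. indicator \<Omega> x * ennreal ((a m x - a l x)\<^sup>2) \<partial>lborel)"
        unfolding L2sq_def by (subst nn_integral_add) (auto simp: nn_integral_cmult cell_average_measurable)
      also have "\<dots> \<le> 2 * ennreal (e / 4) + 2 * ennreal (e / 4)"
        by (intro add_mono mult_left_mono 1 K that) auto
      also have "2 * ennreal (e / 4) = ennreal (e / 2)" using ennreal_mult[of 2 "e / 4"] e by simp
      also have "ennreal (e / 2) + ennreal (e / 2) = ennreal e"
        using e by (simp add: ennreal_plus[symmetric] del: ennreal_plus)
      finally show ?thesis by (simp add: w_def[abs_def])
    qed
    then show "\<exists>N. \<forall>m\<ge>N. \<forall>n\<ge>N. L2sq (\<lambda>x. u (r m) x - u (r n) x) \<le> ennreal e" by blast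
  qed measurable
  then obtain r' where r': "strict_mono r'" "AE x in lborel. convergent (\<lambda>k. u (r (r' k)) x)" by blast
  define v where "v x = lim (\<lambda>k. u (r (r' k)) x)" for x
  have "v \<in> borel_measurable borel"
    unfolding v_def[abs_def] by (rule borel_measurable_lim_metric) measurable
  moreover have "AE x in lborel. (\<lambda>k. u ((r \<circ> r') k) x) \<longlonglongrightarrow> v x"
    using r'(2) by eventually_elim (simp add: v_def convergent_LIMSEQ_iff)
  moreover have "strict_mono (r \<circ> r')" by (rule strict_mono_o[OF r(1) r'(1)])
  ultimately show ?thesis by blast
qed

section \<open>Sets with prescribed volumes\<close>

text \<open>The volume of \<open>A \<inter> ball 0 r\<close> depends continuously on \<open>r\<close>, because its growth is at most that of the
  volume of the ball; the intermediate value theorem gives the radius.\<close>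

lemma borel_subset_of_measure:
  fixes A :: "'a::euclidean_space set"
  assumes [measurable]: "A \<in> sets borel" and fin: "emeasure lborel A < \<infinity>" and c: "0 \<le> c" "c \<le> measure lborel A"
  shows "\<exists>B. B \<in> sets borel \<and> B \<subseteq> A \<and> measure lborel B = c"
proof (cases "c = measure lborel A")
  case True
  then show ?thesis using assms by blast
next
  case False
  define f where "f r = measure lborel (A \<inter> ball 0 r)" for r
  define g where "g r = measure lborel (ball (0::'a) r)" for r
  have g: "g r = unit_ball_vol (real DIM('a)) * r ^ DIM('a)" if "r \<ge> 0" for r
    using content_ball[OF that, of "0::'a"] by (simp add: g_def)
  have fm: "A \<inter> ball 0 r \<in> fmeasurable lborel" for r
    using fin by (intro fmeasurableI) (auto intro: le_less_trans[OF emeasure_mono])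
  have bm: "ball (0::'a) r \<in> fmeasurable lborel" for r
    using emeasure_lborel_ball_finite[of "0::'a" r] by (intro fmeasurableI) auto
  have mono: "0 \<le> f s - f r \<and> f s - f r \<le> g s - g r" if "r \<le> s" for r s
  proof -
    have sub: "A \<inter> ball 0 r \<subseteq> A \<inter> ball 0 s" "ball (0::'a) r \<subseteq> ball 0 s" using that by auto
    have "f s - f r = measure lborel ((A \<inter> ball 0 s) - (A \<inter> ball 0 r))"
      unfolding f_def using fm sub by (simp add: measurable_measure_Diff)
    moreover have "g s - g r = measure lborel (ball (0::'a) s - ball 0 r)"
      unfolding g_def using bm sub by (simp add: measurable_measure_Diff)
    moreover have "measure lborel ((A \<inter> ball 0 s) - (A \<inter> ball 0 r)) \<le> measure lborel (ball (0::'a) s - ball 0 r)"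
      using bm by (intro measure_mono_fmeasurable fmeasurable_Diff) auto
    ultimately show ?thesis by simp
  qed
  have "(\<lambda>n. measure lborel (A \<inter> ball 0 (real n))) \<longlonglongrightarrow> measure lborel (\<Union>n. A \<inter> ball 0 (real n))"
  proof (rule Lim_measure_incseq)
    show "incseq (\<lambda>n. A \<inter> ball 0 (real n))" by (auto simp: incseq_def)
    show "emeasure lborel (\<Union>n. A \<inter> ball 0 (real n)) \<noteq> \<infinity>"
      using fin emeasure_mono[of "\<Union>n. A \<inter> ball 0 (real n)" A lborel] by (auto simp: top_unique)
  qed auto
  moreover have "(\<Union>n. A \<inter> ball 0 (real n)) = A"
    using reals_Archimedean2 by auto
  ultimately have "(\<lambda>n. f (real n)) \<longlonglongrightarrow> measure lborel A" by (simp add: f_def)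
  moreover have "c < measure lborel A" using False c by simp
  ultimately obtain n where n: "c < f (real n)"
    using order_tendstoD(1)[of "\<lambda>n. f (real n)"] by (metis eventually_happens trivial_limit_sequentially)
  have "continuous_on {0..real n} f"
  proof -
    have cg: "continuous_on {0..real n} g"
      by (rule continuous_on_eq[of _ "\<lambda>r. unit_ball_vol (real DIM('a)) * r ^ DIM('a)"])
         (auto intro!: continuous_intros simp: g)
    have le: "dist (f r) (f s) \<le> dist (g r) (g s)" for r s
      using mono[of r s] mono[of s r] by (cases "r \<le> s") (auto simp: dist_real_def)
    show ?thesis using cg unfolding continuous_on_iff
      by (meson le le_less_trans)
  qed
  moreover have "f 0 = 0" by (simp add: f_def)
  ultimately obtain r where "f r = c"
    using IVT'[of f 0 c "real n"] n c by auto
  then show ?thesis by (intro exI[of _ "A \<inter> ball 0 r"]) (auto simp: f_def)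
qed

lemma disjoint_subsets_of_measures:
  fixes R :: "'a::euclidean_space set"
  assumes "finite I" "R \<in> sets borel" "emeasure lborel R < \<infinity>" "\<And>i. i \<in> I \<Longrightarrow> 0 \<le> w i"
    "sum w I \<le> measure lborel R"
  shows "\<exists>T. (\<forall>i\<in>I. T i \<in> sets borel \<and> T i \<subseteq> R \<and> measure lborel (T i) = w i) \<and> disjoint_family_on T I"
  using assms
proof (induction I arbitrary: R rule: finite_induct)
  case empty
  then show ?case by (auto simp: disjoint_family_on_def)
next
  case (insert j I)
  have "0 \<le> sum w I" "0 \<le> w j" using insert.prems(3) by (auto intro: sum_nonneg)
  then have "w j \<le> measure lborel R" using insert.prems(4) insert.hyps by simp
  then obtain B where B: "B \<in> sets borel" "B \<subseteq> R" "measure lborel B = w j"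
    using borel_subset_of_measure[OF insert.prems(1,2) \<open>0 \<le> w j\<close>] by blast
  have fR: "R \<in> fmeasurable lborel" using insert.prems by (intro fmeasurableI) auto
  have fB: "B \<in> fmeasurable lborel" using fmeasurableI2[OF fR B(2)] B(1) by simp
  have "measure lborel (R - B) = measure lborel R - w j"
    using measurable_measure_Diff[OF fR _ B(2)] B by simp
  then have "sum w I \<le> measure lborel (R - B)" using insert.prems(4) insert.hyps by simp
  moreover have "emeasure lborel (R - B) < \<infinity>"
    using insert.prems(2) by (rule le_less_trans[rotated]) (use insert.prems B in \<open>auto intro!: emeasure_mono\<close>)
  ultimately have "\<exists>T. (\<forall>i\<in>I. T i \<in> sets borel \<and> T i \<subseteq> R - B \<and> measure lborel (T i) = w i) \<and> disjoint_family_on T I"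
    by (intro insert.IH) (use insert.prems B in auto)
  then obtain T where T: "\<And>i. i \<in> I \<Longrightarrow> T i \<in> sets borel \<and> T i \<subseteq> R - B \<and> measure lborel (T i) = w i"
      "disjoint_family_on T I"
    by blast
  define T' where "T' = T(j := B)"
  have "disjoint_family_on T' (insert j I)"
    unfolding disjoint_family_on_def
  proof (intro ballI impI)
    fix a b assume ab: "a \<in> insert j I" "b \<in> insert j I" "a \<noteq> b"
    consider "a = j" "b \<in> I" | "b = j" "a \<in> I" | "a \<in> I" "b \<in> I" "a \<noteq> j" "b \<noteq> j"
      using ab insert.hyps by blast
    then show "T' a \<inter> T' b = {}"
    proof cases
      case 1
      then show ?thesis using T(1)[of b] insert.hyps by (auto simp: T'_def)
    next
      case 2
      then show ?thesis using T(1)[of a] insert.hyps by (auto simp: T'_def)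
    next
      case 3
      then show ?thesis using T(2) ab(3) by (auto simp: T'_def disjoint_family_on_def)
    qed
  qed
  moreover have "\<forall>i\<in>insert j I. T' i \<in> sets borel \<and> T' i \<subseteq> R \<and> measure lborel (T' i) = w i"
  proof
    fix i assume "i \<in> insert j I"
    then show "T' i \<in> sets borel \<and> T' i \<subseteq> R \<and> measure lborel (T' i) = w i"
      using T(1)[of i] B by (cases "i = j") (auto simp: T'_def)
  qed
  ultimately show ?case by blast
qed

section \<open>Coercivity of the energy\<close>

lemma set_borel_representative:
  fixes f :: "'a::euclidean_space \<Rightarrow> real"
  assumes "set_borel_measurable lebesgue \<Omega> f"
  obtains f' where "f' \<in> borel_measurable borel" "AE x in lborel. indicator \<Omega> x * f x = f' x"
proof -
  have fm: "(\<lambda>x. indicator \<Omega> x * f x) \<in> borel_measurable lebesgue"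
    using assms by (simp add: set_borel_measurable_def)
  show thesis by (rule borel_representative[OF fm], rule that)
qed

lemma Linfty_representative:
  fixes f :: "'a::euclidean_space \<Rightarrow> real"
  assumes f: "Linfty_on \<Omega> f" and pos: "AE x\<in>\<Omega> in lebesgue. f x \<ge> 0"
  shows "\<exists>f' C. f' \<in> borel_measurable borel \<and> (\<forall>x. 0 \<le> f' x \<and> f' x \<le> C) \<and> (AE x in lborel. indicator \<Omega> x * f x = f' x)"
proof -
  obtain C where C: "AE x\<in>\<Omega> in lebesgue. \<bar>f x\<bar> \<le> C" using f by (auto simp: Linfty_on_def)
  have fm: "set_borel_measurable lebesgue \<Omega> f" using f by (simp add: Linfty_on_def)
  obtain h where h: "h \<in> borel_measurable borel" "AE x in lborel. indicator \<Omega> x * f x = h x"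
    by (rule set_borel_representative[OF fm], rule that)
  have "AE x in lborel. x \<in> \<Omega> \<longrightarrow> \<bar>f x\<bar> \<le> C" "AE x in lborel. x \<in> \<Omega> \<longrightarrow> 0 \<le> f x"
    using C pos by (simp_all add: AE_completion_iff)
  with h(2) have "AE x in lborel. indicator \<Omega> x * f x = max 0 (min (max 0 C) (h x))"
  proof eventually_elim
    case (elim x)
    then show ?case by (cases "x \<in> \<Omega>") (auto simp: max_def min_def)
  qed
  moreover have "(\<lambda>x. max 0 (min (max 0 C) (h x))) \<in> borel_measurable borel" using h(1) by measurable
  ultimately show ?thesis
    by (intro exI[of _ "\<lambda>x. max 0 (min (max 0 C) (h x))"] exI[of _ "max 0 C"]) auto
qed

lemma L2_representative:
  fixes g :: "'a::euclidean_space \<Rightarrow> real"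
  assumes g: "L2_on \<Omega> g"
  shows "\<exists>g'. g' \<in> borel_measurable borel \<and> L2sq g' < \<infinity> \<and> (AE x in lborel. indicator \<Omega> x * g x = g' x)"
proof -
  have gm: "set_borel_measurable lebesgue \<Omega> g" using g by (simp add: L2_on_def)
  obtain h where h: "h \<in> borel_measurable borel" "AE x in lborel. indicator \<Omega> x * g x = h x"
    by (rule set_borel_representative[OF gm], rule that)
  have "integrable lebesgue (\<lambda>x. (indicator \<Omega> x * g x)\<^sup>2)"
  proof -
    have "(\<lambda>x. (indicator \<Omega> x * g x)\<^sup>2) = (\<lambda>x. indicator \<Omega> x *\<^sub>R (g x)\<^sup>2)"
      by (auto simp: fun_eq_iff indicator_def)
    then show ?thesis using g by (simp add: L2_on_def set_integrable_def)
  qed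
  then have "integrable lborel (\<lambda>x. (h x)\<^sup>2)"
    by (subst (asm) integrable_lebesgue_representative)
       (use h gm in \<open>auto simp: set_borel_measurable_def\<close>)
  then have "L2sq h < \<infinity>" by (auto simp: L2sq_def integrable_iff_bounded)
  with h show ?thesis by blast
qed

lemma weak_gradient_works:
  assumes "u \<in> W12" shows "has_weak_gradient u (weak_gradient u)"
proof -
  obtain G where "has_weak_gradient u G" using assms unfolding W12_def by blast
  then show ?thesis unfolding weak_gradient_def by (rule someI[where P="has_weak_gradient u"])
qed

lemma gradient_integral_representative:
  assumes "u \<in> W12" "sobolev_pair u' G" "AE x in lborel. weak_gradient u x = G x"
  shows "(LINT x|lebesgue. (norm (weak_gradient u x))\<^sup>2) = enn2real (L2sq G)"
proof -
  have "weak_gradient u \<in> borel_measurable lebesgue"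
    using weak_gradient_works[OF assms(1)] by (simp add: has_weak_gradient_def)
  then have "(LINT x|lebesgue. (norm (weak_gradient u x))\<^sup>2) = (LINT x|lborel. (norm (G x))\<^sup>2)"
    using assms(3) sobolev_measurable[OF assms(2)] by (intro integral_lebesgue_representative) auto
  then show ?thesis
    by (simp add: L2sq_integrable(2)[OF sobolev_measurable(2)[OF assms(2)] sobolev_gradient_finite[OF assms(2)]])
qed

text \<open>Borel counterpart of the lower order part of the energy of one component; the coefficients are
  extended by zero outside \<open>\<Omega>\<close>.\<close>

abbreviation lower_order ::
    "('a::euclidean_space \<Rightarrow> real) \<Rightarrow> ('a \<Rightarrow> real) \<Rightarrow> ('a \<Rightarrow> real) \<Rightarrow> real" where
  "lower_order f g u \<equiv> LINT x|lborel. (u x)\<^sup>2 * f x - u x * g x"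

lemma lower_order_representative:
  fixes u :: "'a::euclidean_space \<Rightarrow> real"
  assumes u: "u \<in> borel_measurable lebesgue" "u' \<in> borel_measurable borel" "AE x in lborel. u x = u' x"
    and f: "set_borel_measurable lebesgue \<Omega> f" "f' \<in> borel_measurable borel" "AE x in lborel. indicator \<Omega> x * f x = f' x"
    and g: "set_borel_measurable lebesgue \<Omega> g" "g' \<in> borel_measurable borel" "AE x in lborel. indicator \<Omega> x * g x = g' x"
  shows "(LINT x:\<Omega>|lebesgue. ((u x)\<^sup>2 * f x - u x * g x)) = lower_order f' g' u'"
proof -
  have "(LINT x:\<Omega>|lebesgue. ((u x)\<^sup>2 * f x - u x * g x))
    = (LINT x|lebesgue. (u x)\<^sup>2 * (indicator \<Omega> x * f x) - u x * (indicator \<Omega> x * g x))"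
    by (simp add: set_lebesgue_integral_def right_diff_distrib mult.left_commute)
  also have "\<dots> = lower_order f' g' u'"
  proof (rule integral_lebesgue_representative)
    show "(\<lambda>x. (u x)\<^sup>2 * (indicator \<Omega> x * f x) - u x * (indicator \<Omega> x * g x)) \<in> borel_measurable lebesgue"
      using f(1) g(1) unfolding set_borel_measurable_def real_scaleR_def
      by (intro borel_measurable_diff borel_measurable_times[OF borel_measurable_power[OF u(1)]] borel_measurable_times[OF u(1)])
    show "AE x in lborel. (u x)\<^sup>2 * (indicator \<Omega> x * f x) - u x * (indicator \<Omega> x * g x) = (u' x)\<^sup>2 * f' x - u' x * g' x"
      using u(3) f(3) g(3) by eventually_elim simp
  qed (use u f g in auto)
  finally show ?thesis .
qed

lemma weighted_square_integrable:
  fixes u f :: "'a::euclidean_space \<Rightarrow> real"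
  assumes [measurable]: "u \<in> borel_measurable borel" "f \<in> borel_measurable borel"
    and u: "L2sq u < \<infinity>" and f: "\<And>x. 0 \<le> f x \<and> f x \<le> C"
  shows "integrable lborel (\<lambda>x. (u x)\<^sup>2 * f x)" "(LINT x|lborel. (u x)\<^sup>2 * f x) \<le> C * (LINT x|lborel. (u x)\<^sup>2)"
    "0 \<le> (LINT x|lborel. (u x)\<^sup>2 * f x)"
proof -
  have i: "integrable lborel (\<lambda>x. C * (u x)\<^sup>2)"
    using L2sq_integrable(1)[OF assms(1) u] by simp
  have le: "(u x)\<^sup>2 * f x \<le> C * (u x)\<^sup>2" for x
    using mult_left_mono[of "f x" C "(u x)\<^sup>2"] f by (simp add: mult.commute)
  show i': "integrable lborel (\<lambda>x. (u x)\<^sup>2 * f x)"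
  proof (rule Bochner_Integration.integrable_bound[OF i])
    have "norm ((u x)\<^sup>2 * f x) \<le> norm (C * (u x)\<^sup>2)" for x
      using le[of x] mult_nonneg_nonneg[of "(u x)\<^sup>2" "f x"] f[of x] unfolding real_norm_def by auto
    then show "AE x in lborel. norm ((u x)\<^sup>2 * f x) \<le> norm (C * (u x)\<^sup>2)" by simp
  qed auto
  show "(LINT x|lborel. (u x)\<^sup>2 * f x) \<le> C * (LINT x|lborel. (u x)\<^sup>2)"
    using integral_mono[OF i' i le] by simp
  show "0 \<le> (LINT x|lborel. (u x)\<^sup>2 * f x)"
    by (rule integral_nonneg_AE) (use f in auto)
qed

text \<open>The linear term is absorbed: \<open>\<bar>u g\<bar> \<le> d u\<^sup>2 + g\<^sup>2 / d\<close>, and by the Poincare inequality half of the Dirichlet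
  integral suffices to compensate \<open>d u\<^sup>2\<close> if \<open>d\<close> is small.\<close>

lemma component_coercive:
  fixes \<Omega> :: "'a::euclidean_space set"
  assumes \<Omega>: "\<Omega> \<in> sets borel" "emeasure lborel \<Omega> < \<infinity>"
    and fm: "f \<in> borel_measurable borel" and f: "\<And>x. 0 \<le> f x \<and> f x \<le> M"
    and gm: "g \<in> borel_measurable borel" and g: "L2sq g < \<infinity>"
  shows "\<exists>C K. C \<ge> 0 \<and> (\<forall>u G. sobolev_pair u G \<longrightarrow> (AE x in lborel. x \<notin> \<Omega> \<longrightarrow> u x = 0) \<longrightarrow>
      L2sq u \<le> ennreal (C * enn2real (L2sq G)) \<and>
      enn2real (L2sq G) / 2 - K \<le> enn2real (L2sq G) + lower_order f g u)"
proof -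
  obtain C where C: "C \<ge> 0" "\<And>u G. sobolev_pair u G \<Longrightarrow> (AE x in lborel. x \<notin> \<Omega> \<longrightarrow> u x = 0) \<Longrightarrow>
      L2sq u \<le> ennreal C * L2sq G"
    using poincare_finite_measure[OF \<Omega>] by blast
  define d where "d = 1 / (2 * (C + 1))"
  have d: "d > 0" "d * C \<le> 1 / 2" using C(1) by (auto simp: d_def field_simps)
  define K where "K = (LINT x|lborel. (g x)\<^sup>2 / d)"
  have ig: "integrable lborel (\<lambda>x. (g x)\<^sup>2 / d)" using L2sq_integrable(1)[OF gm g] by simp
  have "L2sq u \<le> ennreal (C * enn2real (L2sq G)) \<and>
      enn2real (L2sq G) / 2 - K \<le> enn2real (L2sq G) + lower_order f g u"
    if uG: "sobolev_pair u G" and z: "AE x in lborel. x \<notin> \<Omega> \<longrightarrow> u x = 0" for u G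
  proof -
    note um = sobolev_measurable(1)[OF uG]
    define a where "a = enn2real (L2sq G)"
    have a: "L2sq G = ennreal a" "a \<ge> 0"
      using sobolev_gradient_finite[OF uG] by (auto simp: a_def)
    have 1: "L2sq u \<le> ennreal (C * a)"
      using C(2)[OF uG z] C(1) a by (simp add: ennreal_mult)
    then have fin: "L2sq u < \<infinity>" using le_less_trans[OF 1 ennreal_less_top] by simp
    have iu: "integrable lborel (\<lambda>x. (u x)\<^sup>2)" and u2: "(LINT x|lborel. (u x)\<^sup>2) \<le> C * a"
      using L2sq_integrable[OF um fin] 1 C(1) a by (auto simp: ennreal_le_iff)
    have if': "integrable lborel (\<lambda>x. (u x)\<^sup>2 * f x)" by (rule weighted_square_integrable(1)[OF um fm fin f])
    have iug: "integrable lborel (\<lambda>x. u x * g x)" by (rule integrable_L2_mult[OF um gm fin g])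
    have "- (d * (C * a)) - K \<le> - (d * (LINT x|lborel. (u x)\<^sup>2)) - K"
      using d u2 by (simp add: mult_left_mono)
    also have "\<dots> = (LINT x|lborel. - (d * (u x)\<^sup>2) - (g x)\<^sup>2 / d)"
      using iu ig by (simp add: K_def)
    also have "\<dots> \<le> lower_order f g u"
    proof (rule integral_mono)
      fix x
      have "2 * (d * \<bar>u x\<bar>) * \<bar>g x\<bar> \<le> (d * \<bar>u x\<bar>)\<^sup>2 + \<bar>g x\<bar>\<^sup>2" by (rule sum_squares_bound)
      then have "d * (2 * \<bar>u x * g x\<bar>) \<le> d * (d * (u x)\<^sup>2 + (g x)\<^sup>2 / d)"
        using d by (simp add: abs_mult distrib_left power2_eq_square mult_ac)
      then have "2 * \<bar>u x * g x\<bar> \<le> d * (u x)\<^sup>2 + (g x)\<^sup>2 / d" using d by simp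
      moreover have "0 \<le> (u x)\<^sup>2 * f x" using f by simp
      ultimately show "- (d * (u x)\<^sup>2) - (g x)\<^sup>2 / d \<le> (u x)\<^sup>2 * f x - u x * g x"
        using abs_ge_self[of "u x * g x"] abs_ge_zero[of "u x * g x"] by linarith
    qed (use iu ig if' iug in auto)
    finally have "- (d * (C * a)) - K \<le> lower_order f g u" .
    moreover have "d * (C * a) \<le> a / 2" using mult_right_mono[OF d(2) a(2)] by (simp add: mult.assoc)
    ultimately have "a / 2 - K \<le> a + lower_order f g u" by linarith
    with 1 show ?thesis by (simp add: a_def)
  qed
  with C(1) show ?thesis by blast
qed

section \<open>Existence of minimizers\<close>

text \<open>Admissible pairs and their energy in terms of Borel representatives. Weak gradients are part of
  the data.\<close>

definition borel_admissible ::
    "'a::euclidean_space set \<Rightarrow> (('m::finite \<Rightarrow> 'a \<Rightarrow> real) \<times> ('m \<Rightarrow> 'a \<Rightarrow> 'a) \<times> ('m \<Rightarrow> 'a set)) set" where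
  "borel_admissible \<Omega> = {(u, G, W). W \<in> disjoint_tuples \<Omega> \<and>
     (\<forall>i. sobolev_pair (u i) (G i) \<and> (AE x in lborel. x \<notin> W i \<longrightarrow> u i x = 0))}"

definition borel_energy ::
    "('m::finite \<Rightarrow> 'a::euclidean_space \<Rightarrow> real) \<Rightarrow> ('m \<Rightarrow> 'a \<Rightarrow> real) \<Rightarrow> (('m \<Rightarrow> 'a set) \<Rightarrow> real) \<Rightarrow>
     ('m \<Rightarrow> 'a \<Rightarrow> real) \<Rightarrow> ('m \<Rightarrow> 'a \<Rightarrow> 'a) \<Rightarrow> ('m \<Rightarrow> 'a set) \<Rightarrow> real" where
  "borel_energy f g F u G W = (\<Sum>i\<in>UNIV. enn2real (L2sq (G i)))
     + (\<Sum>i\<in>UNIV. lower_order (f i) (g i) (u i)) + F W"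

lemma finite_common_subseq:
  assumes "finite I"
    and ex: "\<And>i s. i \<in> I \<Longrightarrow> strict_mono (s :: nat \<Rightarrow> nat) \<Longrightarrow> \<exists>r. strict_mono r \<and> P i (s \<circ> r)"
    and stable: "\<And>i s r. P i s \<Longrightarrow> strict_mono (r :: nat \<Rightarrow> nat) \<Longrightarrow> P i (s \<circ> r)"
  shows "\<exists>r. strict_mono r \<and> (\<forall>i\<in>I. P i r)"
  using assms(1) ex
proof (induction I rule: finite_induct)
  case empty
  show ?case by (auto intro: exI[of _ id] simp: strict_mono_def)
next
  case (insert j I)
  then obtain r where r: "strict_mono r" "\<forall>i\<in>I. P i r" by blast
  obtain r' where r': "strict_mono r'" "P j (r \<circ> r')" using insert.prems[of j r] r(1) by blast
  show ?case
  proof (intro exI conjI ballI)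
    show "strict_mono (r \<circ> r')" by (rule strict_mono_o[OF r(1) r'(1)])
    show "P i (r \<circ> r')" if "i \<in> insert j I" for i
      using that r(2) r' stable by (cases "i = j") blast+
  qed
qed

text \<open>The lower limits \<open>S i\<close> of the sets are disjoint, as a common point of two of them would lie in \<open>W k i\<close> and
  in \<open>W k j\<close> for large \<open>k\<close>, and by continuity from below \<open>|S i| \<le> \<mu> i\<close>. The missing volumes fit into the rest of
  \<open>\<Omega>\<close>, because the limits \<open>\<mu> i\<close> add up to at most \<open>|\<Omega>|\<close>.\<close>

lemma liminf_sets_properties:
  fixes W :: "nat \<Rightarrow> 'm::finite \<Rightarrow> 'a::euclidean_space set"
  assumes W: "\<And>k. W k \<in> disjoint_tuples \<Omega>" and \<Omega>: "\<Omega> \<in> sets borel" "emeasure lborel \<Omega> < \<infinity>"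
    and mu: "\<And>i. (\<lambda>k. measure lborel (W k i)) \<longlonglongrightarrow> \<mu> i"
  shows "\<exists>W0\<in>disjoint_tuples \<Omega>. (\<forall>i. measure lborel (W0 i) = \<mu> i \<and> (\<forall>x. (\<exists>m. \<forall>k\<ge>m. x \<in> W k i) \<longrightarrow> x \<in> W0 i))"
proof -
  define S where "S i = (\<Union>m. \<Inter>k\<in>{m..}. W k i)" for i
  have Wb: "W k i \<in> sets borel" "W k i \<subseteq> \<Omega>" "disjoint_family (W k)" for k i
    using W[of k] by (auto simp: disjoint_tuples_def)
  have \<Omega>f: "\<Omega> \<in> fmeasurable lborel" using \<Omega> by (intro fmeasurableI) auto
  have Wf: "W k i \<in> fmeasurable lborel" for k i using fmeasurableI2[OF \<Omega>f Wb(2)] Wb(1) by simp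
  have [measurable]: "W k i \<in> sets borel" for k i by (rule Wb)
  have Sb: "S i \<in> sets borel" for i unfolding S_def by measurable
  have S\<Omega>: "S i \<subseteq> \<Omega>" for i unfolding S_def using Wb(2) by blast
  have Sf: "S i \<in> fmeasurable lborel" for i using fmeasurableI2[OF \<Omega>f S\<Omega>] Sb by simp
  have Sdisj: "S i \<inter> S j = {}" if "i \<noteq> j" for i j
  proof (rule ccontr)
    assume "S i \<inter> S j \<noteq> {}"
    then obtain x where x: "x \<in> S i" "x \<in> S j" by blast
    from x(1) obtain m where "\<forall>k\<in>{m..}. x \<in> W k i" by (auto simp: S_def)
    moreover from x(2) obtain n where "\<forall>k\<in>{n..}. x \<in> W k j" by (auto simp: S_def)
    ultimately have "x \<in> W (max m n) i" "x \<in> W (max m n) j" by auto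
    then show False using Wb(3)[of "max m n"] that by (auto simp: disjoint_family_on_def)
  qed
  have S\<mu>: "measure lborel (S i) \<le> \<mu> i" for i
  proof -
    let ?D = "\<lambda>m. \<Inter>k\<in>{m..}. W k i"
    have sub: "?D m \<subseteq> W k i" if "k \<ge> m" for m k using that by auto
    have "(\<lambda>m. measure lborel (?D m)) \<longlonglongrightarrow> measure lborel (\<Union>m. ?D m)"
    proof (rule Lim_measure_incseq)
      show "incseq ?D" by (auto simp: incseq_def)
      show "emeasure lborel (\<Union>m. ?D m) \<noteq> \<infinity>"
        using Sf[of i] by (simp add: S_def fmeasurable_def)
    qed auto
    moreover have "measure lborel (?D m) \<le> \<mu> i" for m
    proof (rule LIMSEQ_le_const[OF mu])
      have "measure lborel (?D m) \<le> measure lborel (W k i)" if "k \<ge> m" for k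
        using that by (intro measure_mono_fmeasurable Wf sub) auto
      then show "\<exists>N. \<forall>k\<ge>N. measure lborel (?D m) \<le> measure lborel (W k i)" by blast
    qed
    ultimately show ?thesis unfolding S_def by (intro LIMSEQ_le_const2) auto
  qed
  have sum_le: "(\<Sum>i\<in>UNIV. \<mu> i) \<le> measure lborel \<Omega>"
  proof (rule LIMSEQ_le_const2)
    show "(\<lambda>k. \<Sum>i\<in>UNIV. measure lborel (W k i)) \<longlonglongrightarrow> (\<Sum>i\<in>UNIV. \<mu> i)" by (intro tendsto_sum mu)
    have "(\<Sum>i\<in>UNIV. measure lborel (W k i)) = measure lborel (\<Union>i. W k i)" for k
      using Wf Wb(3) by (intro measure_finite_Union[symmetric]) (auto simp: fmeasurable_def less_top)
    moreover have "measure lborel (\<Union>i. W k i) \<le> measure lborel \<Omega>" for k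
      using Wb(2) by (intro measure_mono_fmeasurable \<Omega>f) auto
    ultimately show "\<exists>N. \<forall>k\<ge>N. (\<Sum>i\<in>UNIV. measure lborel (W k i)) \<le> measure lborel \<Omega>" by simp
  qed
  \<comment> \<open>The part of \<open>\<Omega>\<close> that is available for filling up the volumes.\<close>
  define R where "R = \<Omega> - (\<Union>i. S i)"
  have Rb: "R \<in> sets borel" unfolding R_def using \<Omega>(1) Sb by (intro sets.Diff sets.finite_UN) auto
  have R\<Omega>: "R \<subseteq> \<Omega>" by (auto simp: R_def)
  have Rf: "R \<in> fmeasurable lborel" using fmeasurableI2[OF \<Omega>f R\<Omega>] Rb by simp
  have "measure lborel (\<Union>i. S i) = (\<Sum>i\<in>UNIV. measure lborel (S i))"
    using Sf Sdisj by (intro measure_finite_Union) (auto simp: fmeasurable_def less_top disjoint_family_on_def)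
  moreover have "measure lborel R = measure lborel \<Omega> - measure lborel (\<Union>i. S i)"
    unfolding R_def using Sf S\<Omega> by (intro measurable_measure_Diff \<Omega>f) (auto intro!: sets.finite_UN simp: Sb)
  ultimately have R: "measure lborel R = measure lborel \<Omega> - (\<Sum>i\<in>UNIV. measure lborel (S i))" by simp
  have "\<exists>T. (\<forall>i\<in>UNIV. T i \<in> sets borel \<and> T i \<subseteq> R \<and> measure lborel (T i) = \<mu> i - measure lborel (S i)) \<and> disjoint_family_on T UNIV"
  proof (rule disjoint_subsets_of_measures[OF _ Rb])
    show "emeasure lborel R < \<infinity>" using Rf by (simp add: fmeasurable_def)
    show "(\<Sum>i\<in>UNIV. \<mu> i - measure lborel (S i)) \<le> measure lborel R"
      using sum_le R by (simp add: sum_subtractf)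
  qed (use S\<mu> in auto)
  then obtain T where T: "\<And>i. T i \<in> sets borel" "\<And>i. T i \<subseteq> R" "\<And>i. measure lborel (T i) = \<mu> i - measure lborel (S i)"
    "disjoint_family T" by blast
  define W0 where "W0 i = S i \<union> T i" for i
  have "W0 \<in> disjoint_tuples \<Omega>"
  proof -
    have "W0 i \<inter> W0 j = {}" if "i \<noteq> j" for i j
    proof -
      have "T i \<inter> T j = {}" using T(4) that by (auto simp: disjoint_family_on_def)
      moreover have "S i \<inter> T j = {}" "T i \<inter> S j = {}" using T(2)[of i] T(2)[of j] by (auto simp: R_def)
      ultimately show ?thesis using Sdisj[OF that] by (auto simp: W0_def)
    qed
    moreover have "W0 i \<in> sets borel" "W0 i \<subseteq> \<Omega>" for i
      using T(1) Sb S\<Omega>[of i] T(2)[of i] R\<Omega> by (auto simp: W0_def)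
    ultimately show ?thesis by (auto simp: disjoint_tuples_def disjoint_family_on_def)
  qed
  moreover have "measure lborel (W0 i) = \<mu> i" for i
  proof -
    have Tf: "T i \<in> fmeasurable lborel" using fmeasurableI2[OF Rf T(2)] T(1) by simp
    have "S i \<inter> T i = {}" using T(2)[of i] by (auto simp: R_def)
    then have "measure lborel (W0 i) = measure lborel (S i) + measure lborel (T i)"
      unfolding W0_def using Sf[of i] Tf by (intro measure_Un3[THEN trans]) auto
    then show ?thesis by (simp add: T(3))
  qed
  moreover have "x \<in> W0 i" if "\<exists>m. \<forall>k\<ge>m. x \<in> W k i" for x i
    using that by (auto simp: W0_def S_def)
  ultimately show ?thesis by blast
qed

lemma energy_eq_borel_energy:
  fixes f g :: "'m::finite \<Rightarrow> 'a::euclidean_space \<Rightarrow> real"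
  assumes u: "\<And>i. u i \<in> W12" "\<And>i. AE x in lborel. u i x = u' i x"
    and uG: "\<And>i. sobolev_pair (u' i) (G i)" "\<And>i. AE x in lborel. weak_gradient (u i) x = G i x"
    and f: "\<And>i. set_borel_measurable lebesgue \<Omega> (f i)" "\<And>i. f' i \<in> borel_measurable borel"
      "\<And>i. AE x in lborel. indicator \<Omega> x * f i x = f' i x"
    and g: "\<And>i. set_borel_measurable lebesgue \<Omega> (g i)" "\<And>i. g' i \<in> borel_measurable borel"
      "\<And>i. AE x in lborel. indicator \<Omega> x * g i x = g' i x"
  shows "energy \<Omega> f g F u W = borel_energy f' g' F u' G W"
proof -
  have "u i \<in> borel_measurable lebesgue" for i using u(1)[of i] by (auto simp: W12_def locally_L2_def)
  then show ?thesis
    unfolding energy_def borel_energy_def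
    by (simp add: gradient_integral_representative[OF u(1) uG]
        lower_order_representative[OF _ sobolev_measurable(1)[OF uG(1)] u(2) f g])
qed

lemma admissible_imp_borel_admissible:
  assumes "(u, W) \<in> admissible_pairs \<Omega>"
  shows "\<exists>u' G. (u', G, W) \<in> borel_admissible \<Omega> \<and> (\<forall>i. AE x in lborel. u i x = u' i x) \<and>
    (\<forall>i. AE x in lborel. weak_gradient (u i) x = G i x)"
proof -
  have W: "W \<in> disjoint_tuples \<Omega>" and u: "u i \<in> W12" and z: "AE x in lborel. x \<notin> W i \<longrightarrow> u i x = 0" for i
    using assms by (auto simp: admissible_pairs_def AE_completion_iff)
  have "\<exists>p. sobolev_pair (fst p) (snd p) \<and> (AE x in lborel. u i x = fst p x) \<and>
      (AE x in lborel. weak_gradient (u i) x = snd p x)" for i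
  proof -
    obtain v G where "sobolev_pair v G" "AE x in lborel. u i x = v x" "AE x in lborel. weak_gradient (u i) x = G x"
      by (rule W12_representative[OF u[of i]], rule that)
    then show ?thesis by (intro exI[of _ "(v, G)"]) auto
  qed
  then obtain p where p: "\<And>i. sobolev_pair (fst (p i)) (snd (p i))" "\<And>i. AE x in lborel. u i x = fst (p i) x"
      "\<And>i. AE x in lborel. weak_gradient (u i) x = snd (p i) x" by metis
  have "AE x in lborel. x \<notin> W i \<longrightarrow> fst (p i) x = 0" for i
    using z[of i] p(2)[of i] by eventually_elim auto
  then have "(\<lambda>i. fst (p i), \<lambda>i. snd (p i), W) \<in> borel_admissible \<Omega>"
    using W p(1) by (simp add: borel_admissible_def)
  with p(2,3) show ?thesis by blast
qed

lemma borel_admissible_imp_admissible: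
  assumes "(u, G, W) \<in> borel_admissible \<Omega>"
  shows "(u, W) \<in> admissible_pairs \<Omega>" "u i \<in> W12" "sobolev_pair (u i) (G i)"
    "AE x in lborel. weak_gradient (u i) x = G i x"
proof -
  have uG: "sobolev_pair (u i) (G i)" for i using assms by (simp add: borel_admissible_def)
  then show "u i \<in> W12" "sobolev_pair (u i) (G i)" "AE x in lborel. weak_gradient (u i) x = G i x" for i
    using sobolev_pair_W12[OF uG[of i]] by auto
  then show "(u, W) \<in> admissible_pairs \<Omega>"
    using assms by (auto simp: admissible_pairs_def borel_admissible_def AE_completion_iff)
qed

lemma sobolev_pair_zero: "sobolev_pair (\<lambda>x. 0) (\<lambda>x. 0)"
  by (simp add: sobolev_pair_def L2sq_def set_integrable_def)

text \<open>Along a common subsequence the functions converge almost everywhere and all real quantities in the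
  energy converge. Dirichlet integrals are lower semicontinuous, the integrals of \<open>u\<^sup>2 f\<close> are lower
  semicontinuous by Fatou's lemma, as \<open>f \<ge> 0\<close>, and the linear terms converge.\<close>

lemma borel_energy_minimizing_limit:
  fixes \<Omega> :: "'a::euclidean_space set" and f g :: "'m::finite \<Rightarrow> 'a \<Rightarrow> real"
    and u :: "nat \<Rightarrow> 'm \<Rightarrow> 'a \<Rightarrow> real"
  assumes \<Omega>: "\<Omega> \<in> sets borel" "emeasure lborel \<Omega> < \<infinity>"
    and f: "\<And>i. f i \<in> borel_measurable borel" "\<And>i x. 0 \<le> f i x \<and> f i x \<le> M i"
    and g: "\<And>i. g i \<in> borel_measurable borel" "\<And>i. L2sq (g i) < \<infinity>"
    and adm: "\<And>k. (u k, G k, W k) \<in> borel_admissible \<Omega>"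
    and A: "A \<ge> 0" "\<And>k i. L2sq (u k i) \<le> ennreal A" and B: "B \<ge> 0" "\<And>k i. L2sq (G k i) \<le> ennreal B"
  obtains r v H W0 l where "strict_mono r" "(v, H, W0) \<in> borel_admissible \<Omega>"
    "\<And>i. (\<lambda>k. measure lborel (W (r k) i)) \<longlonglongrightarrow> measure lborel (W0 i)"
    "(\<lambda>k. (\<Sum>i\<in>UNIV. enn2real (L2sq (G (r k) i)))
         + (\<Sum>i\<in>UNIV. lower_order (f i) (g i) (u (r k) i))) \<longlonglongrightarrow> l"
    "(\<Sum>i\<in>UNIV. enn2real (L2sq (H i)))
         + (\<Sum>i\<in>UNIV. lower_order (f i) (g i) (v i)) \<le> l"
proof -
  have uG: "sobolev_pair (u k i) (G k i)" and z: "AE x in lborel. x \<notin> W k i \<longrightarrow> u k i x = 0"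
    and W: "W k \<in> disjoint_tuples \<Omega>" for k i
    using adm[of k] by (auto simp: borel_admissible_def)
  have W\<Omega>: "W k i \<subseteq> \<Omega>" "W k i \<in> sets borel" for k i using W[of k] by (auto simp: disjoint_tuples_def)
  have z\<Omega>: "AE x in lborel. x \<notin> \<Omega> \<longrightarrow> u k i x = 0" for k i
    using z[of k i] by eventually_elim (use W\<Omega>(1)[of k i] in blast)
  note um = sobolev_measurable(1)[OF uG]
  have ufin: "L2sq (u k i) < \<infinity>" for k i using le_less_trans[OF A(2) ennreal_less_top] by simp
  define a where "a k i = enn2real (L2sq (G k i))" for k i
  define q where "q k i = (LINT x|lborel. (u k i x)\<^sup>2 * f i x)" for k i
  define m where "m k i = measure lborel (W k i)" for k i
  have aG: "L2sq (G k i) = ennreal (a k i)" for k i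
    using sobolev_gradient_finite[OF uG[of k i]] by (simp add: a_def)
  have a_bd: "0 \<le> a k i" "a k i \<le> B" for k i
    using B(2)[of k i] B(1) by (auto simp: a_def enn2real_leI)
  have M0: "M i \<ge> 0" for i using f(2)[of i undefined] by linarith
  have q_bd: "0 \<le> q k i" "q k i \<le> M i * A" for k i
  proof -
    show "0 \<le> q k i" unfolding q_def by (rule weighted_square_integrable(3)[OF um f(1) ufin f(2)])
    have "q k i \<le> M i * (LINT x|lborel. (u k i x)\<^sup>2)"
      unfolding q_def by (rule weighted_square_integrable(2)[OF um f(1) ufin f(2)])
    also have "\<dots> \<le> M i * A"
      using L2sq_integrable(2)[OF um ufin, of k i] A(2)[of k i] A(1) M0[of i]
      by (intro mult_left_mono) (auto simp: ennreal_le_iff)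
    finally show "q k i \<le> M i * A" .
  qed
  have m_bd: "0 \<le> m k i" "m k i \<le> measure lborel \<Omega>" for k i
    using \<Omega> W\<Omega> by (auto simp: m_def intro!: measure_mono_fmeasurable fmeasurableI)
  have conv: "\<exists>r. strict_mono r \<and> convergent (\<lambda>k. b (s (r k)))" if "\<And>k. 0 \<le> b k" "\<And>k. b k \<le> c"
    for b :: "nat \<Rightarrow> real" and c and s :: "nat \<Rightarrow> nat"
  proof -
    have "bounded (range (\<lambda>k. b (s k)))"
      by (rule bounded_subset[of "{0..c}"]) (use that in auto)
    from bounded_imp_convergent_subsequence[OF this] show ?thesis by (auto simp: convergent_def o_def)
  qed
  \<comment> \<open>The four kinds of convergence are indexed by a number, so that one extraction over a finite index set produces all of them.\<close>
  define P where "P p s \<longleftrightarrow> (case p of (i, c) \<Rightarrow>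
     if c = (0::nat) then (\<exists>v. v \<in> borel_measurable borel \<and> (AE x in lborel. (\<lambda>k. u (s k) i x) \<longlonglongrightarrow> v x))
     else if c = 1 then convergent (\<lambda>k. a (s k) i) else if c = 2 then convergent (\<lambda>k. q (s k) i)
     else convergent (\<lambda>k. m (s k) i))" for p :: "'m \<times> nat" and s :: "nat \<Rightarrow> nat"
  have "\<exists>r. strict_mono r \<and> (\<forall>p\<in>UNIV \<times> {..3}. P p r)"
  proof (rule finite_common_subseq)
    fix p :: "'m \<times> nat" and s :: "nat \<Rightarrow> nat" assume s: "strict_mono s"
    obtain i c where p: "p = (i, c)" by (cases p)
    consider "c = 0" | "c = 1" | "c = 2" | "c \<notin> {0, 1, 2}" by auto
    then show "\<exists>r. strict_mono r \<and> P p (s \<circ> r)"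
    proof cases
      case 1
      obtain r v where "strict_mono r" "v \<in> borel_measurable borel" "AE x in lborel. (\<lambda>k. u (s (r k)) i x) \<longlonglongrightarrow> v x"
        using sobolev_compactness[of "\<lambda>k. u (s k) i" "\<lambda>k. G (s k) i", OF uG \<Omega> z\<Omega> A(2) A(1) B(2) B(1)] by blast
      then show ?thesis using 1 by (auto simp: P_def p)
    next
      case 2
      then show ?thesis using conv[of "\<lambda>k. a k i" B s] a_bd by (auto simp: P_def p)
    next
      case 3
      then show ?thesis using conv[of "\<lambda>k. q k i" "M i * A" s] q_bd by (auto simp: P_def p)
    next
      case 4
      then show ?thesis using conv[of "\<lambda>k. m k i" "measure lborel \<Omega>" s] m_bd by (auto simp: P_def p)
    qed
  next
    fix p :: "'m \<times> nat" and s r :: "nat \<Rightarrow> nat" assume Ps: "P p s" and r: "strict_mono r"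
    have c: "convergent (\<lambda>k. b (s (r k)))" if "convergent (\<lambda>k. b (s k))" for b :: "nat \<Rightarrow> real"
      using convergent_subseq_convergent[OF that r] by (simp add: o_def)
    have t: "AE x in lborel. (\<lambda>k. u (s (r k)) i x) \<longlonglongrightarrow> v x" if "AE x in lborel. (\<lambda>k. u (s k) i x) \<longlonglongrightarrow> v x" for i v
      using that by eventually_elim (rule LIMSEQ_subseq_LIMSEQ[OF _ r, unfolded o_def])
    obtain i k where p: "p = (i, k)" by (cases p)
    show "P p (s \<circ> r)"
      using Ps t[of i] c[of "\<lambda>k. a k i"] c[of "\<lambda>k. q k i"] c[of "\<lambda>k. m k i"]
      unfolding P_def p by (auto split: if_splits)
  qed simp
  then obtain r where r: "strict_mono r" "\<And>i c. c \<le> 3 \<Longrightarrow> P (i, c) r" by auto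
  have "\<exists>v. v \<in> borel_measurable borel \<and> (AE x in lborel. (\<lambda>k. u (r k) i x) \<longlonglongrightarrow> v x)" for i
    using r(2)[of 0 i] by (simp add: P_def)
  then obtain v where v: "\<And>i. v i \<in> borel_measurable borel" "\<And>i. AE x in lborel. (\<lambda>k. u (r k) i x) \<longlonglongrightarrow> v i x"
    by metis
  have "\<exists>\<alpha>. (\<lambda>k. a (r k) i) \<longlonglongrightarrow> \<alpha>" for i using r(2)[of 1 i] by (simp add: P_def convergent_def)
  then obtain \<alpha> where \<alpha>: "\<And>i. (\<lambda>k. a (r k) i) \<longlonglongrightarrow> \<alpha> i" by metis
  have "\<exists>\<beta>. (\<lambda>k. q (r k) i) \<longlonglongrightarrow> \<beta>" for i using r(2)[of 2 i] by (simp add: P_def convergent_def)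
  then obtain \<beta> where \<beta>: "\<And>i. (\<lambda>k. q (r k) i) \<longlonglongrightarrow> \<beta> i" by metis
  have "\<exists>\<mu>. (\<lambda>k. m (r k) i) \<longlonglongrightarrow> \<mu>" for i using r(2)[of 3 i] by (simp add: P_def convergent_def)
  then obtain \<mu> where \<mu>: "\<And>i. (\<lambda>k. m (r k) i) \<longlonglongrightarrow> \<mu> i" by metis
  obtain W0 where W0: "W0 \<in> disjoint_tuples \<Omega>" "\<And>i. measure lborel (W0 i) = \<mu> i"
      "\<And>i x. (\<exists>m. \<forall>k\<ge>m. x \<in> W (r k) i) \<Longrightarrow> x \<in> W0 i"
    using liminf_sets_properties[of "\<lambda>k. W (r k)" \<Omega> \<mu>, OF W \<Omega>] \<mu> unfolding m_def by blast
  have vz: "AE x in lborel. x \<notin> W0 i \<longrightarrow> v i x = 0" for i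
  proof -
    have "AE x in lborel. \<forall>k. x \<notin> W (r k) i \<longrightarrow> u (r k) i x = 0"
      using z by (simp add: AE_all_countable)
    with v(2)[of i] show ?thesis
    proof eventually_elim
      case (elim x)
      show ?case
      proof (rule impI, rule ccontr)
        assume x: "x \<notin> W0 i" "v i x \<noteq> 0"
        have "eventually (\<lambda>k. u (r k) i x \<noteq> 0) sequentially"
          by (rule tendsto_imp_eventually_ne[OF elim(1) x(2)])
        then obtain m where "\<And>k. k \<ge> m \<Longrightarrow> u (r k) i x \<noteq> 0" by (auto simp: eventually_sequentially)
        then have "\<forall>k\<ge>m. x \<in> W (r k) i" using elim(2) by blast
        then show False using W0(3) x(1) by blast
      qed
    qed
  qed
  have "\<exists>H. sobolev_pair (v i) H \<and> L2sq H \<le> ennreal (\<alpha> i)" for i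
    by (rule sobolev_lower_semicontinuous[OF uG v(1) v(2) A(2) _ \<alpha>]) (simp add: aG)
  then obtain H where H: "\<And>i. sobolev_pair (v i) (H i)" "\<And>i. L2sq (H i) \<le> ennreal (\<alpha> i)" by metis
  have \<alpha>0: "\<alpha> i \<ge> 0" for i by (rule LIMSEQ_le_const[OF \<alpha>]) (use a_bd in auto)
  have H\<alpha>: "enn2real (L2sq (H i)) \<le> \<alpha> i" for i using H(2)[of i] \<alpha>0 by (simp add: enn2real_leI)
  have vA: "L2sq (v i) \<le> ennreal A" for i
    by (rule L2_Fatou[OF um v(2) A(2) tendsto_const])
  have vfin: "L2sq (v i) < \<infinity>" for i using le_less_trans[OF vA ennreal_less_top] by simp
  have \<beta>0: "\<beta> i \<ge> 0" for i by (rule LIMSEQ_le_const[OF \<beta>]) (use q_bd in auto)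
  have v\<beta>: "(LINT x|lborel. (v i x)\<^sup>2 * f i x) \<le> \<beta> i" for i
  proof -
    \<comment> \<open>With weight \<open>sqrt f\<close> the integral of \<open>u\<^sup>2 f\<close> becomes a squared norm, to which Fatou's lemma in the form above applies.\<close>
    have sq: "L2sq (\<lambda>x. w x * sqrt (f i x)) = ennreal (LINT x|lborel. (w x)\<^sup>2 * f i x)"
      if "w \<in> borel_measurable borel" "L2sq w < \<infinity>" for w
    proof -
      have "L2sq (\<lambda>x. w x * sqrt (f i x)) = (\<integral>\<^sup>+x. ennreal ((w x)\<^sup>2 * f i x) \<partial>lborel)"
        unfolding L2sq_def using f(2) by (intro nn_integral_cong) (simp add: power_mult_distrib)
      also have "\<dots> = ennreal (LINT x|lborel. (w x)\<^sup>2 * f i x)"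
        by (rule nn_integral_eq_integral[OF weighted_square_integrable(1)[OF that(1) f(1) that(2) f(2)]]) (use f(2) in auto)
      finally show ?thesis .
    qed
    have "L2sq (\<lambda>x. v i x * sqrt (f i x)) \<le> ennreal (\<beta> i)"
    proof (rule L2_Fatou[OF _ _ _ \<beta>])
      show "(\<lambda>x. u (r k) i x * sqrt (f i x)) \<in> borel_measurable borel" for k
        using um f(1) by (intro borel_measurable_times) (auto intro!: measurable_compose[OF f(1)])
      show "AE x in lborel. (\<lambda>k. u (r k) i x * sqrt (f i x)) \<longlonglongrightarrow> v i x * sqrt (f i x)"
        using v(2)[of i] by eventually_elim (intro tendsto_intros)
      show "L2sq (\<lambda>x. u (r k) i x * sqrt (f i x)) \<le> ennreal (q (r k) i)" for k
        using sq[OF um ufin] by (simp add: q_def)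
    qed
    then show ?thesis using sq[OF v(1) vfin] \<beta>0 by (simp add: ennreal_le_iff)
  qed
  have ug: "(\<lambda>k. LINT x|lborel. u (r k) i x * g i x) \<longlonglongrightarrow> (LINT x|lborel. v i x * g i x)" for i
    by (rule L2_bounded_AE_weak_convergence[OF um v(1) g(1) v(2) A(2) g(2)])
  have split: "lower_order (f i) (g i) w
      = (LINT x|lborel. (w x)\<^sup>2 * f i x) - (LINT x|lborel. w x * g i x)"
    if "w \<in> borel_measurable borel" "L2sq w < \<infinity>" for w i
    using weighted_square_integrable(1)[OF that(1) f(1)[of i] that(2) f(2)[of i]]
      integrable_L2_mult[OF that(1) g(1)[of i] that(2) g(2)[of i]]
    by (intro Bochner_Integration.integral_diff)
  let ?l = "(\<Sum>i\<in>UNIV. \<alpha> i) + (\<Sum>i\<in>UNIV. \<beta> i - (LINT x|lborel. v i x * g i x))"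
  have "(\<lambda>k. (\<Sum>i\<in>UNIV. a (r k) i) + (\<Sum>i\<in>UNIV. q (r k) i - (LINT x|lborel. u (r k) i x * g i x))) \<longlonglongrightarrow> ?l"
    by (intro tendsto_intros \<alpha> \<beta> ug)
  then have lim: "(\<lambda>k. (\<Sum>i\<in>UNIV. enn2real (L2sq (G (r k) i)))
         + (\<Sum>i\<in>UNIV. lower_order (f i) (g i) (u (r k) i))) \<longlonglongrightarrow> ?l"
    by (simp add: split[OF um ufin] a_def q_def)
  have le: "(\<Sum>i\<in>UNIV. enn2real (L2sq (H i)))
         + (\<Sum>i\<in>UNIV. lower_order (f i) (g i) (v i)) \<le> ?l"
    unfolding split[OF v(1) vfin] by (intro add_mono sum_mono diff_right_mono H\<alpha> v\<beta>)
  have adm0: "(v, H, W0) \<in> borel_admissible \<Omega>"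
    using W0(1) H(1) vz by (simp add: borel_admissible_def)
  have "(\<lambda>k. measure lborel (W (r k) i)) \<longlonglongrightarrow> measure lborel (W0 i)" for i
    using \<mu> by (simp add: m_def W0(2))
  from that[OF r(1) adm0 this lim le] show thesis .
qed

text \<open>By coercivity the energy is bounded below and its sublevel sets are bounded, so that the previous lemma
  applies to a minimizing sequence. The volume term is continuous along the sequence.\<close>

lemma borel_energy_minimizer:
  fixes \<Omega> :: "'a::euclidean_space set" and f g :: "'m::finite \<Rightarrow> 'a \<Rightarrow> real"
    and F :: "('m \<Rightarrow> 'a set) \<Rightarrow> real" and Ft :: "real ^ 'm \<Rightarrow> real"
  assumes \<Omega>: "\<Omega> \<in> sets borel" "emeasure lborel \<Omega> < \<infinity>"
    and f: "\<And>i. f i \<in> borel_measurable borel" "\<And>i x. 0 \<le> f i x \<and> f i x \<le> M i"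
    and g: "\<And>i. g i \<in> borel_measurable borel" "\<And>i. L2sq (g i) < \<infinity>"
    and Ft: "continuous_on {v. \<forall>i. v $ i \<in> {0..measure lborel \<Omega>}} Ft"
      "\<And>W. W \<in> disjoint_tuples \<Omega> \<Longrightarrow> F W = Ft (\<chi> i. measure lborel (W i))"
  shows "\<exists>(u0, G0, W0)\<in>borel_admissible \<Omega>. \<forall>(u, G, W)\<in>borel_admissible \<Omega>.
    borel_energy f g F u0 G0 W0 \<le> borel_energy f g F u G W"
proof -
  define S where "S = {v :: real ^ 'm. \<forall>i. v $ i \<in> {0..measure lborel \<Omega>}}"
  define vol where "vol W = (\<chi> i. measure lborel (W i))" for W :: "'m \<Rightarrow> 'a set"
  define J where "J p = (case p of (u, G, W) \<Rightarrow> borel_energy f g F u G W)" for p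
  have \<Omega>f: "\<Omega> \<in> fmeasurable lborel" using \<Omega> by (intro fmeasurableI) auto
  have volS: "vol W \<in> S" if "W \<in> disjoint_tuples \<Omega>" for W
    using that \<Omega>f by (auto simp: S_def vol_def disjoint_tuples_def intro!: measure_mono_fmeasurable)
  have "S = cbox 0 (\<chi> i. measure lborel \<Omega>)" by (auto simp: S_def mem_box_cart)
  then have "compact (Ft ` S)"
    using Ft(1) by (intro compact_continuous_image) (auto simp: S_def compact_cbox)
  then have "bounded (Ft ` S)" by (rule compact_imp_bounded)
  then obtain B where B: "\<And>v. v \<in> S \<Longrightarrow> \<bar>Ft v\<bar> \<le> B" unfolding bounded_iff by auto
  have FB: "- B \<le> F W" if "W \<in> disjoint_tuples \<Omega>" for W
    using B[OF volS[OF that]] Ft(2)[OF that] by (simp add: vol_def abs_le_iff)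
  define Q where "Q i C K \<longleftrightarrow> C \<ge> 0 \<and> (\<forall>u G. sobolev_pair u G \<longrightarrow> (AE x in lborel. x \<notin> \<Omega> \<longrightarrow> u x = 0) \<longrightarrow>
      L2sq u \<le> ennreal (C * enn2real (L2sq G)) \<and>
      enn2real (L2sq G) / 2 - K \<le> enn2real (L2sq G) + lower_order (f i) (g i) u)" for i C K
  have "\<exists>C K. Q i C K" for i
    unfolding Q_def by (rule component_coercive[OF \<Omega> f(1) f(2) g])
  then obtain C K where Q: "\<And>i. Q i (C i) (K i)" by metis
  have C0: "C i \<ge> 0" for i using Q[of i] unfolding Q_def by blast
  have CK: "L2sq u \<le> ennreal (C i * enn2real (L2sq G)) \<and>
      enn2real (L2sq G) / 2 - K i \<le> enn2real (L2sq G) + lower_order (f i) (g i) u"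
    if "sobolev_pair u G" "AE x in lborel. x \<notin> \<Omega> \<longrightarrow> u x = 0" for i u G
    using Q[of i] that unfolding Q_def by blast
  have lower: "(\<Sum>i\<in>UNIV. enn2real (L2sq (G i)) / 2) \<le> J (u, G, W) + (\<Sum>i\<in>UNIV. K i) + B"
    and L2u: "L2sq (u i) \<le> ennreal (C i * enn2real (L2sq (G i)))"
    if p: "(u, G, W) \<in> borel_admissible \<Omega>" for u G W i
  proof -
    have W: "W \<in> disjoint_tuples \<Omega>" and uG: "sobolev_pair (u i) (G i)"
      and z: "AE x in lborel. x \<notin> W i \<longrightarrow> u i x = 0" for i
      using p by (auto simp: borel_admissible_def)
    have W\<Omega>: "W i \<subseteq> \<Omega>" for i using W by (auto simp: disjoint_tuples_def)
    have z': "AE x in lborel. x \<notin> \<Omega> \<longrightarrow> u i x = 0" for i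
      using z[of i] by eventually_elim (use W\<Omega>[of i] in blast)
    show "L2sq (u i) \<le> ennreal (C i * enn2real (L2sq (G i)))" using CK[OF uG z'] by blast
    have "(\<Sum>i\<in>UNIV. enn2real (L2sq (G i)) / 2 - K i)
      \<le> (\<Sum>i\<in>UNIV. enn2real (L2sq (G i)) + lower_order (f i) (g i) (u i))"
      using CK[OF uG z'] by (intro sum_mono) blast
    then show "(\<Sum>i\<in>UNIV. enn2real (L2sq (G i)) / 2) \<le> J (u, G, W) + (\<Sum>i\<in>UNIV. K i) + B"
      using FB[OF W] by (simp add: J_def borel_energy_def sum.distrib sum_subtractf)
  qed
  have grad: "enn2real (L2sq (G i)) \<le> 2 * (J (u, G, W) + (\<Sum>i\<in>UNIV. K i) + B)"
    if "(u, G, W) \<in> borel_admissible \<Omega>" for u G W i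
  proof -
    have "enn2real (L2sq (G i)) / 2 \<le> (\<Sum>i\<in>UNIV. enn2real (L2sq (G i)) / 2)"
      by (rule member_le_sum) auto
    also have "\<dots> \<le> J (u, G, W) + (\<Sum>i\<in>UNIV. K i) + B" by (rule lower[OF that])
    finally show ?thesis by simp
  qed
  have bdd: "bdd_below (J ` borel_admissible \<Omega>)"
  proof (rule bdd_belowI2)
    fix p :: "('m \<Rightarrow> 'a \<Rightarrow> real) \<times> ('m \<Rightarrow> 'a \<Rightarrow> 'a) \<times> ('m \<Rightarrow> 'a set)"
    assume "p \<in> borel_admissible \<Omega>"
    moreover obtain u G W where p: "p = (u, G, W)" by (cases p)
    ultimately have "(\<Sum>i\<in>UNIV. enn2real (L2sq (G i)) / 2) \<le> J p + (\<Sum>i\<in>UNIV. K i) + B"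
      using lower by simp
    moreover have "0 \<le> (\<Sum>i\<in>UNIV. enn2real (L2sq (G i)) / 2)" by (intro sum_nonneg) auto
    ultimately show "- (\<Sum>i\<in>UNIV. K i) - B \<le> J p" by linarith
  qed
  have "(\<lambda>(i::'m) x. 0, \<lambda>i x. 0, \<lambda>i. {}) \<in> borel_admissible \<Omega>"
    by (simp add: borel_admissible_def sobolev_pair_zero disjoint_tuples_def disjoint_family_on_def)
  then have ne: "J ` borel_admissible \<Omega> \<noteq> {}" by blast
  define I where "I = Inf (J ` borel_admissible \<Omega>)"
  have I_le: "I \<le> J p" if "p \<in> borel_admissible \<Omega>" for p
    unfolding I_def using that bdd by (intro cInf_lower) auto
  have "\<exists>p\<in>borel_admissible \<Omega>. J p < I + 1 / real (Suc k)" for k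
    using cInf_lessD[OF ne, of "I + 1 / real (Suc k)"] unfolding I_def by auto
  then obtain p where p: "\<And>k. p k \<in> borel_admissible \<Omega>" "\<And>k. J (p k) < I + 1 / real (Suc k)" by metis
  define u where "u k = fst (p k)" for k
  define G where "G k = fst (snd (p k))" for k
  define W where "W k = snd (snd (p k))" for k
  have pk: "p k = (u k, G k, W k)" for k by (simp add: u_def G_def W_def)
  have adm: "(u k, G k, W k) \<in> borel_admissible \<Omega>" for k using p(1)[of k] by (simp add: pk)
  define D where "D = 2 * (I + 1 + (\<Sum>i\<in>UNIV. K i) + B)"
  have aD: "enn2real (L2sq (G k i)) \<le> D" for k i
  proof -
    have "J (u k, G k, W k) \<le> I + 1"
    proof -
      have "1 / real (Suc k) \<le> 1" by simp
      then show ?thesis using p(2)[of k] unfolding pk by linarith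
    qed
    then show ?thesis using grad[OF adm[of k], of i] by (simp add: D_def)
  qed
  have D0: "D \<ge> 0" using order_trans[OF enn2real_nonneg aD] .
  have GD: "L2sq (G k i) \<le> ennreal D" for k i
  proof -
    have "sobolev_pair (u k i) (G k i)" using adm[of k] by (simp add: borel_admissible_def)
    then have "L2sq (G k i) = ennreal (enn2real (L2sq (G k i)))" using sobolev_gradient_finite[of "u k i" "G k i"] by simp
    also have "\<dots> \<le> ennreal D" by (rule ennreal_leI[OF aD])
    finally show ?thesis .
  qed
  define A where "A = (\<Sum>i\<in>UNIV. C i * D)"
  have A0: "A \<ge> 0" unfolding A_def using C0 D0 by (intro sum_nonneg) simp
  have uA: "L2sq (u k i) \<le> ennreal A" for k i
  proof -
    have "C i * enn2real (L2sq (G k i)) \<le> C i * D" by (intro mult_left_mono aD C0)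
    also have "\<dots> \<le> A" unfolding A_def by (rule member_le_sum) (use C0 D0 in auto)
    finally show ?thesis using L2u[OF adm[of k], of i] ennreal_leI order_trans by blast
  qed
  obtain r v H W0 l where r: "strict_mono r" and vHW: "(v, H, W0) \<in> borel_admissible \<Omega>"
    and mu: "\<And>i. (\<lambda>k. measure lborel (W (r k) i)) \<longlonglongrightarrow> measure lborel (W0 i)"
    and lim: "(\<lambda>k. (\<Sum>i\<in>UNIV. enn2real (L2sq (G (r k) i)))
         + (\<Sum>i\<in>UNIV. lower_order (f i) (g i) (u (r k) i))) \<longlonglongrightarrow> l"
    and le: "(\<Sum>i\<in>UNIV. enn2real (L2sq (H i)))
         + (\<Sum>i\<in>UNIV. lower_order (f i) (g i) (v i)) \<le> l"
    by (rule borel_energy_minimizing_limit[where u = u and G = G and W = W and f = f and g = g and M = M,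
        OF \<Omega> f g adm A0 uA D0 GD], rule that)
  have Wd: "W k \<in> disjoint_tuples \<Omega>" "W0 \<in> disjoint_tuples \<Omega>" for k
    using adm[of k] vHW by (auto simp: borel_admissible_def)
  have "(\<lambda>k. Ft (vol (W (r k)))) \<longlonglongrightarrow> Ft (vol W0)"
  proof (rule continuous_on_tendsto_compose[OF Ft(1)])
    show "(\<lambda>k. vol (W (r k))) \<longlonglongrightarrow> vol W0"
      unfolding vol_def by (intro tendsto_vec_lambda mu)
  qed (use volS Wd in \<open>auto simp: S_def\<close>)
  then have "(\<lambda>k. F (W (r k))) \<longlonglongrightarrow> F W0"
    using Ft(2) Wd by (simp add: vol_def)
  from tendsto_add[OF lim this] have JL: "(\<lambda>k. J (p (r k))) \<longlonglongrightarrow> l + F W0"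
    by (simp add: J_def pk borel_energy_def)
  have "l + F W0 \<le> I + 0"
  proof (rule LIMSEQ_le[OF JL])
    have "(\<lambda>k. I + 1 / real (Suc k)) \<longlonglongrightarrow> I + 0"
      by (rule tendsto_add[OF tendsto_const LIMSEQ_inverse_real_of_nat[unfolded inverse_eq_divide]])
    from LIMSEQ_subseq_LIMSEQ[OF this r]
    show "(\<lambda>k. I + 1 / real (Suc (r k))) \<longlonglongrightarrow> I + 0" by (simp add: o_def)
    show "\<exists>N. \<forall>k\<ge>N. J (p (r k)) \<le> I + 1 / real (Suc (r k))"
      using p(2) less_imp_le by blast
  qed
  moreover have "J (v, H, W0) \<le> l + F W0" using le by (simp add: J_def borel_energy_def)
  ultimately have "J (v, H, W0) \<le> J q" if "q \<in> borel_admissible \<Omega>" for q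
    using I_le[OF that] by linarith
  with vHW show ?thesis unfolding J_def by (intro bexI[of _ "(v, H, W0)"]) fastforce+
qed

theorem theorem3p1:
  fixes \<Omega> :: "(real ^ 'n::finite) set"
    and f g :: "'m::finite \<Rightarrow> real ^ 'n \<Rightarrow> real"
    and F :: "('m \<Rightarrow> (real ^ 'n) set) \<Rightarrow> real"
  assumes "\<Omega> \<in> sets borel"
    and "emeasure lebesgue \<Omega> < \<infinity>"
    and "\<And>i. Linfty_on \<Omega> (f i)"
    and "\<And>i. AE x\<in>\<Omega> in lebesgue. f i x \<ge> 0"
    and "\<And>i. L2_on \<Omega> (g i)"
    and "\<exists>Ft :: real ^ 'm \<Rightarrow> real.
           continuous_on {v. \<forall>i. v $ i \<in> {0..measure lebesgue \<Omega>}} Ft \<and>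
           (\<forall>W\<in>disjoint_tuples \<Omega>. F W = Ft (\<chi> i. measure lebesgue (W i)))"
  shows "\<exists>(u0, W0)\<in>admissible_pairs \<Omega>. \<forall>(u, W)\<in>admissible_pairs \<Omega>.
           energy \<Omega> f g F u0 W0 \<le> energy \<Omega> f g F u W"
proof -
  have leb: "measure lebesgue A = measure lborel A" "emeasure lebesgue A = emeasure lborel A"
    if "A \<in> sets borel" for A :: "(real ^ 'n) set"
    using that by (simp_all add: measure_completion)
  have fin: "emeasure lborel \<Omega> < \<infinity>" using assms(1,2) leb by simp
  define Rf where "Rf i h C \<longleftrightarrow> h \<in> borel_measurable borel \<and> (\<forall>x. 0 \<le> h x \<and> h x \<le> C) \<and>
      (AE x in lborel. indicator \<Omega> x * f i x = h x)" for i h C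
  have "\<exists>h C. Rf i h C" for i
    unfolding Rf_def by (rule Linfty_representative[OF assms(3,4)])
  then obtain f' C where "\<And>i. Rf i (f' i) (C i)" by metis
  then have f': "\<And>i. f' i \<in> borel_measurable borel" "\<And>i x. 0 \<le> f' i x \<and> f' i x \<le> C i"
      "\<And>i. AE x in lborel. indicator \<Omega> x * f i x = f' i x" unfolding Rf_def by blast+
  define Rg where "Rg i h \<longleftrightarrow> h \<in> borel_measurable borel \<and> L2sq h < \<infinity> \<and>
      (AE x in lborel. indicator \<Omega> x * g i x = h x)" for i h
  have "\<exists>h. Rg i h" for i
    unfolding Rg_def by (rule L2_representative[OF assms(5)])
  then obtain g' where "\<And>i. Rg i (g' i)" by metis
  then have g': "\<And>i. g' i \<in> borel_measurable borel" "\<And>i. L2sq (g' i) < \<infinity>"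
      "\<And>i. AE x in lborel. indicator \<Omega> x * g i x = g' i x" unfolding Rg_def by blast+
  have fm: "set_borel_measurable lebesgue \<Omega> (f i)" for i using assms(3) by (simp add: Linfty_on_def)
  have gm: "set_borel_measurable lebesgue \<Omega> (g i)" for i using assms(5) by (simp add: L2_on_def)
  obtain Ft :: "real ^ 'm \<Rightarrow> real" where
      Ft: "continuous_on {v. \<forall>i. v $ i \<in> {0..measure lebesgue \<Omega>}} Ft"
        "\<And>W. W \<in> disjoint_tuples \<Omega> \<Longrightarrow> F W = Ft (\<chi> i. measure lebesgue (W i))"
    using assms(6) by blast
  have Ft1: "continuous_on {v. \<forall>i. v $ i \<in> {0..measure lborel \<Omega>}} Ft"
    using Ft(1) unfolding leb(1)[OF assms(1)] .
  have Ft2: "F W = Ft (\<chi> i. measure lborel (W i))" if "W \<in> disjoint_tuples \<Omega>" for W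
  proof -
    have "W i \<in> sets borel" for i using that by (simp add: disjoint_tuples_def)
    then show ?thesis using Ft(2)[OF that] leb(1) by simp
  qed
  obtain u0 G0 W0 where min: "(u0, G0, W0) \<in> borel_admissible \<Omega>"
    "\<And>u G W. (u, G, W) \<in> borel_admissible \<Omega> \<Longrightarrow> borel_energy f' g' F u0 G0 W0 \<le> borel_energy f' g' F u G W"
    using borel_energy_minimizer[where f = f' and g = g' and M = C and F = F and Ft = Ft,
        OF assms(1) fin f'(1,2) g'(1,2) Ft1 Ft2] by blast
  note a0 = borel_admissible_imp_admissible[OF min(1)]
  have e0: "energy \<Omega> f g F u0 W0 = borel_energy f' g' F u0 G0 W0"
    by (rule energy_eq_borel_energy[OF a0(2) _ a0(3,4) fm f'(1,3) gm g'(1,3)]) simp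
  have "energy \<Omega> f g F u0 W0 \<le> energy \<Omega> f g F u W" if uW: "(u, W) \<in> admissible_pairs \<Omega>" for u W
  proof -
    obtain u' G where uG: "(u', G, W) \<in> borel_admissible \<Omega>" "\<And>i. AE x in lborel. u i x = u' i x"
        "\<And>i. AE x in lborel. weak_gradient (u i) x = G i x"
      using admissible_imp_borel_admissible[OF uW] by blast
    have "u i \<in> W12" for i using uW by (simp add: admissible_pairs_def)
    then have "energy \<Omega> f g F u W = borel_energy f' g' F u' G W"
      by (rule energy_eq_borel_energy[OF _ uG(2) borel_admissible_imp_admissible(3)[OF uG(1)] uG(3) fm f'(1,3) gm g'(1,3)])
    then show ?thesis using e0 min(2)[OF uG(1)] by simp
  qed
  with a0(1) show ?thesis by blast
qed

end
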